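(* Let $\Sigma$ be a $d$-dimensional simplicial complex on $n$ vertices that admits a PL embedding into $\mathbb{R}^{d+1}$. Then $f_d(\Sigma)=\mathcal{O}(n^{d-\epsilon})$, where $\epsilon=3^{-\lceil\frac{d+1}{2}\rceil}$.
   Context: Simplicial complexes are finite. $\Sigma$ admits a PL embedding into $\mathbb{R}^k$ if some subdivision of its geometric realisation $\|\Sigma\|$ has a linear embedding (geometric realisation) in $\mathbb{R}^k$. $f_d(\Sigma)$ is the number of $d$-dimensional faces. The $\mathcal{O}$-notation is for fixed $d$ as $n\to\infty$: the implied constant depends only on $d$, not on $\Sigma$ or $n$.
   Formalization: The dimension is assumed to satisfy d ≥ 3; the claimed bound is false for d = 0 (n points on a line), d = 1 (a path in the plane) and d = 2 (the 2-skeleton of a Schlegel diagram of a cyclic 4-polytope, with n(n-3) triangles). *)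

theory Defs
  imports "HOL-Analysis.Analysis" "HOL-Analysis.Finite_Function_Topology"
begin

text \<open>
  Abstract simplicial complexes are finite; a nonempty one contains the empty face, of
  dimension \<open>-1\<close>, and its vertex set is \<open>\<Union>K\<close>. The library's \<^const>\<open>simplicial_complex\<close> is
  a geometric notion for sets of simplices in a Euclidean space; it does not cover abstract
  complexes, nor the standard realisation below, whose ambient space has a basis indexed by
  an arbitrary vertex type.
\<close>

definition abstract_complex :: "'v set set \<Rightarrow> bool" where
  "abstract_complex K \<longleftrightarrow>
     finite K \<and> (\<forall>\<sigma>\<in>K. finite \<sigma>) \<and> (\<forall>\<sigma>\<in>K. \<forall>\<tau>. \<tau> \<subseteq> \<sigma> \<longrightarrow> \<tau> \<in> K)"

definition complex_dim :: "'v set set \<Rightarrow> int" where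
  "complex_dim K = Max ((\<lambda>\<sigma>. int (card \<sigma>) - 1) ` K)"

definition num_faces :: "nat \<Rightarrow> 'v set set \<Rightarrow> nat" where
  "num_faces i K = card {\<sigma>\<in>K. card \<sigma> = i + 1}"

text \<open>
  A linear embedding of \<open>K\<close> is determined by its vertex map \<open>\<phi>\<close>: every face is sent to a
  nondegenerate simplex, and two simplices meet exactly in the simplex of their common face.
\<close>

definition linear_embedding :: "('v \<Rightarrow> 'e::real_vector) \<Rightarrow> 'v set set \<Rightarrow> bool" where
  "linear_embedding \<phi> K \<longleftrightarrow>
     inj_on \<phi> (\<Union>K) \<and>
     (\<forall>\<sigma>\<in>K. \<not> affine_dependent (\<phi> ` \<sigma>)) \<and>
     (\<forall>\<sigma>\<in>K. \<forall>\<tau>\<in>K. convex hull (\<phi> ` \<sigma>) \<inter> convex hull (\<phi> ` \<tau>) = convex hull (\<phi> ` (\<sigma> \<inter> \<tau>)))"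

definition underlying_space :: "('v \<Rightarrow> 'e::real_vector) \<Rightarrow> 'v set set \<Rightarrow> 'e set" where
  "underlying_space \<phi> K = (\<Union>\<sigma>\<in>K. convex hull (\<phi> ` \<sigma>))"

text \<open>
  The geometric realisation of \<open>K\<close> lives in the real vector space with basis the vertices
  (finitely supported functions), each vertex being sent to its basis vector.
\<close>

definition std_vertex :: "'v \<Rightarrow> ('v \<Rightarrow>\<^sub>0 real)" where
  "std_vertex v = Poly_Mapping.single v 1"

definition geom_realisation :: "'v set set \<Rightarrow> ('v \<Rightarrow>\<^sub>0 real) set" where
  "geom_realisation K = underlying_space std_vertex K"

text \<open>
  The vertices of a subdivision \<open>L\<close> of the geometric realisation of \<open>K\<close> are points of that
  realisation, so \<open>L\<close> is a set of sets of points, realised by the identity.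
\<close>

definition subdivision_of :: "('v \<Rightarrow>\<^sub>0 real) set set \<Rightarrow> 'v set set \<Rightarrow> bool" where
  "subdivision_of L K \<longleftrightarrow>
     abstract_complex L \<and> linear_embedding id L \<and>
     underlying_space id L = geom_realisation K \<and>
     (\<forall>\<sigma>\<in>L. \<exists>\<tau>\<in>K. convex hull \<sigma> \<subseteq> convex hull (std_vertex ` \<tau>))"

definition PL_embeddable :: "'e::real_vector itself \<Rightarrow> 'v set set \<Rightarrow> bool" where
  "PL_embeddable T K \<longleftrightarrow>
     (\<exists>L. subdivision_of L K \<and> (\<exists>\<psi> :: ('v \<Rightarrow>\<^sub>0 real) \<Rightarrow> 'e. linear_embedding \<psi> L))"

end

theory Submission
  imports Defs "HOL-Library.Z2" "HOL-Computational_Algebra.Polynomial"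
begin

text \<open>
  Let \<open>m = \<lceil>(d + 1) / 2\<rceil>\<close>. Two properties of a complex \<open>\<Sigma>\<close> that embeds in \<open>\<real>\<^sup>d\<^sup>+\<^sup>1\<close> give the bound.

  First, \<open>f_d = O(f_{d-1})\<close> (num_faces_codim1). The link of a \<open>(d - 2)\<close>-face behaves like a planar graph:
  if it had a minor \<open>K_6\<close>, then \<open>\<Sigma>\<close> would receive a chain map from the join of \<open>K_{3,3}\<close> with a
  simplex, which is impossible in this dimension. So the link has linearly many edges in terms of its
  vertices, and summing over all \<open>(d - 2)\<close>-faces compares \<open>f_d\<close> with \<open>f_{d-1}\<close>.

  Second, \<open>f_m = O(n^{m + 1 - 3^{-m}})\<close> (sparse_middle_faces). By the theorem of Erdos on multipartite
  hypergraphs, more \<open>m\<close>-faces would force a complete \<open>(m + 1)\<close>-partite complex with parts of size 3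
  inside \<open>\<Sigma>\<close>, and this complex does not embed by the theorem of van Kampen and Flores. As a
  \<open>(d - 1)\<close>-face is an \<open>m\<close>-face together with \<open>d - 1 - m\<close> further vertices,
  \<open>f_{d-1} \<le> f_m n^{d-1-m}\<close>, and multiplying the bounds gives the exponent \<open>d - 3^{-m}\<close>.

  Both obstructions are the same theorem (no_carried_map_from_flores): the join of \<open>a\<close> triples of points
  and a simplex with \<open>r\<close> vertices has no suitable chain map to a complex embedded in \<open>\<real>\<^sup>N\<close>,
  \<open>N + 2 = 2a + r\<close>. Its proof counts, modulo 2, the crossings between images of disjoint faces of
  complementary dimensions. The count does not change under chain homotopies
  (crossing_number_elementary_homotopy), so every chain map can be compared with the map that sends the
  vertices to the moment curve; there two faces cross exactly when their vertices alternate, which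
  happens for \<open>3^a\<close> pairs (card_alternating_opposite_faces). An embedding has no crossings, and
  \<open>3^a\<close> is odd. The passage from a PL embedding to chains only uses that a subdivision induces a chain map
  (carried_map_subdivided).
\<close>

section \<open>Simplicial chains modulo 2\<close>

text \<open>
  The type of bits serves as a field here. The default simplification rules turn its sums and products
  into logical operations, after which the laws of rings no longer apply.
\<close>
declare add_bit_eq_xor [simp del] mult_bit_eq_and [simp del]
  bit_not_zero_iff [simp del] bit_not_one_iff [simp del]

lemma bit_add_self [simp]: "x + x = (0::bit)"
  by (cases x) (auto simp: add_bit_eq_xor)

lemma bit_add_eq_0_iff: "x + y = (0::bit) \<longleftrightarrow> x = y"
  by (cases x; cases y) (auto simp: add_bit_eq_xor)

lemma bit_add_self_left: "x + (x + y) = (y::bit)"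
  by (simp flip: add.assoc)

text \<open>
  A chain is a function from finite vertex sets to the field with two elements. The empty set counts as
  a simplex, so that a vertex has the empty set as its boundary; in this augmented complex joins and
  cones need no special treatment in low dimensions.
\<close>
definition chain_boundary :: "'j set \<Rightarrow> ('j set \<Rightarrow> bit) \<Rightarrow> 'j set \<Rightarrow> bit" where
  "chain_boundary J c B = (\<Sum>j\<in>J - B. c (insert j B))"

text \<open>
  Pairs of a set and a point outside of it correspond to pairs of a set and a point inside of it. This
  double count moves a boundary operator from one factor of a sum to the other.
\<close>
lemma sum_insert_Pow:
  fixes g :: "'j set \<Rightarrow> 'j \<Rightarrow> 'b::comm_monoid_add"
  assumes "finite J"
  shows "(\<Sum>B\<in>Pow J. \<Sum>j\<in>J - B. g (insert j B) j) = (\<Sum>A\<in>Pow J. \<Sum>j\<in>A. g A j)"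
proof -
  have "(\<Sum>B\<in>Pow J. \<Sum>j\<in>J - B. g (insert j B) j) =
        (\<Sum>(B,j)\<in>Sigma (Pow J) (\<lambda>B. J - B). g (insert j B) j)"
    using assms by (simp add: sum.Sigma)
  also have "\<dots> = (\<Sum>(A,j)\<in>Sigma (Pow J) (\<lambda>A. A). g A j)"
    by (rule sum.reindex_bij_witness[where i = "\<lambda>(A,j). (A - {j}, j)"
          and j = "\<lambda>(B,j). (insert j B, j)"]) (auto simp: insert_absorb)
  also have "\<dots> = (\<Sum>A\<in>Pow J. \<Sum>j\<in>A. g A j)"
    using assms by (subst sum.Sigma) (auto intro: finite_subset)
  finally show ?thesis .
qed

text \<open>
  The terms of \<open>(x, y)\<close> and \<open>(y, x)\<close> cancel. This is the reason for \<open>\<partial>\<partial> = 0\<close>.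
\<close>
lemma sum_symmetric_off_diagonal:
  fixes f :: "'j \<Rightarrow> 'j \<Rightarrow> bit"
  assumes "finite S" and "\<And>x y. f x y = f y x"
  shows "(\<Sum>x\<in>S. \<Sum>y\<in>S - {x}. f x y) = 0"
  using assms(1)
proof (induction S rule: finite_induct)
  case (insert a S)
  have "(\<Sum>x\<in>insert a S. \<Sum>y\<in>insert a S - {x}. f x y) =
     (\<Sum>y\<in>S. f a y) + (\<Sum>x\<in>S. f x a + (\<Sum>y\<in>S - {x}. f x y))"
  proof -
    have "(\<Sum>y\<in>insert a S - {x}. f x y) = f x a + (\<Sum>y\<in>S - {x}. f x y)" if "x \<in> S" for x
    proof -
      have "insert a S - {x} = insert a (S - {x})" using that insert by auto
      then show ?thesis using insert by simp
    qed
    moreover have "insert a S - {a} = S" using insert by auto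
    ultimately show ?thesis using insert by simp
  qed
  also have "\<dots> = (\<Sum>y\<in>S. f a y) + (\<Sum>x\<in>S. f x a)"
    using insert.IH by (simp add: sum.distrib)
  also have "\<dots> = 0"
    using assms(2)[of a] by simp
  finally show ?case .
qed simp

lemma chain_boundary_twice:
  assumes "finite J"
  shows "chain_boundary J (chain_boundary J c) B = 0"
proof -
  have "chain_boundary J (chain_boundary J c) B = (\<Sum>x\<in>J - B. \<Sum>y\<in>(J - B) - {x}. c (insert y (insert x B)))"
    unfolding chain_boundary_def by (intro sum.cong) auto
  also have "\<dots> = 0"
    using assms by (intro sum_symmetric_off_diagonal) (auto simp: insert_commute)
  finally show ?thesis .
qed

lemma chain_boundary_add: "chain_boundary J (\<lambda>A. c A + c' A) B = chain_boundary J c B + chain_boundary J c' B"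
  by (simp add: chain_boundary_def sum.distrib)

lemma chain_boundary_sum: "chain_boundary J (\<lambda>A. \<Sum>i\<in>I. c i A) B = (\<Sum>i\<in>I. chain_boundary J (c i) B)"
  unfolding chain_boundary_def by (rule sum.swap)

text \<open>
  A simplex that already contains the apex has no cone. With this convention the formula
  \<open>\<partial>(y * c) = c + y * \<partial>c\<close> holds for all simplices, including those through \<open>y\<close>.
\<close>
definition chain_cone :: "'j \<Rightarrow> ('j set \<Rightarrow> bit) \<Rightarrow> 'j set \<Rightarrow> bit" where
  "chain_cone y c A = (if y \<in> A then c (A - {y}) else 0)"

lemma chain_boundary_cone_cycle:
  assumes "finite J" "y \<in> J" and cyc: "\<And>B. B \<subseteq> J \<Longrightarrow> chain_boundary J c B = 0" and B: "B \<subseteq> J"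
  shows "chain_boundary J (chain_cone y c) B = c B"
proof (cases "y \<in> B")
  case False
  have "chain_boundary J (chain_cone y c) B = (\<Sum>j\<in>J - B. if j = y then c B else 0)"
    unfolding chain_boundary_def chain_cone_def using False by (intro sum.cong) auto
  also have "\<dots> = c B" using assms False by (simp add: sum.delta)
  finally show ?thesis .
next
  case True
  have "0 = chain_boundary J c (B - {y})" using cyc[of "B - {y}"] B by auto
  also have "\<dots> = (\<Sum>j\<in>insert y (J - B). c (insert j (B - {y})))"
    unfolding chain_boundary_def using True B assms by (intro sum.cong) auto
  also have "\<dots> = c B + (\<Sum>j\<in>J - B. c (insert j (B - {y})))"
    using True assms by (simp add: insert_absorb)
  also have "(\<Sum>j\<in>J - B. c (insert j (B - {y}))) = chain_boundary J (chain_cone y c) B"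
    unfolding chain_boundary_def chain_cone_def using True by (intro sum.cong refl) (auto intro!: arg_cong[of _ _ c])
  finally show ?thesis by (metis bit_add_eq_0_iff)
qed

lemma chain_boundary_vertex_map:
  assumes finJ: "finite J" and fin: "finite \<sigma>" and inj: "inj_on y \<sigma>"
    and sub: "y ` \<sigma> \<subseteq> J" and B: "B \<subseteq> J"
  shows "chain_boundary J (\<lambda>A. of_bool (A = y ` \<sigma>)) B = (\<Sum>v\<in>\<sigma>. of_bool (B = y ` (\<sigma> - {v})))"
proof -
  have img: "y ` (\<sigma> - {v}) = y ` \<sigma> - {y v}" if "v \<in> \<sigma>" for v
    using inj_on_image_set_diff[OF inj, of \<sigma> "{v}"] that by simp
  have "chain_boundary J (\<lambda>A. of_bool (A = y ` \<sigma>)) B = (\<Sum>j\<in>J - B. of_bool (insert j B = y ` \<sigma>))"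
    by (simp add: chain_boundary_def)
  also have "\<dots> = (\<Sum>j\<in>y ` \<sigma>. of_bool (B = y ` \<sigma> - {j}))"
  proof (rule sum.mono_neutral_cong)
    show "finite (J - B)" "finite (y ` \<sigma>)" using finJ fin by auto
    show "of_bool (insert i B = y ` \<sigma>) = 0" if "i \<in> J - B - y ` \<sigma>" for i
      using that by auto
    show "of_bool (B = y ` \<sigma> - {i}) = 0" if i: "i \<in> y ` \<sigma> - (J - B)" for i
    proof -
      have "i \<in> B" using i sub by auto
      then show ?thesis by auto
    qed
    show "of_bool (insert x B = y ` \<sigma>) = of_bool (B = y ` \<sigma> - {x})" if "x \<in> (J - B) \<inter> y ` \<sigma>" for x
      using that by (intro arg_cong[of _ _ of_bool]) auto
  qed
  also have "\<dots> = (\<Sum>v\<in>\<sigma>. of_bool (B = y ` \<sigma> - {y v}))"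
    using inj by (subst sum.reindex) auto
  also have "\<dots> = (\<Sum>v\<in>\<sigma>. of_bool (B = y ` (\<sigma> - {v})))"
    using img by (intro sum.cong) auto
  finally show ?thesis .
qed

section \<open>Carried chain maps and their crossing numbers\<close>

text \<open>
  An augmented chain map from the faces of \<open>X\<close> to chains on the points \<open>J\<close>. The label \<open>car p\<close> is a set of
  source vertices, and a point may occur in the image of \<open>\<sigma>\<close> only if its label lies in \<open>\<sigma>\<close>. As long as
  labels are nonempty, disjoint faces therefore have images without common points. This takes the place
  of continuity and injectivity of a map between spaces.
\<close>
definition carried_map ::
  "'j set \<Rightarrow> ('j \<Rightarrow> 'v set) \<Rightarrow> 'v set set \<Rightarrow> ('v set \<Rightarrow> 'j set \<Rightarrow> bit) \<Rightarrow> bool" where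
  "carried_map J car X F \<longleftrightarrow> F {} {} = 1 \<and>
     (\<forall>\<sigma>\<in>X. (\<forall>A. F \<sigma> A \<noteq> 0 \<longrightarrow> A \<subseteq> J \<and> card A = card \<sigma> \<and> (\<forall>p\<in>A. car p \<subseteq> \<sigma>)) \<and>
             (\<forall>B\<in>Pow J. chain_boundary J (F \<sigma>) B = (\<Sum>v\<in>\<sigma>. F (\<sigma> - {v}) B)))"

lemma carried_mapD:
  assumes "carried_map J car X F" "\<sigma> \<in> X" "F \<sigma> A \<noteq> 0"
  shows "A \<subseteq> J" "card A = card \<sigma>" "p \<in> A \<Longrightarrow> car p \<subseteq> \<sigma>"
  using assms unfolding carried_map_def by blast+

lemma carried_map_boundary:
  assumes "carried_map J car X F" "\<sigma> \<in> X" "B \<subseteq> J"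
  shows "chain_boundary J (F \<sigma>) B = (\<Sum>v\<in>\<sigma>. F (\<sigma> - {v}) B)"
  using assms unfolding carried_map_def by blast

text \<open>
  The term \<open>\<partial>H + H\<partial>\<close> for the homotopy \<open>H\<close> with value \<open>h\<close> on the face \<open>\<sigma>0\<close> and 0 on all other faces.
  It affects \<open>\<sigma>0\<close> and the faces of which \<open>\<sigma>0\<close> is a facet.
\<close>
definition elementary_homotopy ::
  "'j set \<Rightarrow> 'v set \<Rightarrow> ('j set \<Rightarrow> bit) \<Rightarrow> 'v set \<Rightarrow> 'j set \<Rightarrow> bit" where
  "elementary_homotopy J \<sigma>0 h \<sigma> B =
     (if \<sigma> = \<sigma>0 then chain_boundary J h B else 0) + (\<Sum>v\<in>\<sigma>. if \<sigma> - {v} = \<sigma>0 then h B else 0)"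

lemma elementary_homotopy_nonzero:
  assumes "elementary_homotopy J \<sigma>0 h \<sigma> B \<noteq> 0"
  obtains "\<sigma> = \<sigma>0" "chain_boundary J h B \<noteq> 0" | v where "v \<in> \<sigma>" "\<sigma> - {v} = \<sigma>0" "h B \<noteq> 0"
proof -
  consider "(if \<sigma> = \<sigma>0 then chain_boundary J h B else 0) \<noteq> 0"
    | "(\<Sum>v\<in>\<sigma>. if \<sigma> - {v} = \<sigma>0 then h B else 0) \<noteq> 0"
    using assms unfolding elementary_homotopy_def by fastforce
  then show ?thesis
  proof cases
    case 1
    then have "\<sigma> = \<sigma>0 \<and> chain_boundary J h B \<noteq> 0" by (simp split: if_split_asm)
    then show ?thesis using that(1) by blast
  next
    case 2
    then obtain v where "v \<in> \<sigma>" "(if \<sigma> - {v} = \<sigma>0 then h B else 0) \<noteq> 0"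
      by (rule sum.not_neutral_contains_not_neutral)
    then have "\<sigma> - {v} = \<sigma>0 \<and> h B \<noteq> 0" by (simp split: if_split_asm)
    then show ?thesis using that(2)[OF \<open>v \<in> \<sigma>\<close>] by blast
  qed
qed

lemma chain_boundary_nonzero:
  assumes "chain_boundary J h B \<noteq> 0"
  obtains j where "j \<in> J - B" "h (insert j B) \<noteq> 0"
  using assms that unfolding chain_boundary_def by (elim sum.not_neutral_contains_not_neutral) blast

lemma carried_map_elementary_homotopy:
  assumes finJ: "finite J" and finX: "\<And>\<sigma>. \<sigma> \<in> X \<Longrightarrow> finite \<sigma>"
    and F: "carried_map J car X F"
    and \<sigma>0: "\<sigma>0 \<noteq> {}" "finite \<sigma>0"
    and h: "\<And>A. h A \<noteq> 0 \<Longrightarrow> A \<subseteq> J \<and> card A = card \<sigma>0 + 1 \<and> (\<forall>p\<in>A. car p \<subseteq> \<sigma>0)"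
  shows "carried_map J car X (\<lambda>\<sigma> B. F \<sigma> B + elementary_homotopy J \<sigma>0 h \<sigma> B)"
  unfolding carried_map_def
proof (intro conjI ballI allI impI)
  have "elementary_homotopy J \<sigma>0 h {} {} = 0" using \<sigma>0 by (simp add: elementary_homotopy_def)
  then show "F {} {} + elementary_homotopy J \<sigma>0 h {} {} = 1" using F by (simp add: carried_map_def)
next
  fix \<sigma> A assume \<sigma>: "\<sigma> \<in> X" and nz: "F \<sigma> A + elementary_homotopy J \<sigma>0 h \<sigma> A \<noteq> 0"
  have fin: "finite \<sigma>" using finX \<sigma> by blast
  have "A \<subseteq> J \<and> card A = card \<sigma> \<and> (\<forall>p\<in>A. car p \<subseteq> \<sigma>)"
  proof (cases "F \<sigma> A = 0")
    case True
    then have "elementary_homotopy J \<sigma>0 h \<sigma> A \<noteq> 0" using nz by simp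
    then show ?thesis
    proof (cases rule: elementary_homotopy_nonzero)
      case 1
      then obtain j where j: "j \<in> J - A" "h (insert j A) \<noteq> 0" using chain_boundary_nonzero by blast
      with h[OF j(2)] 1 finJ show ?thesis
        by (metis DiffD2 One_nat_def add_right_cancel add.right_neutral add_Suc_right card_insert_disjoint finite_subset finite_insert insert_subset insertCI)
    next
      case (2 v)
      then have "card \<sigma> = card \<sigma>0 + 1" using fin
        by (metis One_nat_def add.right_neutral add_Suc_right card.remove)
      then show ?thesis using h[OF 2(3)] 2 by (metis Diff_subset order_trans)
    qed
  next
    case False
    then show ?thesis using carried_mapD[OF F \<sigma> False] by blast
  qed
  then show "A \<subseteq> J" "card A = card \<sigma>" and "\<And>p. p \<in> A \<Longrightarrow> car p \<subseteq> \<sigma>" by blast+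
next
  fix \<sigma> B assume \<sigma>: "\<sigma> \<in> X" and B: "B \<in> Pow J"
  have fin: "finite \<sigma>" using finX \<sigma> by blast
  have "chain_boundary J (elementary_homotopy J \<sigma>0 h \<sigma>) B =
     chain_boundary J (\<lambda>B. if \<sigma> = \<sigma>0 then chain_boundary J h B else 0) B
       + chain_boundary J (\<lambda>B. \<Sum>v\<in>\<sigma>. if \<sigma> - {v} = \<sigma>0 then h B else 0) B"
    unfolding elementary_homotopy_def[abs_def] by (rule chain_boundary_add)
  also have "chain_boundary J (\<lambda>B. if \<sigma> = \<sigma>0 then chain_boundary J h B else 0) B = 0"
  proof (cases "\<sigma> = \<sigma>0")
    case True
    then show ?thesis using chain_boundary_twice[OF finJ, of h B] by simp
  qed (simp add: chain_boundary_def)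
  also have "chain_boundary J (\<lambda>B. \<Sum>v\<in>\<sigma>. if \<sigma> - {v} = \<sigma>0 then h B else 0) B
      = (\<Sum>v\<in>\<sigma>. if \<sigma> - {v} = \<sigma>0 then chain_boundary J h B else 0)"
    unfolding chain_boundary_sum by (intro sum.cong) (auto simp: chain_boundary_def)
  finally have 1: "chain_boundary J (elementary_homotopy J \<sigma>0 h \<sigma>) B = (\<Sum>v\<in>\<sigma>. if \<sigma> - {v} = \<sigma>0 then chain_boundary J h B else 0)"
    by simp
  have "(\<Sum>v\<in>\<sigma>. \<Sum>w\<in>\<sigma> - {v}. if \<sigma> - {v} - {w} = \<sigma>0 then h B else 0) = 0"
    using fin by (intro sum_symmetric_off_diagonal) (auto simp: Diff_insert2[symmetric] insert_commute)
  then have "(\<Sum>v\<in>\<sigma>. elementary_homotopy J \<sigma>0 h (\<sigma> - {v}) B) = (\<Sum>v\<in>\<sigma>. if \<sigma> - {v} = \<sigma>0 then chain_boundary J h B else 0)"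
    by (simp add: elementary_homotopy_def sum.distrib)
  with 1 have "chain_boundary J (elementary_homotopy J \<sigma>0 h \<sigma>) B = (\<Sum>v\<in>\<sigma>. elementary_homotopy J \<sigma>0 h (\<sigma> - {v}) B)" by simp
  then show "chain_boundary J (\<lambda>B. F \<sigma> B + elementary_homotopy J \<sigma>0 h \<sigma> B) B =
      (\<Sum>v\<in>\<sigma>. F (\<sigma> - {v}) B + elementary_homotopy J \<sigma>0 h (\<sigma> - {v}) B)"
    using carried_map_boundary[OF F \<sigma>, of B] B by (simp add: chain_boundary_add sum.distrib)
qed

definition pairing ::
  "'j set \<Rightarrow> ('j set \<Rightarrow> 'j set \<Rightarrow> bit) \<Rightarrow> ('j set \<Rightarrow> bit) \<Rightarrow> ('j set \<Rightarrow> bit) \<Rightarrow> bit" where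
  "pairing J p c c' = (\<Sum>A\<in>Pow J. \<Sum>B\<in>Pow J. c A * c' B * p A B)"

lemma pairing_add_left: "pairing J p (\<lambda>A. c1 A + c2 A) c' = pairing J p c1 c' + pairing J p c2 c'"
  by (simp add: pairing_def distrib_right sum.distrib)

lemma pairing_add_right: "pairing J p c' (\<lambda>A. c1 A + c2 A) = pairing J p c' c1 + pairing J p c' c2"
  by (simp add: pairing_def distrib_right distrib_left sum.distrib)

lemma pairing_zero_left [simp]: "pairing J p (\<lambda>A. 0) c' = 0"
  by (simp add: pairing_def)

lemma pairing_sum_left: "pairing J p (\<lambda>A. \<Sum>i\<in>I. c i A) c' = (\<Sum>i\<in>I. pairing J p (c i) c')"
proof (cases "finite I")
  case True
  then show ?thesis by (induction I rule: finite_induct) (simp_all add: pairing_add_left)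
qed simp

lemma pairing_commute:
  assumes "\<And>A B. p A B = p B A"
  shows "pairing J p c c' = pairing J p c' c"
  unfolding pairing_def
  by (subst sum.swap) (simp add: assms mult.commute)

text \<open>
  The combinatorial properties of the parity of crossings of simplices with \<open>M\<close> vertices altogether in a
  space of dimension \<open>M - 2\<close>. The law form_boundary reflects that two simplices with \<open>M + 1\<close>
  vertices altogether meet in a segment or not at all, and that the end points of the segment are the
  crossings of one of the simplices with a facet of the other.
\<close>
locale crossing_form =
  fixes J :: "'j set" and p :: "'j set \<Rightarrow> 'j set \<Rightarrow> bit" and M :: nat
  assumes finite_points: "finite J"
    and form_commute: "p A B = p B A"
    and form_boundary: "\<lbrakk>A \<subseteq> J; B \<subseteq> J; A \<inter> B = {}; card A + card B = M + 1\<rbrakk>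
      \<Longrightarrow> (\<Sum>a\<in>A. p (A - {a}) B) = (\<Sum>b\<in>B. p A (B - {b}))"
begin

lemma pairing_boundary:
  assumes disj: "\<And>A B. c A \<noteq> 0 \<Longrightarrow> c' B \<noteq> 0 \<Longrightarrow> A \<inter> B = {} \<and> card A + card B = M + 1"
  shows "pairing J p (chain_boundary J c) c' = pairing J p c (chain_boundary J c')"
proof -
  have "pairing J p (chain_boundary J c) c' =
      (\<Sum>B\<in>Pow J. \<Sum>A\<in>Pow J. \<Sum>j\<in>J - A. c (insert j A) * c' B * p (insert j A - {j}) B)"
    unfolding pairing_def chain_boundary_def sum_distrib_right
    by (subst sum.swap) (auto intro!: sum.cong)
  also have "\<dots> = (\<Sum>B\<in>Pow J. \<Sum>A\<in>Pow J. \<Sum>a\<in>A. c A * c' B * p (A - {a}) B)"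
    by (intro sum.cong refl sum_insert_Pow[OF finite_points])
  also have "\<dots> = (\<Sum>A\<in>Pow J. \<Sum>B\<in>Pow J. c A * c' B * (\<Sum>a\<in>A. p (A - {a}) B))"
    by (subst sum.swap) (simp add: sum_distrib_left)
  also have "\<dots> = (\<Sum>A\<in>Pow J. \<Sum>B\<in>Pow J. c A * c' B * (\<Sum>b\<in>B. p A (B - {b})))"
    using form_boundary disj by (intro sum.cong refl) (metis PowD mult_eq_0_iff)
  also have "\<dots> = (\<Sum>A\<in>Pow J. \<Sum>B\<in>Pow J. \<Sum>b\<in>B. c A * c' B * p A (B - {b}))"
    by (simp add: sum_distrib_left)
  also have "\<dots> = (\<Sum>A\<in>Pow J. \<Sum>B\<in>Pow J. \<Sum>j\<in>J - B. c A * c' (insert j B) * p A (insert j B - {j}))"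
    by (intro sum.cong refl
        sum_insert_Pow[OF finite_points, where g = "\<lambda>B j. c A * c' B * p A (B - {j})" for A, symmetric])
  also have "\<dots> = pairing J p c (chain_boundary J c')"
    unfolding pairing_def chain_boundary_def sum_distrib_right sum_distrib_left
    by (intro sum.cong) auto
  finally show ?thesis .
qed

end

text \<open>
  The good pairs form a cycle modulo 2 of dimension \<open>M - 2\<close> in the deleted product of \<open>X\<close>, the cell complex
  of products of disjoint faces, up to exchange of the factors: by good_parity every cell of one
  dimension less is a facet of an even number of good pairs. The relation half selects one of the two
  orders of each good pair.
\<close>
locale pair_cycle =
  fixes V :: "'v set" and X :: "'v set set" and good half :: "'v set \<Rightarrow> 'v set \<Rightarrow> bool" and M :: nat
  assumes finite_vertices: "finite V" and faces_subset: "X \<subseteq> Pow V"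
    and faces_closed: "\<sigma> \<in> X \<Longrightarrow> \<tau> \<subseteq> \<sigma> \<Longrightarrow> \<tau> \<in> X"
    and empty_face: "{} \<in> X"
    and goodD: "good \<sigma> \<tau> \<Longrightarrow> \<sigma> \<in> X \<and> \<tau> \<in> X \<and> \<sigma> \<inter> \<tau> = {} \<and> card \<sigma> + card \<tau> = M"
    and good_parity: "\<lbrakk>\<sigma> \<in> X; \<tau> \<in> X\<rbrakk> \<Longrightarrow>
      (\<Sum>w\<in>V - \<tau>. of_bool (good \<sigma> (insert w \<tau>))) + (\<Sum>x\<in>V - \<sigma>. of_bool (good (insert x \<sigma>) \<tau>)) = (0::bit)"
    and good_half: "good \<sigma> \<tau> \<longleftrightarrow> half \<sigma> \<tau> \<or> half \<tau> \<sigma>"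
    and half_asym: "half \<sigma> \<tau> \<Longrightarrow> \<not> half \<tau> \<sigma>"

locale van_kampen = crossing_form J p M + pair_cycle V X good half M
  for J :: "'j set" and p M and V :: "'v set" and X good half +
  fixes car :: "'j \<Rightarrow> 'v set"
  assumes car_nonempty: "j \<in> J \<Longrightarrow> car j \<noteq> {}"
begin

definition crossing_number :: "('v set \<Rightarrow> 'j set \<Rightarrow> bit) \<Rightarrow> bit" where
  "crossing_number F = (\<Sum>(\<sigma>,\<tau>)\<in>{(\<sigma>,\<tau>). half \<sigma> \<tau>}. pairing J p (F \<sigma>) (F \<tau>))"

lemma finite_X: "finite X"
  using finite_vertices faces_subset finite_subset by blast

lemma finite_face: "\<sigma> \<in> X \<Longrightarrow> finite \<sigma>"
  using finite_vertices faces_subset finite_subset by blast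

lemma finite_good: "finite {(\<sigma>,\<tau>). good \<sigma> \<tau>}"
  by (rule finite_subset[of _ "X \<times> X"]) (use goodD finite_X in auto)

lemma finite_half: "finite {(\<sigma>,\<tau>). half \<sigma> \<tau>}"
  by (rule finite_subset[OF _ finite_good]) (use good_half in auto)

text \<open>
  The faces whose image changes all contain \<open>\<sigma>0\<close>, so in a good pair only one of the two factors changes.
  Moving the boundary of \<open>h\<close> to the other factor, the total change becomes a sum of pairings of
  \<open>h\<close> with the images of faces \<open>\<tau>\<close>, where \<open>\<tau>\<close> occurs once for each way to extend \<open>(\<sigma>0, \<tau>)\<close> by one
  vertex to a good pair. By good_parity this number is even.
\<close>
lemma crossing_number_elementary_homotopy:
  assumes F: "carried_map J car X F"
    and \<sigma>0: "\<sigma>0 \<noteq> {}" "\<sigma>0 \<in> X"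
    and h: "\<And>A. h A \<noteq> 0 \<Longrightarrow> A \<subseteq> J \<and> card A = card \<sigma>0 + 1 \<and> (\<forall>p\<in>A. car p \<subseteq> \<sigma>0)"
  shows "crossing_number (\<lambda>\<sigma> B. F \<sigma> B + elementary_homotopy J \<sigma>0 h \<sigma> B) = crossing_number F"
proof -
  define \<delta> where "\<delta> = elementary_homotopy J \<sigma>0 h"
  have \<delta>_sub: "\<sigma>0 \<subseteq> \<sigma>" if "\<delta> \<sigma> B \<noteq> 0" for \<sigma> B
    using that unfolding \<delta>_def by (cases rule: elementary_homotopy_nonzero) auto
  have \<delta>\<delta>: "pairing J p (\<delta> \<sigma>) (\<delta> \<tau>) = 0" if "good \<sigma> \<tau>" for \<sigma> \<tau>
  proof -
    have "\<delta> \<sigma> A * \<delta> \<tau> B * p A B = 0" for A B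
    proof (rule ccontr)
      assume "\<not> ?thesis"
      then have "\<sigma>0 \<subseteq> \<sigma> \<inter> \<tau>" using \<delta>_sub by (metis Int_greatest mult_zero_left mult_zero_right)
      then show False using goodD[OF that] \<sigma>0 by auto
    qed
    then show ?thesis unfolding pairing_def by (intro sum.neutral ballI)
  qed
  have expand: "pairing J p (\<lambda>B. F \<sigma> B + \<delta> \<sigma> B) (\<lambda>B. F \<tau> B + \<delta> \<tau> B)
      = pairing J p (F \<sigma>) (F \<tau>) + (pairing J p (\<delta> \<sigma>) (F \<tau>) + pairing J p (\<delta> \<tau>) (F \<sigma>))"
    if "good \<sigma> \<tau>" for \<sigma> \<tau>
    using \<delta>\<delta>[OF that] pairing_commute[of p J "F \<sigma>" "\<delta> \<tau>", OF form_commute]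
    by (simp add: pairing_add_left pairing_add_right ac_simps)
  define R where "R = (\<lambda>\<sigma> \<tau>. pairing J p (\<delta> \<sigma>) (F \<tau>))"
  define P where "P = (\<lambda>\<tau>. pairing J p h (F \<tau>))"
  define H where "H = {(\<sigma>,\<tau>). half \<sigma> \<tau>}"
  have "crossing_number (\<lambda>\<sigma> B. F \<sigma> B + \<delta> \<sigma> B) = crossing_number F +
     ((\<Sum>(\<sigma>,\<tau>)\<in>H. R \<sigma> \<tau>) + (\<Sum>(\<sigma>,\<tau>)\<in>H. R \<tau> \<sigma>))"
    unfolding crossing_number_def R_def H_def sum.distrib[symmetric]
    by (intro sum.cong refl) (use expand good_half in auto)
  also have "(\<Sum>(\<sigma>,\<tau>)\<in>H. R \<tau> \<sigma>) = (\<Sum>(\<sigma>,\<tau>)\<in>H\<inverse>. R \<sigma> \<tau>)"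
    by (rule sum.reindex_bij_witness[of _ "\<lambda>(x,y). (y,x)" "\<lambda>(x,y). (y,x)"]) auto
  also have "(\<Sum>(\<sigma>,\<tau>)\<in>H. R \<sigma> \<tau>) + (\<Sum>(\<sigma>,\<tau>)\<in>H\<inverse>. R \<sigma> \<tau>) = (\<Sum>(\<sigma>,\<tau>)\<in>H \<union> H\<inverse>. R \<sigma> \<tau>)"
    using finite_half half_asym unfolding H_def
    by (intro sum.union_disjoint[symmetric]) auto
  also have "H \<union> H\<inverse> = {(\<sigma>,\<tau>). good \<sigma> \<tau>}"
    unfolding H_def using good_half by auto
  also have "(\<Sum>(\<sigma>,\<tau>)\<in>{(\<sigma>,\<tau>). good \<sigma> \<tau>}. R \<sigma> \<tau>) = (\<Sum>(\<sigma>,\<tau>)\<in>Pow V \<times> Pow V. of_bool (good \<sigma> \<tau>) * R \<sigma> \<tau>)"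
  proof -
    have "{(\<sigma>,\<tau>). good \<sigma> \<tau>} \<subseteq> Pow V \<times> Pow V" using goodD faces_subset by fast
    then have "(\<Sum>q\<in>{(\<sigma>,\<tau>). good \<sigma> \<tau>}. of_bool (good (fst q) (snd q)) * R (fst q) (snd q))
        = (\<Sum>q\<in>Pow V \<times> Pow V. of_bool (good (fst q) (snd q)) * R (fst q) (snd q))"
      using finite_vertices by (intro sum.mono_neutral_left) auto
    moreover have "(\<Sum>(\<sigma>,\<tau>)\<in>{(\<sigma>,\<tau>). good \<sigma> \<tau>}. R \<sigma> \<tau>)
        = (\<Sum>q\<in>{(\<sigma>,\<tau>). good \<sigma> \<tau>}. of_bool (good (fst q) (snd q)) * R (fst q) (snd q))"
      by (intro sum.cong refl) auto
    ultimately show ?thesis by (simp add: case_prod_beta)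
  qed
  also have "\<dots> = (\<Sum>\<sigma>\<in>Pow V. \<Sum>\<tau>\<in>Pow V. of_bool (good \<sigma> \<tau>) * R \<sigma> \<tau>)"
    by (rule sum.cartesian_product[symmetric])
  also have "\<dots> = (\<Sum>\<tau>\<in>Pow V. P \<tau> * ((\<Sum>w\<in>V - \<tau>. of_bool (good \<sigma>0 (insert w \<tau>)))
        + (\<Sum>x\<in>V - \<sigma>0. of_bool (good (insert x \<sigma>0) \<tau>))))"
  proof -
    have R: "R \<sigma> \<tau> = (if \<sigma> = \<sigma>0 then \<Sum>w\<in>\<tau>. P (\<tau> - {w}) else 0) + (\<Sum>v\<in>\<sigma>. if \<sigma> - {v} = \<sigma>0 then P \<tau> else 0)"
      if g: "good \<sigma> \<tau>" for \<sigma> \<tau>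
    proof -
      have 1: "R \<sigma> \<tau> = (if \<sigma> = \<sigma>0 then pairing J p (chain_boundary J h) (F \<tau>) else 0)
           + (\<Sum>v\<in>\<sigma>. if \<sigma> - {v} = \<sigma>0 then P \<tau> else 0)"
        unfolding R_def \<delta>_def elementary_homotopy_def[abs_def] pairing_add_left pairing_sum_left P_def
        by (intro arg_cong2[of _ _ _ _ "(+)"] sum.cong refl) auto
      have "pairing J p (chain_boundary J h) (F \<tau>) = (\<Sum>w\<in>\<tau>. P (\<tau> - {w}))" if "\<sigma> = \<sigma>0"
      proof -
        note gd = goodD[OF g]
        have "pairing J p (chain_boundary J h) (F \<tau>) = pairing J p h (chain_boundary J (F \<tau>))"
        proof (rule pairing_boundary)
          fix A B assume A: "h A \<noteq> 0" and B: "F \<tau> B \<noteq> 0"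
          note hA = h[OF A]
          note FB = carried_mapD[OF F _ B]
          have "A \<inter> B = {}"
          proof (rule ccontr)
            assume "A \<inter> B \<noteq> {}"
            then obtain j where j: "j \<in> A" "j \<in> B" by auto
            then have "car j \<subseteq> \<sigma>0 \<inter> \<tau>" using hA FB gd by blast
            moreover have "\<sigma>0 \<inter> \<tau> = {}" using gd that by simp
            ultimately show False using car_nonempty[of j] j hA by blast
          qed
          then show "A \<inter> B = {} \<and> card A + card B = M + 1"
            using hA FB(2) gd that by auto
        qed
        also have "\<dots> = pairing J p h (\<lambda>B. \<Sum>w\<in>\<tau>. F (\<tau> - {w}) B)"
          unfolding pairing_def using carried_map_boundary[OF F] gd
          by (intro sum.cong refl) auto
        also have "\<dots> = (\<Sum>w\<in>\<tau>. P (\<tau> - {w}))"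
          unfolding P_def pairing_commute[of p J h, OF form_commute] by (rule pairing_sum_left)
        finally show ?thesis .
      qed
      then show ?thesis unfolding 1 by (cases "\<sigma> = \<sigma>0") auto
    qed
    have "(\<Sum>\<sigma>\<in>Pow V. \<Sum>\<tau>\<in>Pow V. of_bool (good \<sigma> \<tau>) * R \<sigma> \<tau>) =
       (\<Sum>\<sigma>\<in>Pow V. \<Sum>\<tau>\<in>Pow V. of_bool (good \<sigma> \<tau>) * (if \<sigma> = \<sigma>0 then \<Sum>w\<in>\<tau>. P (\<tau> - {w}) else 0))
       + (\<Sum>\<sigma>\<in>Pow V. \<Sum>\<tau>\<in>Pow V. of_bool (good \<sigma> \<tau>) * (\<Sum>v\<in>\<sigma>. if \<sigma> - {v} = \<sigma>0 then P \<tau> else 0))"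
      unfolding sum.distrib[symmetric] using R by (intro sum.cong refl) (auto simp: distrib_left)
    also have "(\<Sum>\<sigma>\<in>Pow V. \<Sum>\<tau>\<in>Pow V. of_bool (good \<sigma> \<tau>) * (if \<sigma> = \<sigma>0 then \<Sum>w\<in>\<tau>. P (\<tau> - {w}) else 0))
        = (\<Sum>\<sigma>\<in>Pow V. if \<sigma> = \<sigma>0 then \<Sum>\<tau>\<in>Pow V. \<Sum>w\<in>\<tau>. of_bool (good \<sigma>0 \<tau>) * P (\<tau> - {w}) else 0)"
      by (intro sum.cong) (auto simp: sum_distrib_left)
    also have "\<dots> = (\<Sum>\<tau>\<in>Pow V. \<Sum>w\<in>\<tau>. of_bool (good \<sigma>0 \<tau>) * P (\<tau> - {w}))"
    proof -
      have "\<sigma>0 \<in> Pow V" using faces_subset \<sigma>0(2) by blast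
      then show ?thesis using finite_vertices
        by (simp only: sum.delta finite_Pow_iff if_True)
    qed
    also have "\<dots> = (\<Sum>\<tau>\<in>Pow V. \<Sum>w\<in>V - \<tau>. of_bool (good \<sigma>0 (insert w \<tau>)) * P (insert w \<tau> - {w}))"
      using sum_insert_Pow[OF finite_vertices, where g = "\<lambda>\<tau> w. of_bool (good \<sigma>0 \<tau>) * P (\<tau> - {w})"]
      by simp
    also have "\<dots> = (\<Sum>\<tau>\<in>Pow V. P \<tau> * (\<Sum>w\<in>V - \<tau>. of_bool (good \<sigma>0 (insert w \<tau>))))"
      unfolding sum_distrib_left by (intro sum.cong refl) (auto simp: mult.commute)
    also have "(\<Sum>\<sigma>\<in>Pow V. \<Sum>\<tau>\<in>Pow V. of_bool (good \<sigma> \<tau>) * (\<Sum>v\<in>\<sigma>. if \<sigma> - {v} = \<sigma>0 then P \<tau> else 0))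
        = (\<Sum>\<tau>\<in>Pow V. \<Sum>\<sigma>\<in>Pow V. \<Sum>v\<in>\<sigma>. if \<sigma> - {v} = \<sigma>0 then P \<tau> * of_bool (good \<sigma> \<tau>) else 0)"
      by (subst sum.swap) (auto simp: sum_distrib_left intro!: sum.cong)
    also have "\<dots> = (\<Sum>\<tau>\<in>Pow V. \<Sum>\<sigma>\<in>Pow V. \<Sum>x\<in>V - \<sigma>. if \<sigma> = \<sigma>0 then P \<tau> * of_bool (good (insert x \<sigma>) \<tau>) else 0)"
    proof (rule sum.cong[OF refl])
      fix \<tau>
      have "(\<Sum>\<sigma>\<in>Pow V. \<Sum>v\<in>\<sigma>. if \<sigma> - {v} = \<sigma>0 then P \<tau> * of_bool (good \<sigma> \<tau>) else 0) =
        (\<Sum>\<sigma>\<in>Pow V. \<Sum>x\<in>V - \<sigma>. if insert x \<sigma> - {x} = \<sigma>0 then P \<tau> * of_bool (good (insert x \<sigma>) \<tau>) else 0)"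
        using sum_insert_Pow[OF finite_vertices, where
            g = "\<lambda>\<sigma> v. if \<sigma> - {v} = \<sigma>0 then P \<tau> * of_bool (good \<sigma> \<tau>) else 0"] by simp
      also have "\<dots> = (\<Sum>\<sigma>\<in>Pow V. \<Sum>x\<in>V - \<sigma>. if \<sigma> = \<sigma>0 then P \<tau> * of_bool (good (insert x \<sigma>) \<tau>) else 0)"
        by (intro sum.cong refl) auto
      finally show "(\<Sum>\<sigma>\<in>Pow V. \<Sum>v\<in>\<sigma>. if \<sigma> - {v} = \<sigma>0 then P \<tau> * of_bool (good \<sigma> \<tau>) else 0) = \<dots>" .
    qed
    also have "\<dots> = (\<Sum>\<tau>\<in>Pow V. P \<tau> * (\<Sum>x\<in>V - \<sigma>0. of_bool (good (insert x \<sigma>0) \<tau>)))"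
    proof (rule sum.cong[OF refl])
      fix \<tau>
      have \<sigma>0V: "\<sigma>0 \<in> Pow V" using faces_subset \<sigma>0(2) by blast
      have "(\<Sum>\<sigma>\<in>Pow V. \<Sum>x\<in>V - \<sigma>. if \<sigma> = \<sigma>0 then P \<tau> * of_bool (good (insert x \<sigma>) \<tau>) else 0)
        = (\<Sum>\<sigma>\<in>Pow V. if \<sigma> = \<sigma>0 then P \<tau> * (\<Sum>x\<in>V - \<sigma>0. of_bool (good (insert x \<sigma>0) \<tau>)) else 0)"
        by (intro sum.cong) (auto simp: sum_distrib_left)
      then show "(\<Sum>\<sigma>\<in>Pow V. \<Sum>x\<in>V - \<sigma>. if \<sigma> = \<sigma>0 then P \<tau> * of_bool (good (insert x \<sigma>) \<tau>) else 0)
        = P \<tau> * (\<Sum>x\<in>V - \<sigma>0. of_bool (good (insert x \<sigma>0) \<tau>))"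
        using \<sigma>0V finite_vertices by (simp only: sum.delta finite_Pow_iff if_True)
    qed
    finally show ?thesis by (simp only: sum.distrib distrib_left)
  qed
  also have "\<dots> = 0"
  proof (rule sum.neutral, rule ballI)
    fix \<tau> assume "\<tau> \<in> Pow V"
    show "P \<tau> * ((\<Sum>w\<in>V - \<tau>. of_bool (good \<sigma>0 (insert w \<tau>)))
        + (\<Sum>x\<in>V - \<sigma>0. of_bool (good (insert x \<sigma>0) \<tau>))) = 0"
    proof (cases "\<tau> \<in> X")
      case True
      then show ?thesis using good_parity[OF \<sigma>0(2) True] by simp
    next
      case False
      then have "\<not> good \<sigma> (insert w \<tau>)" "\<not> good \<sigma> \<tau>" for w \<sigma>
        using goodD faces_closed by blast+
      then show ?thesis by simp
    qed
  qed
  finally show ?thesis unfolding \<delta>_def by simp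
qed

text \<open>
  Faces are treated in the order of their size. When \<open>F\<close> agrees with the vertex map \<open>G\<close> on all facets of
  \<open>\<sigma>0\<close>, the sum \<open>F \<sigma>0 + G \<sigma>0\<close> is a cycle, and hence the boundary of its cone from the point \<open>y v0\<close> of a
  vertex \<open>v0\<close> of \<open>\<sigma>0\<close>. The elementary homotopy by this cone corrects \<open>F\<close> on \<open>\<sigma>0\<close>, respects the labels,
  and does not disturb the faces that were treated before.
\<close>
lemma crossing_number_eq_vertex_map:
  assumes F: "carried_map J car X F"
    and y: "\<And>v. v \<in> V \<Longrightarrow> y v \<in> J" "\<And>v. v \<in> V \<Longrightarrow> car (y v) = {v}" and inj: "inj_on y V"
  shows "crossing_number F = crossing_number (\<lambda>\<sigma> A. of_bool (A = y ` \<sigma>))"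
proof -
  define G :: "'v set \<Rightarrow> 'j set \<Rightarrow> bit" where "G = (\<lambda>\<sigma> A. of_bool (A = y ` \<sigma>))"
  have XV: "\<sigma> \<subseteq> V" if "\<sigma> \<in> X" for \<sigma> using that faces_subset by blast
  have bdG: "chain_boundary J (G \<sigma>) B = (\<Sum>v\<in>\<sigma>. G (\<sigma> - {v}) B)" if \<sigma>: "\<sigma> \<in> X" and B: "B \<subseteq> J" for \<sigma> B
    unfolding G_def
  proof (rule chain_boundary_vertex_map[OF finite_points finite_face[OF \<sigma>] _ _ B])
    show "inj_on y \<sigma>" by (rule inj_on_subset[OF inj XV[OF \<sigma>]])
    show "y ` \<sigma> \<subseteq> J" using y(1) XV[OF \<sigma>] by auto
  qed
  have claim: "crossing_number F = crossing_number G"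
    if "carried_map J car X F" "S \<subseteq> X" "{} \<in> S" "\<And>\<sigma> \<tau>. \<sigma> \<in> S \<Longrightarrow> \<tau> \<subseteq> \<sigma> \<Longrightarrow> \<tau> \<in> S"
      "\<And>\<sigma>. \<sigma> \<in> S \<Longrightarrow> F \<sigma> = G \<sigma>" for S F
    using that
  proof (induction "card (X - S)" arbitrary: S F rule: less_induct)
    case less
    show ?case
    proof (cases "X = S")
      case True
      have "F \<sigma> = G \<sigma> \<and> F \<tau> = G \<tau>" if "half \<sigma> \<tau>" for \<sigma> \<tau>
      proof -
        have "\<sigma> \<in> S" "\<tau> \<in> S" using goodD[of \<sigma> \<tau>] good_half[of \<sigma> \<tau>] that True by auto
        then show ?thesis using less.prems(5) by blast
      qed
      then show ?thesis unfolding crossing_number_def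
        by (intro sum.cong refl) auto
    next
      case False
      then have "X - S \<noteq> {}" using less.prems by auto
      then obtain \<sigma>0 where \<sigma>0: "\<sigma>0 \<in> X - S" and min: "\<And>\<sigma>. \<sigma> \<in> X - S \<Longrightarrow> card \<sigma>0 \<le> card \<sigma>"
        using ex_has_least_nat[of "\<lambda>\<sigma>. \<sigma> \<in> X - S" _ card] by blast
      have below: "\<tau> \<in> S" if "\<tau> \<subset> \<sigma>0" for \<tau>
      proof (rule ccontr)
        assume "\<tau> \<notin> S"
        then have "\<tau> \<in> X - S" using \<sigma>0 faces_closed that by blast
        then show False using min[of \<tau>] psubset_card_mono[OF finite_face that] \<sigma>0 by auto
      qed
      have ne: "\<sigma>0 \<noteq> {}" and fin0: "finite \<sigma>0" and \<sigma>0X: "\<sigma>0 \<in> X"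
        using \<sigma>0 less.prems finite_face by auto
      then obtain v0 where v0: "v0 \<in> \<sigma>0" by auto
      then have v0V: "v0 \<in> V" using XV \<sigma>0X by blast
      define z where "z = (\<lambda>A. F \<sigma>0 A + G \<sigma>0 A)"
      define h where "h = chain_cone (y v0) z"
      have zcyc: "chain_boundary J z B = 0" if "B \<subseteq> J" for B
      proof -
        have "chain_boundary J z B = (\<Sum>v\<in>\<sigma>0. F (\<sigma>0 - {v}) B) + (\<Sum>v\<in>\<sigma>0. G (\<sigma>0 - {v}) B)"
          unfolding z_def chain_boundary_add using carried_map_boundary[OF less.prems(1) \<sigma>0X that] bdG[OF \<sigma>0X that] by simp
        also have "(\<Sum>v\<in>\<sigma>0. F (\<sigma>0 - {v}) B) = (\<Sum>v\<in>\<sigma>0. G (\<sigma>0 - {v}) B)"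
          using less.prems(5) below by (intro sum.cong refl) (metis Diff_subset insert_Diff insertI1 psubsetI Diff_iff)
        finally show ?thesis by simp
      qed
      have zsupp: "A \<subseteq> J \<and> card A = card \<sigma>0 \<and> (\<forall>p\<in>A. car p \<subseteq> \<sigma>0)" if "z A \<noteq> 0" for A
      proof (cases "F \<sigma>0 A = 0")
        case True
        then have "G \<sigma>0 A \<noteq> 0" using that unfolding z_def by simp
        then have A: "A = y ` \<sigma>0" unfolding G_def by (metis of_bool_eq(1))
        have "card A = card \<sigma>0" unfolding A
          using inj XV[OF \<sigma>0X] by (meson card_image inj_on_subset)
        moreover have "\<forall>p\<in>A. car p \<subseteq> \<sigma>0" "A \<subseteq> J" unfolding A using y XV[OF \<sigma>0X] by auto
        ultimately show ?thesis by blast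
      next
        case False
        then show ?thesis using carried_mapD[OF less.prems(1) \<sigma>0X False] by blast
      qed
      have h: "A \<subseteq> J \<and> card A = card \<sigma>0 + 1 \<and> (\<forall>p\<in>A. car p \<subseteq> \<sigma>0)" if "h A \<noteq> 0" for A
      proof -
        from that have A: "y v0 \<in> A" "z (A - {y v0}) \<noteq> 0" unfolding h_def chain_cone_def by (simp_all split: if_split_asm)
        note s = zsupp[OF A(2)]
        have sub: "A \<subseteq> J" using s y(1)[OF v0V] by auto
        then have "finite A" using finite_points finite_subset by blast
        then have "card A = card \<sigma>0 + 1" using s A by (metis add.commute card.remove plus_1_eq_Suc)
        moreover have "car q \<subseteq> \<sigma>0" if "q \<in> A" for q
          using s that y(2)[OF v0V] v0 by (cases "q = y v0") auto
        ultimately show ?thesis using sub by blast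
      qed
      define F' where "F' = (\<lambda>\<sigma> B. F \<sigma> B + elementary_homotopy J \<sigma>0 h \<sigma> B)"
      have F': "carried_map J car X F'"
        unfolding F'_def using carried_map_elementary_homotopy[OF finite_points finite_face less.prems(1) ne fin0 h] .
      have eqS: "F' \<sigma> = G \<sigma>" if "\<sigma> \<in> insert \<sigma>0 S" for \<sigma>
      proof (cases "\<sigma> = \<sigma>0")
        case True
        have "F' \<sigma>0 B = G \<sigma>0 B" for B
        proof (cases "B \<subseteq> J")
          case True
          have "chain_boundary J h B = F \<sigma>0 B + G \<sigma>0 B"
            using chain_boundary_cone_cycle[OF finite_points y(1)[OF v0V] zcyc True] unfolding h_def z_def by blast
          moreover have "(\<Sum>v\<in>\<sigma>0. if \<sigma>0 - {v} = \<sigma>0 then h B else 0) = 0" by (rule sum.neutral) auto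
          ultimately show ?thesis unfolding F'_def elementary_homotopy_def by (simp add: bit_add_self_left)
        next
          case False
          have "F' \<sigma>0 B = 0" using carried_mapD(1)[OF F' \<sigma>0X] False by blast
          moreover have "G \<sigma>0 B = 0"
            using False y(1) XV[OF \<sigma>0X] unfolding G_def by auto
          ultimately show ?thesis by simp
        qed
        then show ?thesis using True by auto
      next
        case False
        then have "\<sigma> \<in> S" using that by auto
        then have "\<not> \<sigma>0 \<subseteq> \<sigma>" using less.prems(4) \<sigma>0 by blast
        then have "elementary_homotopy J \<sigma>0 h \<sigma> B = 0" for B
          by (metis Diff_subset equalityE elementary_homotopy_nonzero)
        then show ?thesis using less.prems(5)[OF \<open>\<sigma> \<in> S\<close>] unfolding F'_def by auto
      qed
      have smaller: "card (X - insert \<sigma>0 S) < card (X - S)"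
        using \<sigma>0 finite_X by (intro psubset_card_mono) auto
      have closed: "\<tau> \<in> insert \<sigma>0 S" if "\<sigma> \<in> insert \<sigma>0 S" "\<tau> \<subseteq> \<sigma>" for \<sigma> \<tau>
        using that less.prems(4)[of \<sigma> \<tau>] below[of \<tau>] by auto
      have "crossing_number F' = crossing_number G"
        using less.hyps[OF smaller F' _ _ closed eqS] less.prems(2,3) \<sigma>0X by simp
      moreover have "crossing_number F' = crossing_number F"
        unfolding F'_def using crossing_number_elementary_homotopy[OF less.prems(1) ne \<sigma>0X h] .
      ultimately show ?thesis by simp
    qed
  qed
  have "F {} = G {}"
  proof
    fix A
    show "F {} A = G {} A"
    proof (cases "A = {}")
      case True
      then show ?thesis using F by (simp add: carried_map_def G_def)
    next
      case False
      have "F {} A = 0"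
      proof (rule ccontr)
        assume "F {} A \<noteq> 0"
        from carried_mapD[OF F empty_face this] False finite_points show False
          by (metis card.empty card_0_eq finite_subset)
      qed
      then show ?thesis using False by (simp add: G_def)
    qed
  qed
  then have "F \<sigma> = G \<sigma>" if "\<sigma> \<in> {{}}" for \<sigma> using that by simp
  then have "crossing_number F = crossing_number G"
    using claim[OF F, of "{{}}"] empty_face by simp
  then show ?thesis unfolding G_def .
qed

end

section \<open>Crossing simplices in general position\<close>

text \<open>
  Dependencies are indexed by labels of points, so that coincident points need no separate treatment.
\<close>
definition affine_dependency :: "('j \<Rightarrow> 'e::real_vector) \<Rightarrow> 'j set \<Rightarrow> ('j \<Rightarrow> real) \<Rightarrow> bool" where
  "affine_dependency pos U c \<longleftrightarrow> sum c U = 0 \<and> (\<Sum>u\<in>U. c u *\<^sub>R pos u) = 0"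

definition general_position :: "('j \<Rightarrow> 'e::euclidean_space) \<Rightarrow> 'j set \<Rightarrow> bool" where
  "general_position pos J \<longleftrightarrow>
     (\<forall>U c. U \<subseteq> J \<and> card U \<le> DIM('e) + 1 \<and> affine_dependency pos U c \<longrightarrow> (\<forall>u\<in>U. c u = 0))"

text \<open>
  For points in general position and \<open>DIM + 2\<close> labels, this says that the simplices on \<open>A\<close> and \<open>B\<close> meet in
  an interior point of both: after normalisation, the dependency is the difference of two convex
  combinations of the same point.
\<close>
definition crosses :: "('j \<Rightarrow> 'e::real_vector) \<Rightarrow> 'j set \<Rightarrow> 'j set \<Rightarrow> bool" where
  "crosses pos A B \<longleftrightarrow>
     (\<exists>c. affine_dependency pos (A \<union> B) c \<and> (\<forall>a\<in>A. c a > 0) \<and> (\<forall>b\<in>B. c b < 0))"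

lemma affine_dependency_scale:
  "affine_dependency pos U c \<Longrightarrow> affine_dependency pos U (\<lambda>u. r * c u)"
  unfolding affine_dependency_def
  by (simp flip: sum_distrib_left scaleR_scaleR scaleR_sum_right)

lemma affine_dependency_add:
  "\<lbrakk>affine_dependency pos U c; affine_dependency pos U c'\<rbrakk> \<Longrightarrow> affine_dependency pos U (\<lambda>u. c u + c' u)"
  unfolding affine_dependency_def by (simp add: sum.distrib scaleR_add_left)

lemma affine_dependency_remove_zero:
  assumes "finite U" "x \<in> U" "c x = 0"
  shows "affine_dependency pos (U - {x}) c \<longleftrightarrow> affine_dependency pos U c"
  unfolding affine_dependency_def using assms by (simp add: sum.remove)

lemma affine_dependency_cong:
  "(\<And>u. u \<in> U \<Longrightarrow> c u = c' u) \<Longrightarrow> affine_dependency pos U c = affine_dependency pos U c'"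
  unfolding affine_dependency_def by (simp cong: sum.cong)

lemma crosses_commute: "crosses pos A B = crosses pos B A"
proof -
  have "crosses pos B A" if "crosses pos A B" for A B
  proof -
    from that obtain c where c: "affine_dependency pos (A \<union> B) c" "\<forall>a\<in>A. c a > 0" "\<forall>b\<in>B. c b < 0"
      unfolding crosses_def by blast
    show ?thesis unfolding crosses_def
      by (rule exI[of _ "\<lambda>u. (-1) * c u"])
        (use affine_dependency_scale[OF c(1), of "-1"] c in \<open>simp add: Un_commute\<close>)
  qed
  then show ?thesis by blast
qed

lemma crosses_image:
  assumes "inj_on f (A \<union> B)"
  shows "crosses pos (f ` A) (f ` B) = crosses (\<lambda>x. pos (f x)) A B"
proof -
  have dep: "affine_dependency pos (f ` A \<union> f ` B) c = affine_dependency (\<lambda>x. pos (f x)) (A \<union> B) (\<lambda>x. c (f x))" for c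
    unfolding affine_dependency_def image_Un[symmetric] using assms by (simp add: sum.reindex)
  show ?thesis
  proof
    assume "crosses pos (f ` A) (f ` B)"
    then obtain c where "affine_dependency pos (f ` A \<union> f ` B) c" "\<forall>a\<in>f ` A. c a > 0" "\<forall>b\<in>f ` B. c b < 0"
      unfolding crosses_def by blast
    then show "crosses (\<lambda>x. pos (f x)) A B"
      unfolding crosses_def dep by (intro exI[of _ "\<lambda>x. c (f x)"]) auto
  next
    assume "crosses (\<lambda>x. pos (f x)) A B"
    then obtain c where c: "affine_dependency (\<lambda>x. pos (f x)) (A \<union> B) c" "\<forall>a\<in>A. c a > 0" "\<forall>b\<in>B. c b < 0"
      unfolding crosses_def by blast
    define c' where "c' = (\<lambda>y. c (the_inv_into (A \<union> B) f y))"
    have c': "c' (f x) = c x" if "x \<in> A \<union> B" for x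
      unfolding c'_def using the_inv_into_f_f[OF assms that] by simp
    have "affine_dependency pos (f ` A \<union> f ` B) c'"
      unfolding dep using c(1) c' by (subst affine_dependency_cong[of _ _ c]) auto
    then show "crosses pos (f ` A) (f ` B)"
      unfolding crosses_def using c(2,3) c' by (intro exI[of _ c']) auto
  qed
qed

text \<open>
  Repeated points give a dependency directly; otherwise there are too many points to be affinely
  independent.
\<close>
lemma affine_dependency_exists:
  fixes pos :: "'j \<Rightarrow> 'e::euclidean_space"
  assumes "finite U" "card U \<ge> DIM('e) + 2"
  obtains c u where "affine_dependency pos U c" "u \<in> U" "c u \<noteq> 0"
proof (cases "inj_on pos U")
  case True
  then have "affine_dependent (pos ` U)"
    using assms by (intro affine_dependent_biggerset) (auto simp: card_image)
  then obtain w where w: "sum w (pos ` U) = 0" "\<exists>v\<in>pos ` U. w v \<noteq> 0" "(\<Sum>v\<in>pos ` U. w v *\<^sub>R v) = 0"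
    using affine_dependent_explicit_finite[of "pos ` U"] assms(1) by auto
  from w(2) obtain u where "u \<in> U" "w (pos u) \<noteq> 0" by auto
  moreover have "affine_dependency pos U (\<lambda>u. w (pos u))"
    using w(1,3) True unfolding affine_dependency_def by (simp add: sum.reindex)
  ultimately show ?thesis using that by blast
next
  case False
  then obtain x y where xy: "x \<in> U" "y \<in> U" "x \<noteq> y" "pos x = pos y" by (auto simp: inj_on_def)
  define c where "c = (\<lambda>u. if u = x then 1 else if u = y then -1 else (0::real))"
  have eq: "(\<Sum>u\<in>U. c u *\<^sub>R f u) = f x - f y" for f :: "'j \<Rightarrow> 'b::real_vector"
  proof -
    have "(\<Sum>u\<in>U. c u *\<^sub>R f u) = (\<Sum>u\<in>{x,y}. c u *\<^sub>R f u)"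
      using assms(1) xy by (intro sum.mono_neutral_right) (auto simp: c_def)
    then show ?thesis using xy by (simp add: c_def)
  qed
  have "affine_dependency pos U c"
    using eq[of pos] eq[of "\<lambda>_. 1::real"] xy unfolding affine_dependency_def by simp
  then show ?thesis using that[of c x] xy by (simp add: c_def)
qed

lemma general_positionD:
  fixes pos :: "'j \<Rightarrow> 'e::euclidean_space"
  assumes "general_position pos J" "U \<subseteq> J" "card U \<le> DIM('e) + 1" "affine_dependency pos U c" "u \<in> U"
  shows "c u = 0"
  using assms unfolding general_position_def by blast

text \<open>
  The dependencies on \<open>U\<close> form a plane, and those whose signs agree weakly with \<open>\<epsilon>\<close> form a cone in it. The
  elements of \<open>M\<close> are the coordinates that vanish on a boundary ray of the cone. Starting on the ray of
  some \<open>c\<close> and turning in the direction of \<open>w\<close>, the other boundary ray is reached when the first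
  coordinate vanishes, and general position forbids that two coordinates vanish together.
\<close>
lemma crossing_facets_0_or_2:
  fixes pos :: "'j \<Rightarrow> 'e::euclidean_space"
  assumes gp: "general_position pos J" and U: "finite U" "U \<subseteq> J" "card U = DIM('e) + 3"
    and \<epsilon>: "\<And>u. \<epsilon> u \<noteq> (0::real)"
  defines "M \<equiv> {u\<in>U. \<exists>c. affine_dependency pos U c \<and> c u = 0 \<and> (\<forall>w\<in>U - {u}. \<epsilon> w * c w > 0)}"
  shows "even (card M)"
proof (cases "M = {}")
  case False
  \<comment> \<open>A dependency with two zeros is supported on \<open>DIM + 1\<close> points.\<close>
  have two_zeros: "c u = 0"
    if "affine_dependency pos U c" "x \<in> U" "y \<in> U" "x \<noteq> y" "c x = 0" "c y = 0" "u \<in> U" for c x y u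
  proof (cases "u = x \<or> u = y")
    case False
    have "affine_dependency pos (U - {x} - {y}) c"
      using that U(1) by (subst affine_dependency_remove_zero; simp)+
    then show ?thesis
      using general_positionD[OF gp, of "U - {x} - {y}" c u] False U that by auto
  qed (use that in auto)
  obtain u where u: "u \<in> M" using False by blast
  then obtain c where uU: "u \<in> U" and c: "affine_dependency pos U c" "c u = 0" "\<And>w. w \<in> U - {u} \<Longrightarrow> \<epsilon> w * c w > 0"
    unfolding M_def by blast
  have c_nz: "c w \<noteq> 0" if "w \<in> U - {u}" for w using c(3)[OF that] by auto
  have Uu: "U - {u} \<noteq> {}" "finite (U - {u})"
    using U uU card_mono[of "{u}" U] by auto
  then obtain k where k: "k \<in> U" "k \<noteq> u" by auto
  have "card (U - {k}) \<ge> DIM('e) + 2" using U k by simp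
  then obtain w0 z where w0: "affine_dependency pos (U - {k}) w0" "z \<in> U - {k}" "w0 z \<noteq> 0"
    using affine_dependency_exists[of "U - {k}" pos] U by blast
  define w1 where "w1 = (\<lambda>x. if x = k then 0 else w0 x)"
  have w1: "affine_dependency pos U w1" "w1 k = 0" "w1 z \<noteq> 0"
  proof -
    have "affine_dependency pos (U - {k}) w1"
      using w0(1) unfolding w1_def by (subst affine_dependency_cong[of _ _ w0]) auto
    then show "affine_dependency pos U w1"
      using affine_dependency_remove_zero[of U k w1 pos] U k by (simp add: w1_def)
  qed (use w0 in \<open>auto simp: w1_def\<close>)
  have w1u: "w1 u \<noteq> 0"
    using two_zeros[OF w1(1) k(1) uU k(2) w1(2)] w1(3) w0(2) by blast
  \<comment> \<open>The sign of \<open>w\<close> is chosen such that adding multiples of \<open>c\<close> leads into the cone.\<close>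
  define w where "w = (\<lambda>x. (\<epsilon> u * w1 u) * w1 x)"
  have w: "affine_dependency pos U w" "\<epsilon> u * w u > 0"
  proof -
    show "affine_dependency pos U w" unfolding w_def using w1(1) by (rule affine_dependency_scale)
    have "\<epsilon> u * w u = (\<epsilon> u * w1 u)\<^sup>2" by (simp add: w_def power2_eq_square)
    then show "\<epsilon> u * w u > 0" using \<epsilon>[of u] w1u by simp
  qed
  \<comment> \<open>The least multiple of \<open>c\<close> for which \<open>w + \<alpha> c\<close> is in the closed cone.\<close>
  define \<alpha> where "\<alpha> = Max ((\<lambda>j. - w j / c j) ` (U - {u}))"
  have \<alpha>_ge: "- w j / c j \<le> \<alpha>" if "j \<in> U - {u}" for j
    unfolding \<alpha>_def using Uu that by (intro Max_ge) auto
  obtain v where v: "v \<in> U - {u}" "- w v / c v = \<alpha>"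
  proof -
    have "\<alpha> \<in> (\<lambda>j. - w j / c j) ` (U - {u})"
      unfolding \<alpha>_def using Uu by (intro Max_in) auto
    then show ?thesis using that by auto
  qed
  define w' where "w' = (\<lambda>j. w j + \<alpha> * c j)"
  have w': "affine_dependency pos U w'"
    unfolding w'_def using w(1) c(1) by (intro affine_dependency_add affine_dependency_scale)
  have w'u: "w' u = w u" "w' u \<noteq> 0" using c(2) w(2) by (auto simp: w'_def)
  have w'v: "w' v = 0" using v c_nz by (auto simp: w'_def field_simps)
  have w'_only: "j = v" if "j \<in> U" "w' j = 0" for j
    using two_zeros[OF w' that(1) _ _ that(2) w'v uU] v w'u by auto
  have w'_ge: "\<epsilon> j * w' j \<ge> 0" if "j \<in> U - {u}" for j
  proof -
    have "\<epsilon> j * w' j = (\<epsilon> j * c j) * (\<alpha> - (- w j / c j))"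
      using c_nz[OF that] by (simp add: w'_def field_simps)
    also have "\<dots> \<ge> 0" by (rule mult_nonneg_nonneg) (use c(3)[OF that] \<alpha>_ge[OF that] in auto)
    finally show ?thesis .
  qed
  have "v \<in> M"
  proof -
    have "\<epsilon> j * w' j > 0" if "j \<in> U - {v}" for j
    proof (cases "j = u")
      case True then show ?thesis using w(2) w'u by simp
    next
      case False
      then show ?thesis using w'_ge[of j] w'_only[of j] that \<epsilon>[of j]
        by (metis Diff_iff insertCI insertE less_eq_real_def mult_eq_0_iff)
    qed
    then show ?thesis unfolding M_def using v w' w'v by blast
  qed
  moreover have "v' = v" if v': "v' \<in> M" "v' \<noteq> u" for v'
  proof -
    obtain d where v'U: "v' \<in> U" and d: "affine_dependency pos U d" "d v' = 0" "\<And>j. j \<in> U - {v'} \<Longrightarrow> \<epsilon> j * d j > 0"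
      using v'(1) unfolding M_def by blast
    have du: "\<epsilon> u * d u > 0" using d(3)[of u] uU v' by auto
    then have dunz: "d u \<noteq> 0" by auto
    \<comment> \<open>Scaled to agree with \<open>w\<close> at \<open>u\<close>, the dependency \<open>d\<close> differs from \<open>w\<close> by a multiple of \<open>c\<close>.\<close>
    define r where "r = w u / d u"
    have r: "r > 0"
      using du w(2) unfolding r_def by (auto simp: zero_less_mult_iff zero_less_divide_iff)
    define e where "e = (\<lambda>j. r * d j + (-1) * w j)"
    have e: "affine_dependency pos U e"
      unfolding e_def by (rule affine_dependency_add; rule affine_dependency_scale; fact)
    have eu: "e u = 0" using dunz by (simp add: e_def r_def)
    define \<beta> where "\<beta> = e k / c k"
    have ck: "c k \<noteq> 0" using c_nz k by auto
    have ec: "affine_dependency pos U (\<lambda>j. e j + (- \<beta>) * c j)"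
      by (rule affine_dependency_add[OF e affine_dependency_scale[OF c(1)]])
    have "e j + (- \<beta>) * c j = 0" if "j \<in> U" for j
      by (rule two_zeros[OF ec uU k(1) k(2)[symmetric] _ _ that]) (use eu c(2) ck in \<open>simp_all add: \<beta>_def\<close>)
    then have rd: "r * d j = w j + \<beta> * c j" if "j \<in> U" for j
      using that unfolding e_def by (simp add: algebra_simps)
    have le: "- w j / c j \<le> \<beta>" if "j \<in> U - {u}" for j
    proof -
      have "\<epsilon> j * d j \<ge> 0" using d(2) d(3)[of j] that by (cases "j = v'") auto
      then have "0 \<le> \<epsilon> j * (r * d j)" using r by (metis mult.left_commute mult_nonneg_nonneg less_imp_le)
      also have "\<dots> = (\<epsilon> j * c j) * (\<beta> - (- w j / c j))"
        using rd[of j] that c_nz[OF that] by (simp add: field_simps)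
      finally show ?thesis using c(3)[OF that] by (simp add: zero_le_mult_iff)
    qed
    have "\<alpha> \<le> \<beta>" using le[OF v(1)] v(2) by simp
    moreover have "\<beta> = - w v' / c v'"
      using rd[OF v'U] d(2) c_nz[of v'] v' v'U by (simp add: field_simps)
    then have "\<beta> \<le> \<alpha>" using \<alpha>_ge[of v'] v' v'U by simp
    ultimately have "w' v' = 0" using rd[OF v'U] d(2) by (simp add: w'_def)
    then show ?thesis using w'_only[OF v'U] by simp
  qed
  ultimately have "M = {u, v}" using u by auto
  moreover have "u \<noteq> v" using v by auto
  ultimately show ?thesis by simp
qed simp

lemma crosses_boundary:
  fixes pos :: "'j \<Rightarrow> 'e::euclidean_space"
  assumes gp: "general_position pos J" and fin: "finite J" and AB: "A \<subseteq> J" "B \<subseteq> J" "A \<inter> B = {}"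
    and card: "card A + card B = DIM('e) + 3"
  shows "(\<Sum>a\<in>A. of_bool (crosses pos (A - {a}) B)) = (\<Sum>b\<in>B. of_bool (crosses pos A (B - {b})) :: bit)"
proof -
  define U where "U = A \<union> B"
  define \<epsilon> where "\<epsilon> = (\<lambda>u. if u \<in> A then 1 else (-1::real))"
  define M where "M = {u\<in>U. \<exists>c. affine_dependency pos U c \<and> c u = 0 \<and> (\<forall>w\<in>U - {u}. \<epsilon> w * c w > 0)}"
  have finA: "finite A" "finite B" using AB fin finite_subset by blast+
  have U: "finite U" "U \<subseteq> J" "card U = DIM('e) + 3"
    unfolding U_def using AB finA card by (auto simp: card_Un_disjoint)
  have even: "even (card M)" unfolding M_def
    by (rule crossing_facets_0_or_2[OF gp U]) (simp add: \<epsilon>_def)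
  have key: "(\<exists>c. affine_dependency pos (U - {x}) c \<and> (\<forall>w\<in>U - {x}. \<epsilon> w * c w > 0)) \<longleftrightarrow> x \<in> M" if "x \<in> U" for x
  proof
    assume "\<exists>c. affine_dependency pos (U - {x}) c \<and> (\<forall>w\<in>U - {x}. \<epsilon> w * c w > 0)"
    then obtain c where c: "affine_dependency pos (U - {x}) c" "\<forall>w\<in>U - {x}. \<epsilon> w * c w > 0" by blast
    define c' where "c' = (\<lambda>u. if u = x then 0 else c u)"
    have "affine_dependency pos (U - {x}) c'"
      using c(1) by (subst affine_dependency_cong[of _ _ c]) (auto simp: c'_def)
    then have "affine_dependency pos U c'"
      using affine_dependency_remove_zero[of U x c' pos] U(1) that by (simp add: c'_def)
    moreover have "\<forall>w\<in>U - {x}. \<epsilon> w * c' w > 0" "c' x = 0" using c(2) by (simp_all add: c'_def)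
    ultimately show "x \<in> M" unfolding M_def using that by blast
  next
    assume "x \<in> M"
    then show "\<exists>c. affine_dependency pos (U - {x}) c \<and> (\<forall>w\<in>U - {x}. \<epsilon> w * c w > 0)"
      unfolding M_def using affine_dependency_remove_zero[OF U(1) that] by blast
  qed
  have cA: "crosses pos (A - {a}) B \<longleftrightarrow> a \<in> M" if "a \<in> A" for a
  proof -
    have *: "A - {a} \<union> B = U - {a}" using that AB by (auto simp: U_def)
    have "((\<forall>w\<in>A - {a}. 0 < c w) \<and> (\<forall>b\<in>B. c b < 0)) \<longleftrightarrow> (\<forall>w\<in>U - {a}. \<epsilon> w * c w > 0)" for c
      unfolding *[symmetric] \<epsilon>_def using AB by auto
    then show ?thesis using key[of a] that unfolding crosses_def * by (simp add: U_def)
  qed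
  have cB: "crosses pos A (B - {b}) \<longleftrightarrow> b \<in> M" if "b \<in> B" for b
  proof -
    have *: "A \<union> (B - {b}) = U - {b}" using that AB by (auto simp: U_def)
    have "((\<forall>w\<in>A. 0 < c w) \<and> (\<forall>w\<in>B - {b}. c w < 0)) \<longleftrightarrow> (\<forall>w\<in>U - {b}. \<epsilon> w * c w > 0)" for c
      unfolding *[symmetric] \<epsilon>_def using AB by auto
    then show ?thesis using key[of b] that unfolding crosses_def * by (simp add: U_def)
  qed
  have MU: "M = (A \<inter> M) \<union> (B \<inter> M)" unfolding M_def U_def by blast
  have "card M = card (A \<inter> M) + card (B \<inter> M)"
    by (subst MU, rule card_Un_disjoint) (use AB finA in auto)
  then have "even (card (A \<inter> M)) = even (card (B \<inter> M))" using even by simp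
  moreover have "(\<Sum>a\<in>A. of_bool (crosses pos (A - {a}) B)) = (of_nat (card (A \<inter> M)) :: bit)"
    using cA finA by (simp add: sum_of_bool_eq cong: sum.cong)
  moreover have "(\<Sum>b\<in>B. of_bool (crosses pos A (B - {b}))) = (of_nat (card (B \<inter> M)) :: bit)"
    using cB finA by (simp add: sum_of_bool_eq cong: sum.cong)
  moreover have "of_nat m = (of_nat n :: bit)" if "even m = even n" for m n
    using that by (metis (mono_tags, lifting) Z2.bit_eq_iff even_of_nat)
  ultimately show ?thesis by metis
qed

section \<open>Perturbation into general position\<close>

lemma uniform_radius:
  fixes P :: "'s \<Rightarrow> real \<Rightarrow> bool"
  assumes "finite S" "\<And>s. s \<in> S \<Longrightarrow> \<exists>d>0. P s d" "\<And>s d d'. P s d \<Longrightarrow> 0 < d' \<Longrightarrow> d' \<le> d \<Longrightarrow> P s d'"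
  shows "\<exists>d>0. \<forall>s\<in>S. P s d"
  using assms(1,2)
proof (induction S rule: finite_induct)
  case empty
  then show ?case by (auto intro: exI[of _ 1])
next
  case (insert s S)
  then obtain d1 d2 where "d1 > 0" "\<forall>s\<in>S. P s d1" "d2 > 0" "P s d2" by blast
  then show ?case using assms(3) by (intro exI[of _ "min d1 d2"]) (auto intro: assms(3))
qed

text \<open>
  A dependency with the signs of a crossing would make the affine function \<open>a \<bullet> x - b\<close> sum to a negative
  number, but every affine function sums to 0 against a dependency.
\<close>
lemma crosses_separated:
  fixes pos :: "'j \<Rightarrow> 'e::real_inner"
  assumes fin: "finite A" "finite B" and ne: "A \<union> B \<noteq> {}"
    and A: "\<And>u. u \<in> A \<Longrightarrow> a \<bullet> pos u < b" and B: "\<And>u. u \<in> B \<Longrightarrow> a \<bullet> pos u > b"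
  shows "\<not> crosses pos A B"
proof
  assume "crosses pos A B"
  then obtain c where c: "affine_dependency pos (A \<union> B) c" "\<forall>u\<in>A. c u > 0" "\<forall>u\<in>B. c u < 0"
    unfolding crosses_def by blast
  have "(\<Sum>u\<in>A \<union> B. c u * (a \<bullet> pos u - b)) = a \<bullet> (\<Sum>u\<in>A \<union> B. c u *\<^sub>R pos u) - b * sum c (A \<union> B)"
    by (simp add: inner_sum_right right_diff_distrib sum_subtractf sum_distrib_left mult.commute)
  also have "\<dots> = 0" using c(1) unfolding affine_dependency_def by simp
  finally have "(\<Sum>u\<in>A \<union> B. c u * (a \<bullet> pos u - b)) = 0" .
  moreover have "(\<Sum>u\<in>A \<union> B. c u * (a \<bullet> pos u - b)) < (\<Sum>u\<in>A \<union> B. 0)"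
  proof (rule sum_strict_mono)
    fix u assume "u \<in> A \<union> B"
    then show "c u * (a \<bullet> pos u - b) < 0"
      using c A[of u] B[of u] by (auto simp: mult_less_0_iff)
  qed (use fin ne in auto)
  ultimately show False by simp
qed

text \<open>
  Disjoint compact hulls are strictly separated by a hyperplane, and finitely many strict inequalities
  survive a small perturbation of the points.
\<close>
lemma not_crosses_stable:
  fixes x :: "'j \<Rightarrow> 'e::euclidean_space"
  assumes fin: "finite A" "finite B" and ne: "A \<union> B \<noteq> {}"
    and disj: "convex hull (x ` A) \<inter> convex hull (x ` B) = {}"
  shows "\<exists>d>0. \<forall>pos. (\<forall>u\<in>A \<union> B. dist (pos u) (x u) < d) \<longrightarrow> \<not> crosses pos A B"
proof (cases "A = {} \<or> B = {}")
  case True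
  have "\<not> crosses pos A B" for pos :: "'j \<Rightarrow> 'e"
  proof
    assume "crosses pos A B"
    then obtain c :: "'j \<Rightarrow> real" where c: "sum c (A \<union> B) = 0" "\<forall>u\<in>A. c u > 0" "\<forall>u\<in>B. c u < 0"
      unfolding crosses_def affine_dependency_def by blast
    show False
      using True
    proof
      assume "A = {}"
      then show False using c ne fin sum_strict_mono[of B c "\<lambda>_. 0"] by simp
    next
      assume "B = {}"
      then show False using c ne fin sum_pos[of A c] by simp
    qed
  qed
  then show ?thesis by (auto intro: exI[of _ 1])
next
  case False
  have "\<exists>a b. (\<forall>y\<in>convex hull (x ` A). a \<bullet> y < b) \<and> (\<forall>y\<in>convex hull (x ` B). a \<bullet> y > b)"
    using disj fin False
    by (intro separating_hyperplane_closed_compact) (auto intro: compact_imp_closed finite_imp_compact_convex_hull)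
  then obtain a b where ab: "\<And>y. y \<in> convex hull (x ` A) \<Longrightarrow> a \<bullet> y < b"
    "\<And>y. y \<in> convex hull (x ` B) \<Longrightarrow> a \<bullet> y > b" by blast
  have "\<exists>d>0. \<forall>u\<in>A \<union> B. \<forall>y. dist y (x u) < d \<longrightarrow> (u \<in> A \<longrightarrow> a \<bullet> y < b) \<and> (u \<in> B \<longrightarrow> a \<bullet> y > b)"
  proof (rule uniform_radius)
    fix u assume u: "u \<in> A \<union> B"
    let ?S = "(if u \<in> A then {y. a \<bullet> y < b} else UNIV) \<inter> (if u \<in> B then {y. a \<bullet> y > b} else UNIV)"
    have "open ?S" by (auto intro!: open_Int open_halfspace_lt open_halfspace_gt)
    moreover have "x u \<in> ?S" using ab hull_inc[of "x u" "x ` A" convex] hull_inc[of "x u" "x ` B" convex] by auto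
    ultimately obtain d where "d > 0" "\<And>y. dist y (x u) < d \<Longrightarrow> y \<in> ?S" unfolding open_dist by blast
    then show "\<exists>d>0. \<forall>y. dist y (x u) < d \<longrightarrow> (u \<in> A \<longrightarrow> a \<bullet> y < b) \<and> (u \<in> B \<longrightarrow> a \<bullet> y > b)"
      by (intro exI[of _ d]) (auto split: if_split_asm)
  qed (use fin in auto)
  then obtain d where "d > 0"
    and d: "\<And>u y. u \<in> A \<union> B \<Longrightarrow> dist y (x u) < d \<Longrightarrow> (u \<in> A \<longrightarrow> a \<bullet> y < b) \<and> (u \<in> B \<longrightarrow> a \<bullet> y > b)"
    by blast
  have "\<not> crosses pos A B" if "\<forall>u\<in>A \<union> B. dist (pos u) (x u) < d" for pos
    by (rule crosses_separated[OF fin ne, of a _ b]) (use d that in auto)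
  then show ?thesis using \<open>d > 0\<close> by blast
qed

text \<open>
  A new point may be anywhere outside of the affine hulls of at most \<open>DIM\<close> of the given points. These
  are finitely many null sets, so they do not cover a ball.
\<close>
lemma general_position_extend:
  fixes pos :: "'j \<Rightarrow> 'e::euclidean_space"
  assumes gp: "general_position pos J" and fin: "finite J" and j: "j \<notin> J" and d: "d > 0"
  obtains q where "dist q x < d" "general_position (pos(j := q)) (insert j J)"
proof -
  define \<V> where "\<V> = {V. V \<subseteq> J \<and> card V \<le> DIM('e)}"
  have fin\<V>: "finite \<V>" unfolding \<V>_def using fin by simp
  have "negligible (affine hull (pos ` V))" if "V \<in> \<V>" for V
  proof -
    have "finite (pos ` V)" "card (pos ` V) \<le> DIM('e)"
      using that fin card_image_le[of V pos] finite_subset[of V J] order_trans unfolding \<V>_def by auto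
    then have "interior (affine hull (pos ` V)) = {}" by (rule empty_interior_affine_hull)
    then show ?thesis by (simp add: negligible_convex_interior affine_imp_convex)
  qed
  then have "negligible (\<Union>V\<in>\<V>. affine hull (pos ` V))"
    using fin\<V> by (intro negligible_Union) auto
  moreover have "\<not> negligible (ball x d)"
    using d open_ball open_not_negligible by (metis ball_eq_empty linorder_not_le)
  ultimately have "\<not> ball x d \<subseteq> (\<Union>V\<in>\<V>. affine hull (pos ` V))" using negligible_subset by blast
  then obtain q where q: "q \<in> ball x d" "\<And>V. V \<in> \<V> \<Longrightarrow> q \<notin> affine hull (pos ` V)" by blast
  have "general_position (pos(j := q)) (insert j J)"
    unfolding general_position_def
  proof (intro allI impI)
    fix U c assume as: "U \<subseteq> insert j J \<and> card U \<le> DIM('e) + 1 \<and> affine_dependency (pos(j := q)) U c"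
    have finU: "finite U" using as fin finite_subset by blast
    have restrict: "affine_dependency (pos(j := q)) (U - {j}) c \<longleftrightarrow> affine_dependency pos (U - {j}) c"
      unfolding affine_dependency_def by (intro arg_cong2[of _ _ _ _ "(\<and>)"] refl arg_cong[of _ _ "\<lambda>s. s = 0"] sum.cong) auto
    show "\<forall>u\<in>U. c u = 0"
    proof (cases "j \<in> U \<and> c j \<noteq> 0")
      case False
      have "affine_dependency pos (U - {j}) c"
      proof (cases "j \<in> U")
        case True
        then show ?thesis using False as affine_dependency_remove_zero[OF finU True] restrict by metis
      next
        case False
        then show ?thesis using as restrict by simp
      qed
      moreover have "U - {j} \<subseteq> J" using as by auto
      moreover have "card (U - {j}) \<le> DIM('e) + 1" using as card_Diff1_le[of U j] by linarith
      ultimately have "c u = 0" if "u \<in> U - {j}" for u using general_positionD[OF gp] that by blast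
      then show ?thesis using False by blast
    next
      case True
      define V where "V = U - {j}"
      have V: "V \<subseteq> J" "card V \<le> DIM('e)" "finite V" using as True finU unfolding V_def by auto
      have s: "sum c V = - c j" "(\<Sum>u\<in>V. c u *\<^sub>R pos u) = - (c j *\<^sub>R q)"
      proof -
        have "sum c U = c j + sum c V" unfolding V_def using True finU by (simp add: sum.remove)
        then show "sum c V = - c j" using as unfolding affine_dependency_def by simp
        have "(\<Sum>u\<in>U. c u *\<^sub>R (pos(j := q)) u) = c j *\<^sub>R q + (\<Sum>u\<in>V. c u *\<^sub>R (pos(j := q)) u)"
          unfolding V_def using True finU by (subst sum.remove[of U j]) auto
        also have "(\<Sum>u\<in>V. c u *\<^sub>R (pos(j := q)) u) = (\<Sum>u\<in>V. c u *\<^sub>R pos u)"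
          unfolding V_def by (intro sum.cong) auto
        finally show "(\<Sum>u\<in>V. c u *\<^sub>R pos u) = - (c j *\<^sub>R q)"
          using as unfolding affine_dependency_def by (metis add_eq_0_iff)
      qed
      have q_eq: "q = (\<Sum>u\<in>V. (- c u / c j) *\<^sub>R pos u)"
      proof -
        have "(\<Sum>u\<in>V. (- c u / c j) *\<^sub>R pos u) = (- 1 / c j) *\<^sub>R (\<Sum>u\<in>V. c u *\<^sub>R pos u)"
          by (simp add: scaleR_sum_right)
        also have "\<dots> = q" unfolding s using True by simp
        finally show ?thesis by simp
      qed
      have one: "(\<Sum>u\<in>V. - c u / c j) = 1"
        using s(1) True by (simp add: sum_negf flip: sum_divide_distrib)
      have inj: "inj_on pos V"
      proof (rule inj_onI, rule ccontr)
        fix u u' assume uu: "u \<in> V" "u' \<in> V" "pos u = pos u'" "u \<noteq> u'"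
        define e where "e = (\<lambda>z. if z = u then 1 else (-1::real))"
        have "affine_dependency pos {u, u'} e"
          using uu unfolding affine_dependency_def e_def by simp
        moreover have "{u, u'} \<subseteq> J" "card {u, u'} \<le> DIM('e) + 1"
          using uu V DIM_positive[where 'a = 'e] by auto
        ultimately have "e u = 0" using general_positionD[OF gp] by blast
        then show False by (simp add: e_def)
      qed
      define w where "w = (\<lambda>z. - c (the_inv_into V pos z) / c j)"
      have w: "w (pos u) = - c u / c j" if "u \<in> V" for u
        using the_inv_into_f_f[OF inj that] by (simp add: w_def)
      have "sum w (pos ` V) = 1" "(\<Sum>z\<in>pos ` V. w z *\<^sub>R z) = (\<Sum>u\<in>V. (- c u / c j) *\<^sub>R pos u)"
        using one w by (simp_all add: sum.reindex[OF inj])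
      then have "(\<Sum>u\<in>V. (- c u / c j) *\<^sub>R pos u) \<in> affine hull (pos ` V)"
        using V(3) by (auto simp: affine_hull_finite)
      then show ?thesis using q(2)[of V] V q_eq unfolding \<V>_def by auto
    qed
  qed
  then show ?thesis using that q(1) by (auto simp: dist_commute)
qed

lemma general_position_approx:
  fixes pos x :: "'j \<Rightarrow> 'e::euclidean_space"
  assumes "finite S" "general_position pos J" "finite J" "S \<inter> J = {}" "d > 0"
  shows "\<exists>pos'. (\<forall>j\<in>J. pos' j = pos j) \<and> (\<forall>s\<in>S. dist (pos' s) (x s) < d) \<and> general_position pos' (S \<union> J)"
  using assms(1,4)
proof (induction S rule: finite_induct)
  case empty
  then show ?case using assms by auto
next
  case (insert s S)
  then obtain pos' where pos': "\<forall>j\<in>J. pos' j = pos j" "\<forall>s\<in>S. dist (pos' s) (x s) < d"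
    "general_position pos' (S \<union> J)" by auto
  have "s \<notin> S \<union> J" "finite (S \<union> J)" using insert assms by auto
  then obtain q where q: "dist q (x s) < d" "general_position (pos'(s := q)) (insert s (S \<union> J))"
    using general_position_extend[OF pos'(3) _ _ assms(5)] by blast
  show ?case
  proof (intro exI[of _ "pos'(s := q)"] conjI)
    show "\<forall>j\<in>J. (pos'(s := q)) j = pos j" using pos'(1) insert.prems by auto
    show "\<forall>s'\<in>insert s S. dist ((pos'(s := q)) s') (x s') < d" using pos'(2) q(1) insert.hyps by auto
    show "general_position (pos'(s := q)) (insert s S \<union> J)" using q(2) by (simp add: insert_is_Un[symmetric])
  qed
qed

section \<open>The moment curve\<close>

text \<open>
  The index type of the coordinates carries no order, so \<open>idx\<close> has to assign a degree to each coordinate.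
\<close>
definition moment_curve :: "('k::finite \<Rightarrow> nat) \<Rightarrow> real \<Rightarrow> real ^ 'k" where
  "moment_curve idx t = (\<chi> i. t ^ idx i)"

text \<open>
  The coordinates of the curve together with the constant 1 are the monomials of degree up to the
  dimension, so a dependency annihilates all polynomials of such degree. The following lemmas apply this
  to products of linear factors that vanish at all but one or two of the points.
\<close>
lemma moment_dependency_poly:
  fixes idx :: "'k::finite \<Rightarrow> nat"
  assumes idx: "bij_betw idx UNIV {1..CARD('k)}"
    and dep: "affine_dependency (\<lambda>u. moment_curve idx (t u)) U c" and deg: "degree q \<le> CARD('k)"
  shows "(\<Sum>u\<in>U. c u * poly q (t u)) = 0"
proof -
  have pw: "(\<Sum>u\<in>U. c u * t u ^ i) = 0" if "i \<le> CARD('k)" for i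
  proof (cases "i = 0")
    case True
    then show ?thesis using dep by (simp add: affine_dependency_def)
  next
    case False
    then have "i \<in> idx ` UNIV" using that idx by (simp add: bij_betw_def)
    then obtain k where k: "i = idx k" by auto
    have "0 = (\<Sum>u\<in>U. c u *\<^sub>R moment_curve idx (t u)) $ k"
      using dep by (simp add: affine_dependency_def)
    also have "\<dots> = (\<Sum>u\<in>U. c u * t u ^ i)"
      by (simp add: moment_curve_def k)
    finally show ?thesis by simp
  qed
  have "(\<Sum>u\<in>U. c u * poly q (t u)) = (\<Sum>u\<in>U. \<Sum>i\<le>degree q. coeff q i * (c u * t u ^ i))"
    by (simp add: poly_altdef sum_distrib_left mult_ac)
  also have "\<dots> = (\<Sum>i\<le>degree q. coeff q i * (\<Sum>u\<in>U. c u * t u ^ i))"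
    by (subst sum.swap) (simp add: sum_distrib_left)
  also have "\<dots> = 0" using pw deg by (intro sum.neutral) auto
  finally show ?thesis .
qed

lemma degree_prod_linear_le:
  assumes "finite S" shows "degree (\<Prod>w\<in>S. [:t w, - 1 :: real:]) \<le> card S"
proof -
  have "degree (\<Prod>w\<in>S. [:t w, - 1:]) \<le> sum (degree \<circ> (\<lambda>w. [:t w, - 1:])) S"
    by (rule degree_prod_sum_le[OF assms])
  then show ?thesis by simp
qed

lemma poly_prod_linear: "poly (\<Prod>w\<in>S. [:t w, - 1 :: real:]) x = (\<Prod>w\<in>S. t w - x)"
  by (simp add: poly_prod)

lemma general_position_moment_curve:
  fixes idx :: "'k::finite \<Rightarrow> nat"
  assumes idx: "bij_betw idx UNIV {1..CARD('k)}" and fin: "finite J" and inj: "inj_on t J"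
  shows "general_position (\<lambda>u. moment_curve idx (t u)) J"
  unfolding general_position_def
proof (intro allI impI ballI)
  fix U c u assume U: "U \<subseteq> J \<and> card U \<le> DIM(real ^ 'k) + 1 \<and> affine_dependency (\<lambda>u. moment_curve idx (t u)) U c"
    and u: "u \<in> U"
  have finU: "finite U" using U fin finite_subset by blast
  define q where "q = (\<Prod>w\<in>U - {u}. [:t w, - 1:])"
  have "degree q \<le> CARD('k)"
    using degree_prod_linear_le[of "U - {u}" t] finU U u unfolding q_def by (simp, linarith)
  then have "(\<Sum>v\<in>U. c v * poly q (t v)) = 0"
    using moment_dependency_poly[OF idx] U by blast
  also have "(\<Sum>v\<in>U. c v * poly q (t v)) = (\<Sum>v\<in>{u}. c v * poly q (t v))"
    using u finU by (intro sum.mono_neutral_right) (auto simp: q_def poly_prod_linear prod_zero_iff)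
  finally have "c u * (\<Prod>w\<in>U - {u}. t w - t u) = 0" by (simp add: q_def poly_prod_linear)
  moreover have "(\<Prod>w\<in>U - {u}. t w - t u) \<noteq> 0"
    using finU inj U u by (auto simp: prod_zero_iff inj_on_def)
  ultimately show "c u = 0" by simp
qed

lemma prod_differences_sign:
  fixes S :: "nat set"
  assumes "finite S" "z \<notin> S"
  shows "(- 1) ^ card {w\<in>S. w < z} * (\<Prod>w\<in>S. real w - real z) > 0"
  using assms
proof (induction S rule: finite_induct)
  case (insert a S)
  have IH: "(- 1) ^ card {w\<in>S. w < z} * (\<Prod>w\<in>S. real w - real z) > 0" using insert by simp
  show ?case
  proof (cases "a < z")
    case True
    then have "{w\<in>insert a S. w < z} = insert a {w\<in>S. w < z}" by auto
    then have "(- 1) ^ card {w\<in>insert a S. w < z} * (\<Prod>w\<in>insert a S. real w - real z)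
       = (real z - real a) * ((- 1) ^ card {w\<in>S. w < z} * (\<Prod>w\<in>S. real w - real z))"
      using insert by (simp add: algebra_simps)
    then show ?thesis using IH True by (simp only:) (rule mult_pos_pos, auto)
  next
    case False
    then have "{w\<in>insert a S. w < z} = {w\<in>S. w < z}" by auto
    then have "(- 1) ^ card {w\<in>insert a S. w < z} * (\<Prod>w\<in>insert a S. real w - real z)
       = (real a - real z) * ((- 1) ^ card {w\<in>S. w < z} * (\<Prod>w\<in>S. real w - real z))"
      using insert by (simp add: algebra_simps)
    moreover have "a > z" using False insert.prems by auto
    ultimately show ?thesis using IH by (simp only:) (rule mult_pos_pos, auto)
  qed
qed simp

definition order_position :: "nat set \<Rightarrow> nat \<Rightarrow> nat" where
  "order_position U u = card {w\<in>U. w < u}"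

text \<open>
  Take the polynomial that vanishes at all points except \<open>x\<close> and \<open>y\<close>. Its values there have signs that
  count the points below, and they are in the inverse ratio of the coefficients up to a sign.
\<close>
lemma moment_dependency_alternates:
  fixes idx :: "'k::finite \<Rightarrow> nat"
  assumes idx: "bij_betw idx UNIV {1..CARD('k)}"
    and dep: "affine_dependency (\<lambda>u. moment_curve idx (real u)) U c"
    and U: "finite U" "card U = CARD('k) + 2" and nz: "\<And>u. u \<in> U \<Longrightarrow> c u \<noteq> 0"
    and xy: "x \<in> U" "y \<in> U"
  shows "c x * c y * (- 1) ^ (order_position U x + order_position U y) > 0"
proof -
  have less: "c x * c y * (- 1) ^ (order_position U x + order_position U y) > 0" if "x \<in> U" "y \<in> U" "x < y" for x y
  proof -
    define S where "S = U - {x, y}"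
    define Q where "Q = (\<lambda>z::nat. \<Prod>w\<in>S. real w - real z)"
    define q where "q = (\<Prod>w\<in>S. [:real w, - 1:])"
    have S: "finite S" "card S = CARD('k)" "x \<notin> S" "y \<notin> S"
      unfolding S_def using U that by (auto simp: card_Diff_subset)
    have "degree q \<le> CARD('k)" using degree_prod_linear_le[of S real] S unfolding q_def by simp
    then have "(\<Sum>v\<in>U. c v * poly q (real v)) = 0"
      using moment_dependency_poly[OF idx dep] by blast
    also have "(\<Sum>v\<in>U. c v * poly q (real v)) = (\<Sum>v\<in>{x, y}. c v * poly q (real v))"
      using that U by (intro sum.mono_neutral_right) (auto simp: q_def poly_prod_linear prod_zero_iff S_def)
    finally have "c x * Q x + c y * Q y = 0"
      using that by (simp add: q_def poly_prod_linear Q_def)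
    then have eq: "c x * Q x = - (c y * Q y)" by simp
    define a b where "a = card {w\<in>S. w < x}" and "b = card {w\<in>S. w < y}"
    have pos: "(- 1) ^ a * Q x > 0" "(- 1) ^ b * Q y > 0"
      unfolding a_def b_def Q_def using S by (simp_all add: prod_differences_sign)
    have a: "order_position U x = a" unfolding order_position_def a_def S_def using that by (intro arg_cong[of _ _ card]) auto
    have "{w\<in>U. w < y} = insert x {w\<in>S. w < y}" unfolding S_def using that by auto
    then have b: "order_position U y = Suc b" unfolding order_position_def b_def using S by simp
    have "(c x * c y * (- 1) ^ (a + b)) * ((- 1) ^ a * Q x) = - ((c y)\<^sup>2 * ((- 1) ^ b * Q y))"
    proof -
      have "(c x * c y * (- 1) ^ (a + b)) * ((- 1) ^ a * Q x) = c y * (- 1) ^ b * ((- 1) ^ a * (- 1) ^ a) * (c x * Q x)"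
        by (simp add: power_add)
      also have "(- 1) ^ a * (- 1) ^ a = (1::real)" by (simp flip: power_add add: mult_2[symmetric])
      finally show ?thesis by (simp add: eq power2_eq_square)
    qed
    also have "\<dots> < 0" using pos(2) nz[OF that(2)] by simp
    finally have "c x * c y * (- 1) ^ (a + b) < 0" using pos(1) by (meson mult_less_0_iff not_less_iff_gr_or_eq)
    then show ?thesis unfolding a b by simp
  qed
  consider "x < y" | "y < x" | "x = y" by linarith
  then show ?thesis
  proof cases
    case 1 then show ?thesis using less xy by blast
  next
    case 2 then show ?thesis using less[OF xy(2,1) 2] by (simp add: ac_simps)
  next
    case 3
    have "(- 1) ^ (order_position U y + order_position U y) = (1::real)" by (simp flip: mult_2)
    then show ?thesis using nz[OF xy(2)] by (simp add: 3 power2_eq_square[symmetric] del: power_add)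
  qed
qed

text \<open>
  The dependency on \<open>DIM + 2\<close> points of the curve is unique up to a factor and its signs alternate along
  the curve.
\<close>
lemma crosses_moment_curve_iff:
  fixes idx :: "'k::finite \<Rightarrow> nat"
  assumes idx: "bij_betw idx UNIV {1..CARD('k)}" and fin: "finite A" "finite B" and disj: "A \<inter> B = {}"
    and card: "card A + card B = CARD('k) + 2"
  shows "crosses (\<lambda>u. moment_curve idx (real u)) A B \<longleftrightarrow>
    (\<exists>s. (\<forall>u\<in>A. even (order_position (A \<union> B) u) = s) \<and> (\<forall>u\<in>B. even (order_position (A \<union> B) u) \<noteq> s))"
proof -
  define U where "U = A \<union> B"
  let ?pos = "\<lambda>u. moment_curve idx (real u)"
  have U: "finite U" "card U = CARD('k) + 2"
    unfolding U_def using fin disj card by (auto simp: card_Un_disjoint)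
  have gp: "general_position ?pos U"
    by (rule general_position_moment_curve[OF idx U(1)]) (auto simp: inj_on_def)
  have all_nz: "c u \<noteq> 0" if dep: "affine_dependency ?pos U c" and v: "v \<in> U" "c v \<noteq> 0" and u: "u \<in> U" for c u v
  proof
    assume "c u = 0"
    then have "affine_dependency ?pos (U - {u}) c" using dep affine_dependency_remove_zero[OF U(1) u] by blast
    moreover have "card (U - {u}) \<le> DIM(real ^ 'k) + 1" using U u by simp
    moreover have "v \<in> U - {u}" using v \<open>c u = 0\<close> by auto
    ultimately have "c v = 0" using general_positionD[OF gp, of "U - {u}" c v] by blast
    then show False using v by simp
  qed
  have sign: "(c x > 0) = ((c y > 0) = (even (order_position U x) = even (order_position U y)))"
    if dep: "affine_dependency ?pos U c" and v: "v \<in> U" "c v \<noteq> 0" and xy: "x \<in> U" "y \<in> U" for c x y v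
  proof -
    have nz: "c u \<noteq> 0" if "u \<in> U" for u using all_nz[OF dep v that] .
    have "c x * c y * (- 1) ^ (order_position U x + order_position U y) > 0"
      using moment_dependency_alternates[OF idx dep U nz xy] .
    then show ?thesis
      using nz[OF xy(1)] nz[OF xy(2)]
      by (cases "even (order_position U x + order_position U y)") (auto simp: zero_less_mult_iff mult_less_0_iff)
  qed
  show ?thesis unfolding U_def[symmetric]
  proof
    assume "crosses ?pos A B"
    then obtain c where c: "affine_dependency ?pos U c" "\<forall>a\<in>A. c a > 0" "\<forall>b\<in>B. c b < 0"
      unfolding crosses_def U_def by blast
    have "U \<noteq> {}" using U by auto
    then obtain v where v: "v \<in> U" by blast
    then have cv: "c v \<noteq> 0" using c unfolding U_def by fastforce
    define s where "s = (even (order_position U v) = (c v > 0))"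
    have "even (order_position U u) = s" if "u \<in> A" for u
      using sign[OF c(1) v cv _ v, of u] c that unfolding s_def U_def by auto
    moreover have "even (order_position U u) \<noteq> s" if "u \<in> B" for u
      using sign[OF c(1) v cv _ v, of u] c that unfolding s_def U_def by (auto dest: less_asym)
    ultimately show "\<exists>s. (\<forall>u\<in>A. even (order_position U u) = s) \<and> (\<forall>u\<in>B. even (order_position U u) \<noteq> s)" by blast
  next
    assume "\<exists>s. (\<forall>u\<in>A. even (order_position U u) = s) \<and> (\<forall>u\<in>B. even (order_position U u) \<noteq> s)"
    then obtain s where s: "\<And>u. u \<in> A \<Longrightarrow> even (order_position U u) = s" "\<And>u. u \<in> B \<Longrightarrow> even (order_position U u) \<noteq> s" by blast
    have "card U \<ge> DIM(real ^ 'k) + 2" using U by simp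
    then obtain c v where c: "affine_dependency ?pos U c" "v \<in> U" "c v \<noteq> 0"
      using affine_dependency_exists[OF U(1)] by blast
    have nz: "c u \<noteq> 0" if "u \<in> U" for u using all_nz[OF c that] .
    define e where "e = (if (c v > 0) = (even (order_position U v) = s) then 1 else (-1::real))"
    have "affine_dependency ?pos U (\<lambda>u. e * c u)" using c(1) by (rule affine_dependency_scale)
    moreover have "e * c u > 0" if "u \<in> A" for u
      using sign[OF c(1,2,3) _ c(2), of u] s(1)[OF that] nz[of u] that unfolding e_def U_def by auto
    moreover have "e * c u < 0" if "u \<in> B" for u
      using sign[OF c(1,2,3) _ c(2), of u] s(2)[OF that] nz[of u] that unfolding e_def U_def by auto
    ultimately show "crosses ?pos A B" unfolding crosses_def U_def by blast
  qed
qed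

section \<open>Subdivisions as chain maps\<close>

lemma lookup_scaleR [simp]: "Poly_Mapping.lookup (r *\<^sub>R x) v = r *\<^sub>R Poly_Mapping.lookup x v"
proof -
  have "finite {i. r *\<^sub>R Poly_Mapping.lookup x i \<noteq> 0}"
    by (rule finite_subset[OF _ finite_lookup[of x]]) auto
  then show ?thesis by (simp add: scaleR_poly_mapping_def)
qed

lemma lookup_std_vertex: "Poly_Mapping.lookup (std_vertex v) w = (if v = w then 1 else 0)"
  by (simp add: std_vertex_def lookup_single when_def)

lemma inj_std_vertex: "inj std_vertex"
  by (rule injI) (metis lookup_std_vertex zero_neq_one)

abbreviation std_simplex :: "'v set \<Rightarrow> ('v \<Rightarrow>\<^sub>0 real) set" where
  "std_simplex \<sigma> \<equiv> convex hull (std_vertex ` \<sigma>)"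

lemma lookup_combination:
  assumes "finite \<sigma>"
  shows "Poly_Mapping.lookup (\<Sum>v\<in>\<sigma>. c v *\<^sub>R std_vertex v) w = (if w \<in> \<sigma> then c w else 0)"
proof -
  have "Poly_Mapping.lookup (\<Sum>v\<in>\<sigma>. c v *\<^sub>R std_vertex v) w = (\<Sum>v\<in>\<sigma>. if v = w then c v else 0)"
    by (simp add: lookup_sum lookup_std_vertex if_distrib cong: if_cong)
  then show ?thesis using assms by (simp add: sum.delta)
qed

lemma std_expansion:
  fixes x :: "'v \<Rightarrow>\<^sub>0 real"
  assumes "finite \<sigma>" "Poly_Mapping.keys x \<subseteq> \<sigma>"
  shows "x = (\<Sum>v\<in>\<sigma>. Poly_Mapping.lookup x v *\<^sub>R std_vertex v)"
  by (rule poly_mapping_eqI) (use assms in \<open>auto simp: lookup_combination in_keys_iff\<close>)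

text \<open>
  Barycentric coordinates in a standard simplex are the coordinates of the ambient space.
\<close>
lemma in_std_simplex_iff:
  assumes "finite \<sigma>"
  shows "x \<in> std_simplex \<sigma> \<longleftrightarrow>
    Poly_Mapping.keys x \<subseteq> \<sigma> \<and> (\<forall>v. 0 \<le> Poly_Mapping.lookup x v) \<and> (\<Sum>v\<in>\<sigma>. Poly_Mapping.lookup x v) = 1"
proof
  assume "x \<in> std_simplex \<sigma>"
  then obtain u where u: "\<forall>p\<in>std_vertex ` \<sigma>. 0 \<le> u p" "sum u (std_vertex ` \<sigma>) = 1"
    "(\<Sum>p\<in>std_vertex ` \<sigma>. u p *\<^sub>R p) = x"
    using assms by (auto simp: convex_hull_finite)
  have inj: "inj_on std_vertex \<sigma>" by (rule inj_on_subset[OF inj_std_vertex subset_UNIV])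
  have x: "x = (\<Sum>v\<in>\<sigma>. u (std_vertex v) *\<^sub>R std_vertex v)"
    using u(3) by (simp add: sum.reindex[OF inj])
  have l: "Poly_Mapping.lookup x w = (if w \<in> \<sigma> then u (std_vertex w) else 0)" for w
    unfolding x by (rule lookup_combination[OF assms])
  show "Poly_Mapping.keys x \<subseteq> \<sigma> \<and> (\<forall>v. 0 \<le> Poly_Mapping.lookup x v) \<and> (\<Sum>v\<in>\<sigma>. Poly_Mapping.lookup x v) = 1"
    using u(1,2) by (auto simp: l in_keys_iff sum.reindex[OF inj] split: if_split_asm)
next
  assume x: "Poly_Mapping.keys x \<subseteq> \<sigma> \<and> (\<forall>v. 0 \<le> Poly_Mapping.lookup x v) \<and> (\<Sum>v\<in>\<sigma>. Poly_Mapping.lookup x v) = 1"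
  have "(\<Sum>v\<in>\<sigma>. Poly_Mapping.lookup x v *\<^sub>R std_vertex v) \<in> std_simplex \<sigma>"
    using x assms by (intro convex_sum) (auto intro: hull_inc)
  then show "x \<in> std_simplex \<sigma>" using std_expansion[of \<sigma> x] x assms by simp
qed

lemma scaled_sum_in_hull:
  fixes S :: "'e::real_vector set"
  assumes "finite S" "\<And>q. q \<in> S \<Longrightarrow> 0 \<le> c q" "sum c S = r" "r > 0"
  shows "(1 / r) *\<^sub>R (\<Sum>q\<in>S. c q *\<^sub>R q) \<in> convex hull S"
proof -
  have "(\<Sum>q\<in>S. (c q / r) *\<^sub>R q) \<in> convex hull S"
    using assms by (intro convex_sum) (auto intro: hull_inc simp flip: sum_divide_distrib)
  then show ?thesis by (simp add: scaleR_sum_right)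
qed

lemma independent_span_unique:
  fixes S :: "'e::real_vector set"
  assumes "independent S" "finite S" "(\<Sum>q\<in>S. a q *\<^sub>R q) = (\<Sum>q\<in>S. b q *\<^sub>R q)" "q \<in> S"
  shows "a q = b q"
proof (rule ccontr)
  assume neq: "a q \<noteq> b q"
  have 0: "(\<Sum>q\<in>S. (a q - b q) *\<^sub>R q) = 0"
    using assms(3) by (simp add: scaleR_diff_left sum_subtractf)
  have "\<exists>u. (\<exists>v\<in>S. u v \<noteq> 0) \<and> (\<Sum>v\<in>S. u v *\<^sub>R v) = 0"
    by (rule exI[of _ "\<lambda>q. a q - b q"]) (use 0 neq assms(4) in auto)
  then show False using assms(1) dependent_finite[OF assms(2)] by simp
qed

locale subdivided_complex =
  fixes K :: "'v set set" and L :: "('v \<Rightarrow>\<^sub>0 real) set set"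
  assumes complexK: "abstract_complex K" and subdiv: "subdivision_of L K"
begin

definition points :: "('v \<Rightarrow>\<^sub>0 real) set" where "points = \<Union>L"

text \<open>
  The chain that represents a face after subdivision.
\<close>
definition subdivided :: "'v set \<Rightarrow> ('v \<Rightarrow>\<^sub>0 real) set \<Rightarrow> bit" where
  "subdivided \<sigma> s = of_bool (s \<in> L \<and> card s = card \<sigma> \<and> (\<forall>p\<in>s. Poly_Mapping.keys p \<subseteq> \<sigma>))"

lemma subdivided_nonzero:
  "subdivided \<sigma> s \<noteq> 0 \<longleftrightarrow> s \<in> L \<and> card s = card \<sigma> \<and> (\<forall>p\<in>s. Poly_Mapping.keys p \<subseteq> \<sigma>)"
  by (auto simp: subdivided_def)

lemma finite_faceK: "\<sigma> \<in> K \<Longrightarrow> finite \<sigma>" and faceK_closed: "\<sigma> \<in> K \<Longrightarrow> \<tau> \<subseteq> \<sigma> \<Longrightarrow> \<tau> \<in> K"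
  using complexK unfolding abstract_complex_def by blast+

lemma finiteL: "finite L" and finite_faceL: "s \<in> L \<Longrightarrow> finite s"
  and faceL_closed: "s \<in> L \<Longrightarrow> t \<subseteq> s \<Longrightarrow> t \<in> L"
  using subdiv unfolding subdivision_of_def abstract_complex_def by blast+

lemma finite_points: "finite points"
  unfolding points_def using finiteL finite_faceL by blast

lemma faceL_independent: "s \<in> L \<Longrightarrow> \<not> affine_dependent s"
  using subdiv unfolding subdivision_of_def linear_embedding_def by simp

lemma faceL_Int: "s \<in> L \<Longrightarrow> t \<in> L \<Longrightarrow> convex hull s \<inter> convex hull t = convex hull (s \<inter> t)"
  using subdiv unfolding subdivision_of_def linear_embedding_def by simp

lemma pointE:
  assumes "p \<in> s" "s \<in> L"
  obtains \<tau> where "\<tau> \<in> K" "p \<in> std_simplex \<tau>"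
proof -
  obtain \<tau> where "\<tau> \<in> K" "convex hull s \<subseteq> std_simplex \<tau>"
    using subdiv assms(2) unfolding subdivision_of_def by blast
  then show ?thesis using that assms(1) hull_inc[of p s convex] by blast
qed

lemma point_nonneg:
  assumes "p \<in> s" "s \<in> L"
  shows "0 \<le> Poly_Mapping.lookup p v"
proof -
  obtain \<tau> where "\<tau> \<in> K" "p \<in> std_simplex \<tau>" using pointE assms by blast
  then show ?thesis by (simp add: in_std_simplex_iff finite_faceK)
qed

lemma point_sum:
  assumes "p \<in> s" "s \<in> L" "finite \<sigma>" "Poly_Mapping.keys p \<subseteq> \<sigma>"
  shows "(\<Sum>v\<in>\<sigma>. Poly_Mapping.lookup p v) = 1"
proof -
  obtain \<tau> where "\<tau> \<in> K" "p \<in> std_simplex \<tau>" using pointE assms by blast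
  then have t: "finite \<tau>" "Poly_Mapping.keys p \<subseteq> \<tau>" "(\<Sum>v\<in>\<tau>. Poly_Mapping.lookup p v) = 1"
    by (auto simp: in_std_simplex_iff finite_faceK)
  have "(\<Sum>v\<in>\<sigma>. Poly_Mapping.lookup p v) = (\<Sum>v\<in>Poly_Mapping.keys p. Poly_Mapping.lookup p v)"
    using assms by (intro sum.mono_neutral_right) (auto simp: in_keys_iff)
  also have "\<dots> = (\<Sum>v\<in>\<tau>. Poly_Mapping.lookup p v)"
    using t by (intro sum.mono_neutral_left) (auto simp: in_keys_iff)
  finally show ?thesis using t by simp
qed

lemma point_in_std_simplex:
  assumes "p \<in> s" "s \<in> L" "finite \<sigma>"
  shows "p \<in> std_simplex \<sigma> \<longleftrightarrow> Poly_Mapping.keys p \<subseteq> \<sigma>"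
  using point_sum[OF assms] point_nonneg[OF assms(1,2)] assms(3) by (auto simp: in_std_simplex_iff)

lemma keys_nonempty: "p \<in> points \<Longrightarrow> Poly_Mapping.keys p \<noteq> {}"
  using point_sum[of p _ "{}"] unfolding points_def by auto

text \<open>
  All coordinates of the vertices of \<open>s\<close> are nonnegative, so a vertex with a positive weight in \<open>x\<close>
  cannot have a coordinate that vanishes in \<open>x\<close>. Hence a face of \<open>K\<close> cuts out a face of every simplex of \<open>L\<close>.
\<close>
lemma hull_Int_std_simplex:
  assumes s: "s \<in> L" and \<sigma>: "finite \<sigma>" and x: "x \<in> convex hull s" "x \<in> std_simplex \<sigma>"
  shows "x \<in> convex hull {p\<in>s. Poly_Mapping.keys p \<subseteq> \<sigma>}"
proof -
  have fin: "finite s" using s finite_faceL by blast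
  obtain u where u: "\<forall>p\<in>s. 0 \<le> u p" "sum u s = 1" "(\<Sum>p\<in>s. u p *\<^sub>R p) = x"
    using x(1) fin by (auto simp: convex_hull_finite)
  have zero: "u p = 0" if p: "p \<in> s" "\<not> Poly_Mapping.keys p \<subseteq> \<sigma>" for p
  proof -
    obtain v where v: "v \<in> Poly_Mapping.keys p" "v \<notin> \<sigma>" using p by blast
    have "Poly_Mapping.lookup x v = 0"
      using x(2) v(2) \<sigma> by (auto simp: in_std_simplex_iff in_keys_iff)
    then have "(\<Sum>p\<in>s. u p * Poly_Mapping.lookup p v) = 0"
      using u(3) by (auto simp: lookup_sum)
    then have "u p * Poly_Mapping.lookup p v = 0"
      using fin u(1) point_nonneg[OF _ s] p(1) by (subst (asm) sum_nonneg_eq_0_iff) auto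
    then show ?thesis using v(1) by (simp add: in_keys_iff)
  qed
  let ?s = "{p\<in>s. Poly_Mapping.keys p \<subseteq> \<sigma>}"
  have "sum u ?s = 1" "(\<Sum>p\<in>?s. u p *\<^sub>R p) = x"
    unfolding u(2,3)[symmetric] using fin zero by (intro sum.mono_neutral_left; auto)+
  then show ?thesis using u(1) fin by (auto simp: convex_hull_finite)
qed

text \<open>
  The vertices of \<open>L\<close> lie in the hyperplane of coordinate sum 1, where affine and linear independence
  coincide.
\<close>
lemma faceL_linear_independent:
  assumes s: "s \<in> L"
  shows "independent s"
proof -
  have fin: "finite s" using s finite_faceL by blast
  have "c p = 0" if c: "(\<Sum>p\<in>s. c p *\<^sub>R p) = 0" and p: "p \<in> s" for c p
  proof -
    define V where "V = (\<Union>p\<in>s. Poly_Mapping.keys p)"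
    have V: "finite V" unfolding V_def using fin by simp
    have "sum c s = (\<Sum>p\<in>s. c p * (\<Sum>v\<in>V. Poly_Mapping.lookup p v))"
      using point_sum[OF _ s V] by (intro sum.cong) (auto simp: V_def)
    also have "\<dots> = (\<Sum>v\<in>V. Poly_Mapping.lookup (\<Sum>p\<in>s. c p *\<^sub>R p) v)"
      unfolding sum_distrib_left by (subst sum.swap) (simp add: lookup_sum)
    also have "\<dots> = 0" using c by simp
    finally have "sum c s = 0" .
    then show ?thesis
      using faceL_independent[OF s] c p unfolding affine_dependent_explicit_finite[OF fin] by auto
  qed
  then show ?thesis using dependent_finite[OF fin] by blast
qed

lemma faceL_span:
  assumes "finite \<sigma>" "\<And>p. p \<in> s \<Longrightarrow> Poly_Mapping.keys p \<subseteq> \<sigma>"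
  shows "s \<subseteq> span (std_vertex ` \<sigma>)"
proof
  fix p assume "p \<in> s"
  then have "p = (\<Sum>v\<in>\<sigma>. Poly_Mapping.lookup p v *\<^sub>R std_vertex v)"
    using std_expansion assms by blast
  also have "\<dots> \<in> span (std_vertex ` \<sigma>)"
    by (intro span_sum span_scale span_base) auto
  finally show "p \<in> span (std_vertex ` \<sigma>)" .
qed

lemma independent_card_bound:
  assumes "finite \<sigma>" "independent S" "S \<subseteq> span (std_vertex ` \<sigma>)"
  shows "finite S" "card S \<le> card \<sigma>"
  using independent_span_bound[of "std_vertex ` \<sigma>" S] assms card_image_le[of \<sigma> std_vertex] by auto

lemma geom_pointE:
  assumes "x \<in> std_simplex \<sigma>" "\<sigma> \<in> K"
  obtains s where "s \<in> L" "x \<in> convex hull s"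
proof -
  have "x \<in> underlying_space id L"
    using subdiv assms unfolding subdivision_of_def geom_realisation_def by (auto simp: underlying_space_def)
  then show ?thesis using that unfolding underlying_space_def by auto
qed

text \<open>
  The simplex of \<open>L\<close> that covers the vertex has a face inside \<open>{v}\<close>, which can only be the vertex itself.
  This is the case \<open>t = {}\<close> of the count of cofaces below.
\<close>
lemma subdivided_vertex:
  assumes "{v} \<in> K"
  shows "{p\<in>points. {p} \<in> L \<and> Poly_Mapping.keys p \<subseteq> {v}} = {std_vertex v}"
proof -
  have eq: "p = std_vertex v" if "{p} \<in> L" "Poly_Mapping.keys p \<subseteq> {v}" for p
  proof -
    have "p \<in> std_simplex {v}" using point_in_std_simplex[of p "{p}" "{v}"] that by simp
    then show ?thesis by simp
  qed
  obtain s where s: "s \<in> L" "std_vertex v \<in> convex hull s"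
    using geom_pointE[of "std_vertex v" "{v}"] assms by auto
  have "std_vertex v \<in> convex hull {p\<in>s. Poly_Mapping.keys p \<subseteq> {v}}"
    by (rule hull_Int_std_simplex[OF s(1) _ s(2)]) auto
  then obtain p where p: "p \<in> s" "Poly_Mapping.keys p \<subseteq> {v}"
    by (metis (mono_tags, lifting) convex_hull_empty empty_iff equals0I mem_Collect_eq)
  have "{p} \<in> L" using faceL_closed[OF s(1), of "{p}"] p by simp
  then show ?thesis using eq p unfolding points_def by (auto intro: eq)
qed

text \<open>
  A subdivided simplex is a pseudomanifold with boundary: a simplex \<open>t\<close> of codimension 1 in \<open>\<sigma>\<close> has one
  coface inside \<open>\<sigma>\<close> if it lies in a facet of \<open>\<sigma>\<close> and two otherwise. Indeed, let \<open>l\<close> be a linear form that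
  vanishes on \<open>t\<close> but not on \<open>\<sigma>\<close>. On each side of \<open>t\<close> there is at most one coface, because two of them would
  overlap near \<open>t\<close>. There is at least one if \<open>\<sigma>\<close> has a vertex on this side, because points slightly off
  the barycentre of \<open>t\<close> in the direction of this vertex are covered by \<open>L\<close>. In the interior of \<open>\<sigma>\<close> the form
  \<open>l\<close> takes both signs on the vertices of \<open>\<sigma>\<close>; along a facet only one vertex of \<open>\<sigma>\<close> is off the zero set.
\<close>
lemma card_cofaces_in_subdivision:
  assumes t: "t \<in> L" and \<sigma>: "\<sigma> \<in> K" and card: "card t + 1 = card \<sigma>"
    and tk: "\<And>p. p \<in> t \<Longrightarrow> Poly_Mapping.keys p \<subseteq> \<sigma>" and ne: "t \<noteq> {}"
  defines "P \<equiv> {p\<in>points - t. insert p t \<in> L \<and> Poly_Mapping.keys p \<subseteq> \<sigma>}"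
  shows "card P = (if \<exists>v\<in>\<sigma>. \<forall>p\<in>t. Poly_Mapping.keys p \<subseteq> \<sigma> - {v} then 1 else 2)"
    and "card {v\<in>\<sigma>. \<forall>p\<in>t. Poly_Mapping.keys p \<subseteq> \<sigma> - {v}} \<le> 1"
proof -
  have fin\<sigma>: "finite \<sigma>" and fint: "finite t" using \<sigma> t finite_faceK finite_faceL by auto
  have indt: "independent t" using faceL_linear_independent[OF t] .
  define e :: "'v \<Rightarrow> ('v \<Rightarrow>\<^sub>0 real)" where "e = std_vertex"
  have tsp: "t \<subseteq> span (e ` \<sigma>)" unfolding e_def using faceL_span[OF fin\<sigma> tk] .
  obtain v0 where v0: "v0 \<in> \<sigma>" "e v0 \<notin> span t"
  proof (rule ccontr)
    assume "\<not> thesis"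
    then have "e ` \<sigma> \<subseteq> span t" using that by blast
    moreover have "independent (e ` \<sigma>)"
    proof -
      have inj: "inj_on e \<sigma>" unfolding e_def by (rule inj_on_subset[OF inj_std_vertex subset_UNIV])
      have "c q = 0" if c: "(\<Sum>q\<in>e ` \<sigma>. c q *\<^sub>R q) = 0" "q \<in> e ` \<sigma>" for c q
      proof -
        obtain w where w: "w \<in> \<sigma>" "q = e w" using c(2) by blast
        have "0 = Poly_Mapping.lookup (\<Sum>v\<in>\<sigma>. c (e v) *\<^sub>R e v) w"
          using c(1) by (simp add: sum.reindex[OF inj])
        also have "\<dots> = c (e w)" unfolding e_def using w by (subst lookup_combination[OF fin\<sigma>]) simp
        finally show ?thesis using w by simp
      qed
      then show ?thesis using dependent_finite[of "e ` \<sigma>"] fin\<sigma> by blast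
    qed
    ultimately have "card (e ` \<sigma>) \<le> card t" using independent_span_bound[OF fint] by blast
    moreover have "card (e ` \<sigma>) = card \<sigma>" unfolding e_def
      by (intro card_image inj_on_subset[OF inj_std_vertex subset_UNIV])
    ultimately show False using card by simp
  qed
  have ind0: "independent (insert (e v0) t)" using independent_insertI[OF v0(2) indt] .
  then obtain l :: "('v \<Rightarrow>\<^sub>0 real) \<Rightarrow> real" where l: "linear l" "\<And>x. x \<in> insert (e v0) t \<Longrightarrow> l x = (if x = e v0 then 1 else 0)"
    using linear_independent_extend[OF ind0, of "\<lambda>x. if x = e v0 then 1 else (0::real)"] by blast
  have lt: "l x = 0" if "x \<in> t" for x using l(2)[of x] that v0(2) span_base by auto
  have lt_span: "l x = 0" if "x \<in> span t" for x using linear_eq_0_on_span[OF l(1)] lt that by blast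
  have lv0: "l (e v0) = 1" using l(2) by simp
  \<comment> \<open>On the span of the face, the zero set of \<open>l\<close> is the span of \<open>t\<close>.\<close>
  have ker: "x \<in> span t" if x: "x \<in> span (e ` \<sigma>)" "l x = 0" for x
  proof -
    have "x \<in> span (insert (e v0) t)"
    proof (rule ccontr)
      assume n: "x \<notin> span (insert (e v0) t)"
      then have "independent (insert x (insert (e v0) t))" using independent_insertI ind0 by blast
      moreover have "insert x (insert (e v0) t) \<subseteq> span (e ` \<sigma>)" using x tsp v0 by (auto intro: span_base)
      ultimately have "card (insert x (insert (e v0) t)) \<le> card \<sigma>"
        using independent_card_bound[OF fin\<sigma>] unfolding e_def by blast
      moreover have "x \<notin> insert (e v0) t" using n span_base[of x "insert (e v0) t"] by blast
      moreover have "e v0 \<notin> t" using v0(2) span_base[of "e v0" t] by blast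
      ultimately show False using fint card by simp
    qed
    then obtain k where k: "x - k *\<^sub>R e v0 \<in> span t" using span_breakdown_eq by blast
    have "0 = l (x - k *\<^sub>R e v0)" using lt_span[OF k] by simp
    also have "\<dots> = - k" using l(1) x(2) lv0 by (simp add: linear_diff linear_scale)
    finally show ?thesis using k by simp
  qed
  have lP: "l p \<noteq> 0" if "p \<in> P" for p
  proof
    assume "l p = 0"
    have p: "p \<notin> t" "insert p t \<in> L" "Poly_Mapping.keys p \<subseteq> \<sigma>" using that unfolding P_def by auto
    have "p \<in> span (e ` \<sigma>)" using faceL_span[OF fin\<sigma>, of "{p}"] p(3) unfolding e_def by simp
    then have "p \<in> span t" using ker \<open>l p = 0\<close> by blast
    moreover have "p \<notin> span t"
      using faceL_linear_independent[OF p(2)] p(1) by (simp add: independent_insert)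
    ultimately show False by simp
  qed
  have uniq: "p = p'" if p: "p \<in> P" and p': "p' \<in> P" and sgn: "l p * l p' > 0" for p p'
  proof (rule ccontr)
    assume neq: "p \<noteq> p'"
    have pp: "p \<notin> t" "insert p t \<in> L" "Poly_Mapping.keys p \<subseteq> \<sigma>" using p unfolding P_def by auto
    have pp': "p' \<notin> t" "insert p' t \<in> L" "Poly_Mapping.keys p' \<subseteq> \<sigma>" using p' unfolding P_def by auto
    define \<alpha> where "\<alpha> = l p / l p'"
    have \<alpha>: "\<alpha> > 0" using sgn unfolding \<alpha>_def by (simp add: zero_less_divide_iff zero_less_mult_iff)
    have sp: "p \<in> span (e ` \<sigma>)" "p' \<in> span (e ` \<sigma>)"
      using faceL_span[OF fin\<sigma>, of "{p, p'}"] pp(3) pp'(3) unfolding e_def by auto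
    have "l (p - \<alpha> *\<^sub>R p') = 0" using l(1) lP[OF p'] by (simp add: \<alpha>_def linear_diff linear_scale)
    then have "p - \<alpha> *\<^sub>R p' \<in> span t" using ker sp by (simp add: span_diff span_scale)
    then obtain c where c: "p - \<alpha> *\<^sub>R p' = (\<Sum>q\<in>t. c q *\<^sub>R q)"
      using span_finite[OF fint] by auto
    \<comment> \<open>A multiple of the barycentre of \<open>t\<close> large enough to make both expansions of \<open>x\<close> nonnegative.\<close>
    define N where "N = (\<Sum>q\<in>t. \<bar>c q\<bar>)"
    have N: "N + c q \<ge> 0" if "q \<in> t" for q
      using member_le_sum[of q t "\<lambda>q. \<bar>c q\<bar>"] that fint unfolding N_def by simp
    have N0: "N \<ge> 0" unfolding N_def by (simp add: sum_nonneg)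
    define x where "x = p + (\<Sum>q\<in>t. N *\<^sub>R q)"
    have x': "x = \<alpha> *\<^sub>R p' + (\<Sum>q\<in>t. (N + c q) *\<^sub>R q)"
    proof -
      have "p = \<alpha> *\<^sub>R p' + (\<Sum>q\<in>t. c q *\<^sub>R q)" using c by (metis add.commute diff_eq_eq)
      then show ?thesis unfolding x_def by (simp add: scaleR_add_left sum.distrib)
    qed
    define r where "r = 1 + N * card t"
    have r: "r > 0" unfolding r_def using N0 by (simp add: add_pos_nonneg)
    have tot: "(\<Sum>v\<in>\<sigma>. Poly_Mapping.lookup (k *\<^sub>R q + (\<Sum>q\<in>t. f q *\<^sub>R q)) v) = k + sum f t"
      if "q \<in> s" "s \<in> L" "Poly_Mapping.keys q \<subseteq> \<sigma>" for q s k f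
    proof -
      have "(\<Sum>v\<in>\<sigma>. Poly_Mapping.lookup (k *\<^sub>R q + (\<Sum>q\<in>t. f q *\<^sub>R q)) v)
        = k * (\<Sum>v\<in>\<sigma>. Poly_Mapping.lookup q v) + (\<Sum>v\<in>\<sigma>. \<Sum>q\<in>t. f q * Poly_Mapping.lookup q v)"
        by (simp add: lookup_add lookup_sum sum.distrib sum_distrib_left)
      also have "(\<Sum>v\<in>\<sigma>. \<Sum>q\<in>t. f q * Poly_Mapping.lookup q v) = (\<Sum>q\<in>t. f q * (\<Sum>v\<in>\<sigma>. Poly_Mapping.lookup q v))"
        by (subst sum.swap) (simp add: sum_distrib_left)
      also have "\<dots> = sum f t" using point_sum[OF _ t fin\<sigma> tk] by simp
      also have "(\<Sum>v\<in>\<sigma>. Poly_Mapping.lookup q v) = 1" using point_sum[OF that(1,2) fin\<sigma> that(3)] .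
      finally show ?thesis by simp
    qed
    have r': "\<alpha> + (\<Sum>q\<in>t. N + c q) = r"
      using tot[OF _ pp(2,3), of 1 "\<lambda>_. N"] tot[OF _ pp'(2,3), of \<alpha> "\<lambda>q. N + c q"] x'
      by (simp add: x_def r_def mult.commute)
    have "(1 / r) *\<^sub>R x \<in> convex hull (insert p t)"
    proof -
      have "(\<Sum>q\<in>insert p t. (if q = p then 1 else N) *\<^sub>R q) = x"
        using pp(1) fint unfolding x_def by (auto intro!: sum.cong)
      moreover have "(\<Sum>q\<in>insert p t. if q = p then 1 else N) = r"
      proof -
        have "(\<Sum>q\<in>t. if q = p then 1 else N) = (\<Sum>q\<in>t. N)" using pp(1) by (intro sum.cong) auto
        then show ?thesis using pp(1) fint by (simp add: r_def mult.commute)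
      qed
      ultimately show ?thesis
        using scaled_sum_in_hull[of "insert p t" "\<lambda>q. if q = p then 1 else N" r] fint N0 r by simp
    qed
    moreover have "(1 / r) *\<^sub>R x \<in> convex hull (insert p' t)"
    proof -
      have e1: "(\<Sum>q\<in>t. (if q = p' then \<alpha> else N + c q) *\<^sub>R q) = (\<Sum>q\<in>t. (N + c q) *\<^sub>R q)"
        "(\<Sum>q\<in>t. if q = p' then \<alpha> else N + c q) = (\<Sum>q\<in>t. N + c q)"
        using pp'(1) by (intro sum.cong; auto)+
      have s1: "(\<Sum>q\<in>insert p' t. (if q = p' then \<alpha> else N + c q) *\<^sub>R q) = x"
        unfolding x' sum.insert[OF fint pp'(1)] e1 by simp
      have s2: "(\<Sum>q\<in>insert p' t. if q = p' then \<alpha> else N + c q) = r"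
        unfolding r'[symmetric] sum.insert[OF fint pp'(1)] e1 by simp
      have nn: "0 \<le> (if q = p' then \<alpha> else N + c q)" if "q \<in> insert p' t" for q using N \<alpha> that by auto
      show ?thesis using scaled_sum_in_hull[OF _ nn s2 r] fint unfolding s1 by simp
    qed
    ultimately have "(1 / r) *\<^sub>R x \<in> convex hull (insert p t \<inter> insert p' t)"
      using faceL_Int[OF pp(2) pp'(2)] by blast
    also have "insert p t \<inter> insert p' t = t" using neq pp(1) pp'(1) by auto
    also have "convex hull t \<subseteq> span t" by (meson convex_hull_subset_span)
    finally have "l ((1 / r) *\<^sub>R x) = 0" by (rule lt_span)
    then have "l x = 0" using r l(1) by (simp add: linear_scale)
    moreover have "l x = l p"
    proof -
      have "(\<Sum>q\<in>t. N *\<^sub>R q) \<in> span t" by (intro span_sum span_scale span_base)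
      then show ?thesis unfolding x_def using l(1) lt_span by (simp add: linear_add)
    qed
    ultimately show False using lP[OF p] by simp
  qed
  define b where "b = (\<Sum>p\<in>t. (1 / card t) *\<^sub>R p)"
  have ct: "real (card t) > 0" using ne fint by (simp add: card_gt_0_iff)
  have b_hull: "b \<in> convex hull t" unfolding b_def
    using fint ct by (intro convex_sum) (auto intro: hull_inc)
  have hull_std: "convex hull t \<subseteq> std_simplex \<sigma>"
    using point_in_std_simplex[OF _ t fin\<sigma>] tk by (intro hull_minimal) auto
  have lb: "l b = 0" using lt_span b_hull convex_hull_subset_span by blast
  have keysb: "Poly_Mapping.keys b = (\<Union>p\<in>t. Poly_Mapping.keys p)"
  proof -
    have "Poly_Mapping.lookup b v = 0 \<longleftrightarrow> (\<forall>p\<in>t. Poly_Mapping.lookup p v = 0)" for v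
    proof -
      have "Poly_Mapping.lookup b v = (\<Sum>p\<in>t. (1 / card t) * Poly_Mapping.lookup p v)"
        unfolding b_def by (simp add: lookup_sum)
      also have "\<dots> = 0 \<longleftrightarrow> (\<forall>p\<in>t. (1 / card t) * Poly_Mapping.lookup p v = 0)"
        by (rule sum_nonneg_eq_0_iff[OF fint]) (simp add: point_nonneg[OF _ t])
      finally show ?thesis using ct by simp
    qed
    then show ?thesis by (auto simp: in_keys_iff)
  qed
  have ex: "\<exists>p\<in>P. l p * l (e v) > 0" if v: "v \<in> \<sigma>" "l (e v) \<noteq> 0" for v
  proof -
    \<comment> \<open>Points that tend to the barycentre \<open>b\<close> of \<open>t\<close> from the direction of \<open>v\<close>; infinitely many of
      them lie in one simplex of \<open>L\<close>, which then contains \<open>b\<close>.\<close>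
    define y where "y = (\<lambda>n::nat. (1 / (real n + 1)) *\<^sub>R (real n *\<^sub>R b + e v))"
    have y_std: "y n \<in> std_simplex \<sigma>" for n
    proof -
      have "(real n / (real n + 1)) *\<^sub>R b + (1 / (real n + 1)) *\<^sub>R e v \<in> std_simplex \<sigma>"
        using b_hull hull_std v(1) unfolding e_def
        by (intro convexD[OF convex_convex_hull]) (auto intro: hull_inc simp flip: add_divide_distrib)
      then show ?thesis by (simp add: y_def scaleR_add_right)
    qed
    have "\<forall>n. \<exists>s\<in>L. y n \<in> convex hull s" using geom_pointE[OF y_std \<sigma>] by metis
    then obtain f where f: "\<And>n. f n \<in> L" "\<And>n. y n \<in> convex hull (f n)" by metis
    have "finite (range f)" by (rule finite_subset[OF _ finiteL]) (use f(1) in auto)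
    then obtain s where inf: "infinite {n. f n = s}"
      using pigeonhole_infinite[of "UNIV::nat set" f] by auto
    define S where "S = {n. f n = s}"
    have sL: "s \<in> L" using inf f(1) not_finite_existsD by blast
    define s0 where "s0 = {p\<in>s. Poly_Mapping.keys p \<subseteq> \<sigma>}"
    have s0L: "s0 \<in> L" unfolding s0_def by (rule faceL_closed[OF sL]) blast
    have fins0: "finite s0" using s0L finite_faceL by blast
    have y_s0: "y n \<in> convex hull s0" if "n \<in> S" for n
      unfolding s0_def using hull_Int_std_simplex[OF sL fin\<sigma> _ y_std] f(2)[of n] that unfolding S_def by auto
    have "\<exists>a. (\<forall>q\<in>s0. 0 \<le> a q) \<and> real n *\<^sub>R b + e v = (\<Sum>q\<in>s0. a q *\<^sub>R q)" if n: "n \<in> S" for n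
    proof -
      obtain u where u: "\<forall>q\<in>s0. 0 \<le> u q" "(\<Sum>q\<in>s0. u q *\<^sub>R q) = y n"
        using y_s0[OF n] fins0 by (auto simp: convex_hull_finite)
      have "real n *\<^sub>R b + e v = (real n + 1) *\<^sub>R y n" by (simp add: y_def)
      also have "\<dots> = (\<Sum>q\<in>s0. ((real n + 1) * u q) *\<^sub>R q)" unfolding u(2)[symmetric] by (simp add: scaleR_sum_right)
      finally show ?thesis using u(1) by (intro exI[of _ "\<lambda>q. (real n + 1) * u q"]) auto
    qed
    then obtain a where a: "\<And>n q. n \<in> S \<Longrightarrow> q \<in> s0 \<Longrightarrow> 0 \<le> a n q"
      "\<And>n. n \<in> S \<Longrightarrow> real n *\<^sub>R b + e v = (\<Sum>q\<in>s0. a n q *\<^sub>R q)" by metis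
    obtain n where n: "n \<in> S" using inf unfolding S_def by (metis (full_types) not_finite_existsD mem_Collect_eq)
    obtain m where m: "m \<in> S" "m > n" using inf unfolding S_def[symmetric] by (meson infinite_nat_iff_unbounded)
    \<comment> \<open>The coefficients of \<open>n b + v\<close> are affine in \<open>n\<close> with slope \<open>\<beta>\<close>, and stay nonnegative.\<close>
    define \<beta> where "\<beta> = (\<lambda>q. (a m q - a n q) / (real m - real n))"
    have b_eq: "b = (\<Sum>q\<in>s0. \<beta> q *\<^sub>R q)"
    proof -
      have "(real m - real n) *\<^sub>R b = (\<Sum>q\<in>s0. (a m q - a n q) *\<^sub>R q)"
      proof -
        have bk: "real k *\<^sub>R b = (\<Sum>q\<in>s0. a k q *\<^sub>R q) - e v" if "k \<in> S" for k
          using a(2)[OF that] by (simp add: eq_diff_eq)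
        show ?thesis by (simp add: scaleR_diff_left sum_subtractf bk[OF m(1)] bk[OF n])
      qed
      moreover have "b = (1 / (real m - real n)) *\<^sub>R ((real m - real n) *\<^sub>R b)" using m(2) by simp
      ultimately have "b = (1 / (real m - real n)) *\<^sub>R (\<Sum>q\<in>s0. (a m q - a n q) *\<^sub>R q)" by simp
      then show ?thesis by (simp add: \<beta>_def scaleR_sum_right)
    qed
    have ind0': "independent s0" using faceL_linear_independent[OF s0L] .
    have \<beta>: "\<beta> q \<ge> 0" if q: "q \<in> s0" for q
    proof (rule ccontr)
      assume neg: "\<not> \<beta> q \<ge> 0"
      obtain k where k: "k \<in> S" "real k > real n + a n q / (- \<beta> q)"
      proof -
        obtain k0 :: nat where "real k0 > real n + a n q / (- \<beta> q)" using reals_Archimedean2 by blast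
        moreover obtain k where "k \<in> S" "k > k0" using inf unfolding S_def[symmetric] by (meson infinite_nat_iff_unbounded)
        ultimately show ?thesis using that[of k] by simp
      qed
      have "(\<Sum>q\<in>s0. a k q *\<^sub>R q) = (\<Sum>q\<in>s0. (a n q + (real k - real n) * \<beta> q) *\<^sub>R q)"
      proof -
        have "(\<Sum>q\<in>s0. (a n q + (real k - real n) * \<beta> q) *\<^sub>R q) = (\<Sum>q\<in>s0. a n q *\<^sub>R q) + (real k - real n) *\<^sub>R b"
          unfolding b_eq by (simp add: scaleR_add_left sum.distrib scaleR_sum_right)
        also have "\<dots> = real k *\<^sub>R b + e v" unfolding a(2)[OF n, symmetric] by (simp add: algebra_simps)
        finally show ?thesis using a(2)[OF k(1)] by simp
      qed
      then have "a k q = a n q + (real k - real n) * \<beta> q"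
        by (rule independent_span_unique[OF ind0' fins0 _ q])
      moreover have "(real k - real n) * (- \<beta> q) > a n q"
        using k(2) neg by (simp add: field_simps)
      ultimately show False using a(1)[OF k(1) q] by simp
    qed
    have s0k: "Poly_Mapping.keys q \<subseteq> \<sigma>" if "q \<in> s0" for q using that unfolding s0_def by blast
    have "sum \<beta> s0 = 1"
    proof -
      have "sum \<beta> s0 = (\<Sum>q\<in>s0. \<beta> q * (\<Sum>v\<in>\<sigma>. Poly_Mapping.lookup q v))"
        using point_sum[OF _ s0L fin\<sigma> s0k] by simp
      also have "\<dots> = (\<Sum>v\<in>\<sigma>. Poly_Mapping.lookup b v)"
        unfolding b_eq sum_distrib_left by (subst sum.swap) (simp add: lookup_sum)
      also have "\<dots> = 1" using b_hull hull_std fin\<sigma> by (auto simp: in_std_simplex_iff)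
      finally show ?thesis .
    qed
    then have "b \<in> convex hull s0" using b_eq \<beta> fins0 by (auto simp: convex_hull_finite)
    then have "b \<in> convex hull (t \<inter> s0)" using b_hull faceL_Int[OF t s0L] by blast
    then obtain u where u: "\<forall>q\<in>t \<inter> s0. 0 \<le> u q" "(\<Sum>q\<in>t \<inter> s0. u q *\<^sub>R q) = b"
      using fint by (auto simp: convex_hull_finite)
    have ts0: "t \<subseteq> s0"
    proof
      fix q assume q: "q \<in> t"
      have "(\<Sum>q\<in>t. (if q \<in> s0 then u q else 0) *\<^sub>R q) = (\<Sum>q\<in>t \<inter> s0. u q *\<^sub>R q)"
        using fint by (simp add: sum.inter_restrict if_distrib[of "\<lambda>c. c *\<^sub>R _"] cong: if_cong)
      then have "(\<Sum>q\<in>t. (if q \<in> s0 then u q else 0) *\<^sub>R q) = (\<Sum>p\<in>t. (1 / card t) *\<^sub>R p)"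
        using u(2) b_def by simp
      from independent_span_unique[OF indt fint this q] show "q \<in> s0"
        using ct by (auto split: if_split_asm)
    qed
    have ev_eq: "e v = (\<Sum>q\<in>s0. a n q *\<^sub>R q) - real n *\<^sub>R b" using a(2)[OF n] by (metis add_diff_cancel_left')
    have "s0 \<noteq> t"
    proof
      assume "s0 = t"
      have "b \<in> span t" using b_hull convex_hull_subset_span[of t] by blast
      then have "e v \<in> span t" unfolding ev_eq \<open>s0 = t\<close>
        by (intro span_diff span_sum span_scale) (auto intro: span_base)
      then show False using lt_span v(2) by blast
    qed
    moreover have "card s0 \<le> card \<sigma>"
      using independent_card_bound[OF fin\<sigma> ind0' faceL_span[OF fin\<sigma> s0k]] by blast
    ultimately have "card (s0 - t) = 1"
      using ts0 card fins0 by (metis (no_types, lifting) Suc_eq_plus1 add_diff_cancel_left' card_Diff_subset card_mono card_subset_eq fint le_SucE plus_1_eq_Suc le_antisym add.commute)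
    then obtain p where p: "s0 - t = {p}" by (rule card_1_singletonE)
    then have s0_eq: "s0 = insert p t" "p \<notin> t" using ts0 by auto
    have "p \<in> P" unfolding P_def points_def using s0_eq s0L s0k[of p] by auto
    have lev: "l (e v) = a n p * l p"
    proof -
      have "l (e v) = (\<Sum>q\<in>s0. a n q * l q)"
        unfolding ev_eq using l(1) lb by (simp add: linear_diff linear_sum linear_scale)
      also have "\<dots> = a n p * l p" using s0_eq fint lt by simp
      finally show ?thesis .
    qed
    have "a n p \<ge> 0" using a(1)[OF n] s0_eq by simp
    moreover have "a n p \<noteq> 0" "l p \<noteq> 0" using v(2) lev by auto
    ultimately have "a n p * (l p)\<^sup>2 > 0" by (intro mult_pos_pos) auto
    then have "l p * l (e v) > 0" by (simp add: lev power2_eq_square mult.left_commute)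
    then show ?thesis using \<open>p \<in> P\<close> by blast
  qed
  obtain p1 where p1: "p1 \<in> P" "l p1 > 0" using ex[OF v0(1)] lv0 by auto
  have facet: "l (e v) = 0 \<longleftrightarrow> v \<noteq> w" if w: "w \<in> \<sigma>" "\<forall>p\<in>t. Poly_Mapping.keys p \<subseteq> \<sigma> - {w}" and v: "v \<in> \<sigma>" for v w
  proof -
    have sub: "t \<subseteq> span (e ` (\<sigma> - {w}))" unfolding e_def using faceL_span[of "\<sigma> - {w}" t] fin\<sigma> w(2) by blast
    have z: "l (e v') = 0" if v': "v' \<in> \<sigma> - {w}" for v'
    proof (rule ccontr)
      assume "l (e v') \<noteq> 0"
      then have n: "e v' \<notin> span t" using lt_span by blast
      then have "independent (insert (e v') t)" using independent_insertI indt by blast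
      moreover have "insert (e v') t \<subseteq> span (e ` (\<sigma> - {w}))" using sub v' by (auto intro: span_base)
      ultimately have "card (insert (e v') t) \<le> card (\<sigma> - {w})"
        using independent_card_bound[of "\<sigma> - {w}"] fin\<sigma> unfolding e_def by blast
      moreover have "e v' \<notin> t" using n span_base by blast
      ultimately show False using fint card w(1) fin\<sigma> by simp
    qed
    then have "v0 = w" using v0 lv0 by force
    then show ?thesis using z[of v] v lv0 by auto
  qed
  show "card {v\<in>\<sigma>. \<forall>p\<in>t. Poly_Mapping.keys p \<subseteq> \<sigma> - {v}} \<le> 1"
  proof -
    have "v = w" if "v \<in> {v\<in>\<sigma>. \<forall>p\<in>t. Poly_Mapping.keys p \<subseteq> \<sigma> - {v}}"
      "w \<in> {v\<in>\<sigma>. \<forall>p\<in>t. Poly_Mapping.keys p \<subseteq> \<sigma> - {v}}" for v w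
      using facet[of v v] facet[of w v] that by blast
    then show ?thesis using fin\<sigma> by (simp add: card_le_Suc0_iff_eq)
  qed
  show "card P = (if \<exists>v\<in>\<sigma>. \<forall>p\<in>t. Poly_Mapping.keys p \<subseteq> \<sigma> - {v} then 1 else 2)"
  proof (cases "\<exists>v\<in>\<sigma>. \<forall>p\<in>t. Poly_Mapping.keys p \<subseteq> \<sigma> - {v}")
    case True
    then obtain w where w: "w \<in> \<sigma>" "\<forall>p\<in>t. Poly_Mapping.keys p \<subseteq> \<sigma> - {w}" by blast
    have "v0 = w" using facet[OF w v0(1)] lv0 by auto
    have "p = p1" if p: "p \<in> P" for p
    proof -
      have pk: "Poly_Mapping.keys p \<subseteq> \<sigma>" and pL: "insert p t \<in> L" using p unfolding P_def by auto
      have "l p = l (\<Sum>v\<in>\<sigma>. Poly_Mapping.lookup p v *\<^sub>R e v)"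
        unfolding e_def using std_expansion[OF fin\<sigma> pk] by simp
      also have "\<dots> = (\<Sum>v\<in>\<sigma>. Poly_Mapping.lookup p v * l (e v))"
        using l(1) by (simp add: linear_sum linear_scale)
      also have "\<dots> \<ge> 0"
        using point_nonneg[OF _ pL, of p] facet[OF w] lv0 \<open>v0 = w\<close>
        by (intro sum_nonneg mult_nonneg_nonneg) (auto, metis order_refl zero_le_one)
      finally have "l p > 0" using lP[OF p] by simp
      then show ?thesis using uniq[OF p p1(1)] p1(2) by simp
    qed
    then have "P = {p1}" using p1(1) by blast
    then show ?thesis using True by simp
  next
    case False
    have kb: "Poly_Mapping.keys b = \<sigma>"
      using False tk unfolding keysb by blast
    have bpos: "Poly_Mapping.lookup b v > 0" if "v \<in> \<sigma>" for v
      using that b_hull hull_std fin\<sigma> kb unfolding in_keys_iff[symmetric]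
      by (metis in_keys_iff in_std_simplex_iff less_le subsetD)
    have "\<exists>v\<in>\<sigma>. l (e v) < 0"
    proof (rule ccontr)
      assume "\<not> ?thesis"
      then have nn: "l (e v) \<ge> 0" if "v \<in> \<sigma>" for v using that by force
      have "0 = l (\<Sum>v\<in>\<sigma>. Poly_Mapping.lookup b v *\<^sub>R e v)"
        unfolding e_def using std_expansion[OF fin\<sigma>, of b] kb lb by simp
      also have "\<dots> = (\<Sum>v\<in>\<sigma>. Poly_Mapping.lookup b v * l (e v))"
        using l(1) by (simp add: linear_sum linear_scale)
      also have "\<dots> > 0"
        using fin\<sigma> v0(1) lv0 bpos nn by (intro sum_pos2[of _ v0]) (auto simp: less_imp_le)
      finally show False by simp
    qed
    then obtain v where v: "v \<in> \<sigma>" "l (e v) < 0" by blast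
    then obtain p2 where p2: "p2 \<in> P" "l p2 < 0" using ex[of v] by (auto simp: zero_less_mult_iff)
    have "p = p1 \<or> p = p2" if "p \<in> P" for p
      using uniq[OF that p1(1)] uniq[OF that p2(1)] lP[OF that] p1(2) p2(2)
      by (cases "l p > 0") (auto simp: zero_less_mult_iff)
    then have "P = {p1, p2}" using p1(1) p2(1) by blast
    moreover have "p1 \<noteq> p2" using p1 p2 by auto
    ultimately show ?thesis using False by simp
  qed
qed

text \<open>
  The cofaces of \<open>t\<close> in \<open>\<sigma>\<close> and the facets of \<open>\<sigma>\<close> containing \<open>t\<close> agree in number modulo 2, which is the chain
  map property. The label of a point is its support, the smallest face that contains it.
\<close>
lemma carried_map_subdivided:
  assumes "{} \<in> L"
  shows "carried_map points Poly_Mapping.keys K subdivided"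
  unfolding carried_map_def
proof (intro conjI ballI allI impI)
  show "subdivided {} {} = 1" using assms by (simp add: subdivided_def)
next
  fix \<sigma> A p assume \<sigma>: "\<sigma> \<in> K" and nz: "subdivided \<sigma> A \<noteq> 0"
  then have A: "A \<in> L \<and> card A = card \<sigma> \<and> (\<forall>p\<in>A. Poly_Mapping.keys p \<subseteq> \<sigma>)"
    by (simp add: subdivided_nonzero)
  show "A \<subseteq> points" "card A = card \<sigma>" using A unfolding points_def by auto
  show "p \<in> A \<Longrightarrow> Poly_Mapping.keys p \<subseteq> \<sigma>" using A by blast
next
  fix \<sigma> t assume \<sigma>: "\<sigma> \<in> K" and t: "t \<in> Pow points"
  have fin\<sigma>: "finite \<sigma>" using \<sigma> finite_faceK by blast
  define P where "P = {p\<in>points - t. insert p t \<in> L \<and> Poly_Mapping.keys p \<subseteq> \<sigma>}"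
  define Q where "Q = {v\<in>\<sigma>. \<forall>p\<in>t. Poly_Mapping.keys p \<subseteq> \<sigma> - {v}}"
  show "chain_boundary points (subdivided \<sigma>) t = (\<Sum>v\<in>\<sigma>. subdivided (\<sigma> - {v}) t)"
  proof (cases "t \<in> L \<and> card t + 1 = card \<sigma> \<and> (\<forall>p\<in>t. Poly_Mapping.keys p \<subseteq> \<sigma>)")
    case False
    have "subdivided \<sigma> (insert j t) = 0" if "j \<in> points - t" for j
    proof (rule ccontr)
      assume "subdivided \<sigma> (insert j t) \<noteq> 0"
      then have j: "insert j t \<in> L" "card (insert j t) = card \<sigma>" "\<forall>p\<in>insert j t. Poly_Mapping.keys p \<subseteq> \<sigma>"
        by (simp_all add: subdivided_nonzero)
      have "finite t" using finite_faceL[OF j(1)] by simp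
      then show False using False faceL_closed[OF j(1), of t] j that by auto
    qed
    then have "chain_boundary points (subdivided \<sigma>) t = 0" unfolding chain_boundary_def by simp
    moreover have "subdivided (\<sigma> - {v}) t = 0" if "v \<in> \<sigma>" for v
    proof (rule ccontr)
      assume "subdivided (\<sigma> - {v}) t \<noteq> 0"
      then have j: "t \<in> L" "card t = card (\<sigma> - {v})" "\<forall>p\<in>t. Poly_Mapping.keys p \<subseteq> \<sigma> - {v}"
        by (simp_all add: subdivided_nonzero)
      have "card t + 1 = card \<sigma>" using j(2) that fin\<sigma> by (metis Suc_eq_plus1 card.remove)
      then show False using False j by blast
    qed
    ultimately show ?thesis by simp
  next
    case True
    have fint: "finite t" using True finite_faceL by blast
    have "chain_boundary points (subdivided \<sigma>) t = (\<Sum>p\<in>points - t. of_bool (insert p t \<in> L \<and> Poly_Mapping.keys p \<subseteq> \<sigma>))"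
      unfolding chain_boundary_def subdivided_def using True fint by (intro sum.cong refl arg_cong[of _ _ of_bool]) auto
    also have "\<dots> = of_nat (card P)"
      using finite_points unfolding P_def by (simp add: sum_of_bool_eq Int_def)
    finally have 1: "chain_boundary points (subdivided \<sigma>) t = of_nat (card P)" .
    have "(\<Sum>v\<in>\<sigma>. subdivided (\<sigma> - {v}) t) = (\<Sum>v\<in>\<sigma>. of_bool (\<forall>p\<in>t. Poly_Mapping.keys p \<subseteq> \<sigma> - {v}))"
      unfolding subdivided_def using True fin\<sigma>
      by (intro sum.cong refl arg_cong[of _ _ of_bool]) (auto simp: card_Diff_singleton)
    also have "\<dots> = of_nat (card Q)"
      using fin\<sigma> unfolding Q_def by (simp add: sum_of_bool_eq Int_def)
    finally have 2: "(\<Sum>v\<in>\<sigma>. subdivided (\<sigma> - {v}) t) = of_nat (card Q)" .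
    have finQ: "finite Q" unfolding Q_def using fin\<sigma> by simp
    show ?thesis
    proof (cases "t = {}")
      case True
      then obtain v where v: "\<sigma> = {v}" using \<open>t \<in> L \<and> _\<close> by (metis add_0 card_1_singletonE card.empty)
      have "P = {std_vertex v}" using subdivided_vertex[of v] \<sigma> True unfolding P_def v by simp
      moreover have "Q = {v}" unfolding Q_def v True by simp
      ultimately show ?thesis unfolding 1 2 by simp
    next
      case ne: False
      have cP: "card P = (if Q \<noteq> {} then 1 else 2)" and "card Q \<le> 1"
        using card_cofaces_in_subdivision[of t \<sigma>] True \<sigma> ne unfolding P_def Q_def by auto
      then show ?thesis unfolding 1 2 using finQ by (cases "Q = {}") (auto simp: le_Suc_eq)
    qed
  qed
qed

end

section \<open>Opposite faces of joins of triples and a simplex\<close>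

text \<open>
  The vertices below \<open>3 * a\<close> come in consecutive triples, each of which forms a class; every further
  vertex is a class by itself.
\<close>
definition vertex_class :: "nat \<Rightarrow> nat \<Rightarrow> nat" where
  "vertex_class a v = (if v < 3 * a then v div 3 else v - 2 * a)"

text \<open>
  The join of \<open>a\<close> sets of three isolated points and of a simplex with \<open>r\<close> vertices: a face has at most one
  vertex in each class. For \<open>r = 0\<close> this is the complex of van Kampen and Flores, for \<open>a = 2\<close> the join of
  \<open>K_{3,3}\<close> and a simplex.
\<close>
definition flores :: "nat \<Rightarrow> nat \<Rightarrow> nat set set" where
  "flores a r = {\<sigma>. \<sigma> \<subseteq> {..<3 * a + r} \<and> inj_on (vertex_class a) \<sigma>}"

text \<open>
  The cardinality is the largest possible: two disjoint faces use at most two vertices of each triple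
  and each other vertex at most once.
\<close>
definition opposite_faces :: "nat \<Rightarrow> nat \<Rightarrow> nat set \<Rightarrow> nat set \<Rightarrow> bool" where
  "opposite_faces a r \<sigma> \<tau> \<longleftrightarrow> \<sigma> \<in> flores a r \<and> \<tau> \<in> flores a r \<and> \<sigma> \<inter> \<tau> = {} \<and> card \<sigma> + card \<tau> = 2 * a + r"

text \<open>
  Comparing the least vertices selects one order of each pair of opposite faces.
\<close>
definition ordered_opposite_faces :: "nat \<Rightarrow> nat \<Rightarrow> nat set \<Rightarrow> nat set \<Rightarrow> bool" where
  "ordered_opposite_faces a r \<sigma> \<tau> \<longleftrightarrow> opposite_faces a r \<sigma> \<tau> \<and> Min \<sigma> < Min \<tau>"

lemma finite_flores: "\<sigma> \<in> flores a r \<Longrightarrow> finite \<sigma>"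
  unfolding flores_def using finite_subset by blast

lemma flores_subset: "\<sigma> \<in> flores a r \<Longrightarrow> \<tau> \<subseteq> \<sigma> \<Longrightarrow> \<tau> \<in> flores a r"
  unfolding flores_def by (auto intro: inj_on_subset)

lemma empty_flores: "{} \<in> flores a r"
  by (simp add: flores_def)

lemma vertex_class_bound: "v < 3 * a + r \<Longrightarrow> vertex_class a v < a + r"
  by (auto simp: vertex_class_def)

lemma card_flores: "\<sigma> \<in> flores a r \<Longrightarrow> card \<sigma> \<le> a + r"
proof -
  assume s: "\<sigma> \<in> flores a r"
  have "card \<sigma> = card (vertex_class a ` \<sigma>)" using s by (simp add: flores_def card_image)
  also have "\<dots> \<le> card {..<a + r}" using s vertex_class_bound by (intro card_mono) (auto simp: flores_def)
  finally show ?thesis by simp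
qed

lemma opposite_faces_nonempty: "opposite_faces a r \<sigma> \<tau> \<Longrightarrow> a \<ge> 1 \<Longrightarrow> \<sigma> \<noteq> {} \<and> \<tau> \<noteq> {}"
  using card_flores[of \<sigma> a r] card_flores[of \<tau> a r] unfolding opposite_faces_def by auto

text \<open>
  A face contains at most one vertex of each triple.
\<close>
lemma triple_missing:
  assumes "\<sigma> \<in> flores a r" "\<tau> \<in> flores a r" "i < a"
  shows "\<exists>j<3. 3 * i + j \<notin> \<sigma> \<union> \<tau>"
proof -
  have p: "vertex_class a (3 * i + j) = i" if "j < 3" for j using that assms(3) by (simp add: vertex_class_def)
  show ?thesis
  proof (rule ccontr)
    assume "\<not> ?thesis"
    then have all: "3 * i + j \<in> \<sigma> \<union> \<tau>" if "j < 3" for j using that by blast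
    have uq: "j = j'" if "j < 3" "j' < 3" "3 * i + j \<in> \<rho>" "3 * i + j' \<in> \<rho>" "\<rho> \<in> flores a r" for j j' \<rho>
      using that p inj_onD[of "vertex_class a" \<rho> "3 * i + j" "3 * i + j'"] by (simp add: flores_def)
    consider "3 * i \<in> \<sigma>" "3 * i + 1 \<in> \<sigma>" | "3 * i \<in> \<sigma>" "3 * i + 2 \<in> \<sigma>" | "3 * i + 1 \<in> \<sigma>" "3 * i + 2 \<in> \<sigma>"
      | "3 * i \<in> \<tau>" "3 * i + 1 \<in> \<tau>" | "3 * i \<in> \<tau>" "3 * i + 2 \<in> \<tau>" | "3 * i + 1 \<in> \<tau>" "3 * i + 2 \<in> \<tau>"
      using all[of 0] all[of 1] all[of 2] by auto
    then show False
      using uq[of 0 1 \<sigma>] uq[of 0 2 \<sigma>] uq[of 1 2 \<sigma>] uq[of 0 1 \<tau>] uq[of 0 2 \<tau>] uq[of 1 2 \<tau>] assms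
      by cases auto
  qed
qed

lemma missing_choice:
  assumes "\<sigma> \<in> flores a r" "\<tau> \<in> flores a r"
  obtains f where "\<And>i. i < a \<Longrightarrow> f i < 3" "\<And>i. i < a \<Longrightarrow> 3 * i + f i \<notin> \<sigma> \<union> \<tau>"
    "card ((\<lambda>i. 3 * i + f i) ` {..<a}) = a"
proof -
  have "\<forall>i. \<exists>j. i < a \<longrightarrow> j < 3 \<and> 3 * i + j \<notin> \<sigma> \<union> \<tau>" using triple_missing[OF assms] by blast
  then obtain f where f: "\<And>i. i < a \<Longrightarrow> f i < 3" "\<And>i. i < a \<Longrightarrow> 3 * i + f i \<notin> \<sigma> \<union> \<tau>" by metis
  have "inj_on (\<lambda>i. 3 * i + f i) {..<a}"
  proof (rule inj_onI)
    fix i i' assume "i \<in> {..<a}" "i' \<in> {..<a}" "3 * i + f i = 3 * i' + f i'"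
    then show "i = i'" using f(1)[of i] f(1)[of i'] by auto
  qed
  then have "card ((\<lambda>i. 3 * i + f i) ` {..<a}) = a" by (simp add: card_image)
  then show ?thesis using that f by blast
qed

lemma insert_flores_iff:
  assumes "\<sigma> \<in> flores a r" "w < 3 * a + r" "w \<notin> \<sigma>"
  shows "insert w \<sigma> \<in> flores a r \<longleftrightarrow> vertex_class a w \<notin> vertex_class a ` \<sigma>"
  using assms unfolding flores_def by auto

text \<open>
  For disjoint faces with one vertex too few, exactly one class has an unused vertex beyond the forced
  one in each triple. A triple \<open>{u, z, z'}\<close> of which only \<open>u\<close> is used admits \<open>z\<close> and \<open>z'\<close> in the same role, and
  an unused vertex outside of the triples may join either face. All other unused vertices are in a
  triple that both faces meet already. So the number of extensions is even.
\<close>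
lemma opposite_faces_parity:
  assumes \<sigma>: "\<sigma> \<in> flores a r" and \<tau>: "\<tau> \<in> flores a r"
  defines "V \<equiv> {..<3 * a + r}"
  shows "(\<Sum>w\<in>V - \<tau>. of_bool (opposite_faces a r \<sigma> (insert w \<tau>))) + (\<Sum>x\<in>V - \<sigma>. of_bool (opposite_faces a r (insert x \<sigma>) \<tau>)) = (0::bit)"
proof (cases "\<sigma> \<inter> \<tau> = {} \<and> card \<sigma> + card \<tau> + 1 = 2 * a + r")
  case False
  have "\<not> opposite_faces a r \<sigma> (insert w \<tau>)" if "w \<in> V - \<tau>" for w
    using False that finite_flores[OF \<tau>] unfolding opposite_faces_def by auto
  moreover have "\<not> opposite_faces a r (insert x \<sigma>) \<tau>" if "x \<in> V - \<sigma>" for x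
    using False that finite_flores[OF \<sigma>] unfolding opposite_faces_def by auto
  ultimately show ?thesis by simp
next
  case True
  then have disj: "\<sigma> \<inter> \<tau> = {}" and card: "card \<sigma> + card \<tau> + 1 = 2 * a + r" by auto
  have fin: "finite \<sigma>" "finite \<tau>" "finite V" using finite_flores \<sigma> \<tau> by (auto simp: V_def)
  have sub: "\<sigma> \<subseteq> V" "\<tau> \<subseteq> V" using \<sigma> \<tau> by (auto simp: flores_def V_def)
  \<comment> \<open>The unused vertices; \<open>\<phi> w\<close> counts the faces to which \<open>w\<close> can be added.\<close>
  define Z where "Z = V - (\<sigma> \<union> \<tau>)"
  define \<phi> :: "nat \<Rightarrow> bit" where "\<phi> = (\<lambda>w. of_bool (vertex_class a w \<notin> vertex_class a ` \<tau>) + of_bool (vertex_class a w \<notin> vertex_class a ` \<sigma>))"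
  have "(\<Sum>w\<in>V - \<tau>. of_bool (opposite_faces a r \<sigma> (insert w \<tau>))) = (\<Sum>w\<in>Z. of_bool (vertex_class a w \<notin> vertex_class a ` \<tau>) :: bit)"
  proof (rule sum.mono_neutral_cong_right)
    show "\<forall>i\<in>V - \<tau> - Z. of_bool (opposite_faces a r \<sigma> (insert i \<tau>)) = (0::bit)"
      by (auto simp: Z_def opposite_faces_def)
    fix w assume "w \<in> Z"
    then show "of_bool (opposite_faces a r \<sigma> (insert w \<tau>)) = (of_bool (vertex_class a w \<notin> vertex_class a ` \<tau>) :: bit)"
      using insert_flores_iff[OF \<tau>, of w] \<sigma> disj card fin unfolding Z_def V_def opposite_faces_def by auto
  qed (use fin in \<open>auto simp: Z_def\<close>)
  moreover have "(\<Sum>x\<in>V - \<sigma>. of_bool (opposite_faces a r (insert x \<sigma>) \<tau>)) = (\<Sum>w\<in>Z. of_bool (vertex_class a w \<notin> vertex_class a ` \<sigma>) :: bit)"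
  proof (rule sum.mono_neutral_cong_right)
    show "\<forall>i\<in>V - \<sigma> - Z. of_bool (opposite_faces a r (insert i \<sigma>) \<tau>) = (0::bit)"
      by (auto simp: Z_def opposite_faces_def)
    fix w assume "w \<in> Z"
    then show "of_bool (opposite_faces a r (insert w \<sigma>) \<tau>) = (of_bool (vertex_class a w \<notin> vertex_class a ` \<sigma>) :: bit)"
      using insert_flores_iff[OF \<sigma>, of w] \<tau> disj card fin unfolding Z_def V_def opposite_faces_def by auto
  qed (use fin in \<open>auto simp: Z_def\<close>)
  ultimately have "(\<Sum>w\<in>V - \<tau>. of_bool (opposite_faces a r \<sigma> (insert w \<tau>))) + (\<Sum>x\<in>V - \<sigma>. of_bool (opposite_faces a r (insert x \<sigma>) \<tau>))
      = (\<Sum>w\<in>Z. \<phi> w)"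
    by (simp add: \<phi>_def sum.distrib)
  also have "\<dots> = 0"
  proof -
    obtain f where f: "\<And>i. i < a \<Longrightarrow> f i < (3::nat)" "\<And>i. i < a \<Longrightarrow> 3 * i + f i \<notin> \<sigma> \<union> \<tau>"
      "card ((\<lambda>i. 3 * i + f i) ` {..<a}) = a"
      using missing_choice[OF \<sigma> \<tau>] by blast
    define Z0 where "Z0 = (\<lambda>i. 3 * i + f i) ` {..<a}"
    have Z0: "Z0 \<subseteq> Z" "card Z0 = a" "finite Z0"
      unfolding Z0_def Z_def V_def using f by (force simp: f(3))+
    have cardZ: "card Z = a + 1"
    proof -
      have "card V = card Z + card (\<sigma> \<union> \<tau>)" unfolding Z_def
        using fin sub by (subst card_Diff_subset) (auto simp: card_mono)
      also have "card (\<sigma> \<union> \<tau>) = card \<sigma> + card \<tau>" using fin disj by (simp add: card_Un_disjoint)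
      finally show ?thesis using card by (simp add: V_def)
    qed
    then have "card (Z - Z0) = 1" using Z0 by (simp add: card_Diff_subset)
    then obtain z where z: "Z - Z0 = {z}" by (rule card_1_singletonE)
    have Z_eq: "Z = insert z Z0" "z \<notin> Z0" using z Z0 by auto
    have zV: "z < 3 * a + r" "z \<notin> \<sigma> \<union> \<tau>" using z unfolding Z_def V_def by auto
    have full: "\<phi> (3 * i + f i) = 0" if i: "i < a" "z \<notin> {3 * i..<3 * i + 3}" for i
    proof -
      have "{3 * i..<3 * i + 3} - {3 * i + f i} \<subseteq> \<sigma> \<union> \<tau>"
      proof
        fix v assume v: "v \<in> {3 * i..<3 * i + 3} - {3 * i + f i}"
        have "v \<notin> Z0"
        proof
          assume "v \<in> Z0"
          then obtain i' where "i' < a" "v = 3 * i' + f i'" unfolding Z0_def by auto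
          then show False using v f(1)[of i'] by (cases "i' = i") auto
        qed
        then have "v \<notin> Z" using v i Z_eq by auto
        then show "v \<in> \<sigma> \<union> \<tau>" using v i unfolding Z_def V_def by auto
      qed
      moreover obtain u v where uv: "u \<noteq> v" "{3 * i..<3 * i + 3} - {3 * i + f i} = {u, v}"
      proof -
        have "card ({3 * i..<3 * i + 3} - {3 * i + f i}) = 2" using f(1)[OF i(1)] by simp
        then show ?thesis using that unfolding card_2_iff by blast
      qed
      moreover have pp: "vertex_class a u = i" "vertex_class a v = i" "vertex_class a (3 * i + f i) = i"
      proof -
        have "vertex_class a x = i" if "x \<in> {3 * i..<3 * i + 3}" for x
        proof -
          have "x div 3 = i" using that by auto
          then show ?thesis using that i(1) by (simp add: vertex_class_def)
        qed
        moreover have "u \<in> {3 * i..<3 * i + 3}" "v \<in> {3 * i..<3 * i + 3}" using uv(2) by blast+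
        moreover have "3 * i + f i \<in> {3 * i..<3 * i + 3}" using f(1)[OF i(1)] by simp
        ultimately show "vertex_class a u = i" "vertex_class a v = i" "vertex_class a (3 * i + f i) = i" by blast+
      qed
      ultimately have "u \<in> \<sigma> \<union> \<tau>" "v \<in> \<sigma> \<union> \<tau>" by auto
      moreover have "\<not> (u \<in> \<sigma> \<and> v \<in> \<sigma>)" "\<not> (u \<in> \<tau> \<and> v \<in> \<tau>)"
        using \<sigma> \<tau> uv(1) pp unfolding flores_def by (auto dest: inj_onD)
      ultimately have "(u \<in> \<sigma> \<and> v \<in> \<tau>) \<or> (v \<in> \<sigma> \<and> u \<in> \<tau>)" by blast
      then have "i \<in> vertex_class a ` \<sigma>" "i \<in> vertex_class a ` \<tau>"
        using imageI[of u \<sigma> "vertex_class a"] imageI[of v \<sigma> "vertex_class a"] imageI[of u \<tau> "vertex_class a"] imageI[of v \<tau> "vertex_class a"] pp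
        by auto
      then show ?thesis unfolding \<phi>_def pp by simp
    qed
    have injf: "inj_on (\<lambda>i. 3 * i + f i) {..<a}"
      using f(3) by (intro eq_card_imp_inj_on) auto
    show ?thesis
    proof (cases "z < 3 * a")
      case True
      define j where "j = z div 3"
      have j: "j < a" "z \<in> {3 * j..<3 * j + 3}" using True unfolding j_def by auto
      have same: "\<phi> (3 * j + f j) = \<phi> z"
      proof -
        have "vertex_class a z = j" "vertex_class a (3 * j + f j) = j" using True j f(1)[OF j(1)] by (auto simp: vertex_class_def j_def)
        then show ?thesis unfolding \<phi>_def by simp
      qed
      have "(\<Sum>w\<in>Z0. \<phi> w) = (\<Sum>i<a. \<phi> (3 * i + f i))" unfolding Z0_def using injf by (simp add: sum.reindex)
      also have "\<dots> = (\<Sum>i<a. if i = j then \<phi> z else 0)"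
      proof (intro sum.cong refl)
        fix i assume "i \<in> {..<a}"
        then show "\<phi> (3 * i + f i) = (if i = j then \<phi> z else 0)" using full[of i] same j(2) by auto
      qed
      also have "\<dots> = \<phi> z" using j by simp
      finally show ?thesis using Z_eq Z0(3) by simp
    next
      case False
      have "(\<Sum>w\<in>Z0. \<phi> w) = 0"
      proof (rule sum.neutral, rule ballI)
        fix w assume "w \<in> Z0"
        then obtain i where "i < a" "w = 3 * i + f i" unfolding Z0_def by auto
        then show "\<phi> w = 0" using full[of i] False by auto
      qed
      moreover have "\<phi> z = 0"
      proof -
        have "vertex_class a v \<noteq> vertex_class a z" if "v \<in> \<sigma> \<union> \<tau>" for v
        proof
          assume eq: "vertex_class a v = vertex_class a z"
          have "vertex_class a z \<ge> a" using False by (auto simp: vertex_class_def)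
          then have "\<not> v < 3 * a" using eq by (auto simp: vertex_class_def)
          then have "v = z" using eq False by (auto simp: vertex_class_def)
          then show False using that zV by simp
        qed
        then have "vertex_class a z \<notin> vertex_class a ` \<tau>" "vertex_class a z \<notin> vertex_class a ` \<sigma>" by (metis UnCI imageE)+
        then show ?thesis unfolding \<phi>_def by simp
      qed
      ultimately show ?thesis using Z_eq Z0(3) by simp
    qed
  qed
  finally show ?thesis .
qed

lemma pair_cycle_flores:
  assumes a: "a \<ge> 1"
  shows "pair_cycle {..<3 * a + r} (flores a r) (opposite_faces a r) (ordered_opposite_faces a r) (2 * a + r)"
proof
  show "finite {..<3 * a + r}" by simp
  show "flores a r \<subseteq> Pow {..<3 * a + r}" by (auto simp: flores_def)
  show "\<tau> \<in> flores a r" if "\<sigma> \<in> flores a r" "\<tau> \<subseteq> \<sigma>" for \<sigma> \<tau> using flores_subset that by blast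
  show "{} \<in> flores a r" by (rule empty_flores)
  show "\<sigma> \<in> flores a r \<and> \<tau> \<in> flores a r \<and> \<sigma> \<inter> \<tau> = {} \<and> card \<sigma> + card \<tau> = 2 * a + r" if "opposite_faces a r \<sigma> \<tau>" for \<sigma> \<tau>
    using that by (simp add: opposite_faces_def)
  show "(\<Sum>w\<in>{..<3 * a + r} - \<tau>. of_bool (opposite_faces a r \<sigma> (insert w \<tau>))) + (\<Sum>x\<in>{..<3 * a + r} - \<sigma>. of_bool (opposite_faces a r (insert x \<sigma>) \<tau>)) = (0::bit)"
    if "\<sigma> \<in> flores a r" "\<tau> \<in> flores a r" for \<sigma> \<tau>
    using opposite_faces_parity that by blast
  show "opposite_faces a r \<sigma> \<tau> \<longleftrightarrow> ordered_opposite_faces a r \<sigma> \<tau> \<or> ordered_opposite_faces a r \<tau> \<sigma>" for \<sigma> \<tau>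
  proof
    assume g: "opposite_faces a r \<sigma> \<tau>"
    have "finite \<sigma>" "finite \<tau>" using g finite_flores by (auto simp: opposite_faces_def)
    then have "Min \<sigma> \<in> \<sigma>" "Min \<tau> \<in> \<tau>" using opposite_faces_nonempty[OF g a] by auto
    then have "Min \<sigma> \<noteq> Min \<tau>" using g by (auto simp: opposite_faces_def)
    moreover have "opposite_faces a r \<tau> \<sigma>" using g by (auto simp: opposite_faces_def)
    ultimately show "ordered_opposite_faces a r \<sigma> \<tau> \<or> ordered_opposite_faces a r \<tau> \<sigma>" using g unfolding ordered_opposite_faces_def by auto
  next
    assume "ordered_opposite_faces a r \<sigma> \<tau> \<or> ordered_opposite_faces a r \<tau> \<sigma>"
    then show "opposite_faces a r \<sigma> \<tau>" by (auto simp: ordered_opposite_faces_def opposite_faces_def)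
  qed
  show "ordered_opposite_faces a r \<sigma> \<tau> \<Longrightarrow> \<not> ordered_opposite_faces a r \<tau> \<sigma>" for \<sigma> \<tau> by (auto simp: ordered_opposite_faces_def)
qed

definition alternating :: "nat set \<Rightarrow> nat set \<Rightarrow> bool" where
  "alternating A B \<longleftrightarrow> (\<exists>s. (\<forall>u\<in>A. even (order_position (A \<union> B) u) = s) \<and> (\<forall>u\<in>B. even (order_position (A \<union> B) u) \<noteq> s))"

lemma order_position_next:
  assumes "finite U" "x \<in> U" "x < y" "\<And>w. w \<in> U \<Longrightarrow> x < w \<Longrightarrow> y \<le> w"
  shows "order_position U y = Suc (order_position U x)"
proof -
  have "{w\<in>U. w < y} = insert x {w\<in>U. w < x}"
    using assms(2,3,4) by (auto simp: not_less dest: le_neq_implies_less) (metis assms(4) leD linorder_neqE_nat)+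
  then show ?thesis unfolding order_position_def using assms(1) by simp
qed

text \<open>
  An alternating pair is determined by its union \<open>U\<close>: the first face consists of the elements of \<open>U\<close> in
  even position and the second one of those in odd position. The possible unions arise by omitting one
  vertex of each triple, in \<open>3^a\<close> ways. The two remaining vertices of a triple are adjacent in \<open>U\<close>, so they
  end up in different faces.
\<close>
lemma card_alternating_opposite_faces:
  assumes a: "a \<ge> 1"
  shows "card {(\<sigma>, \<tau>). ordered_opposite_faces a r \<sigma> \<tau> \<and> alternating \<sigma> \<tau>} = 3 ^ a"
proof -
  define V where "V = {..<3 * a + r}"
  define Fn where "Fn = ({..<a} \<rightarrow>\<^sub>E {..<3::nat})"
  define omit where "omit = (\<lambda>f::nat \<Rightarrow> nat. (\<lambda>i. 3 * i + f i) ` {..<a})"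
  define ev od where "ev = (\<lambda>U. {u\<in>U. even (order_position U u)})" and "od = (\<lambda>U. {u\<in>U. odd (order_position U u)})"
  define \<Psi> where "\<Psi> = (\<lambda>f. (ev (V - omit f), od (V - omit f)))"
  have omit_sub: "omit f \<subseteq> V" and card_omit: "card (omit f) = a" and
    omit_iff: "\<And>i j. i < a \<Longrightarrow> j < 3 \<Longrightarrow> 3 * i + j \<in> omit f \<longleftrightarrow> j = f i"
    if f: "f \<in> Fn" for f
  proof -
    have f3: "f i < 3" if "i < a" for i using f that unfolding Fn_def by (auto simp: PiE_iff)
    show "omit f \<subseteq> V"
    proof
      fix x assume "x \<in> omit f"
      then obtain i where "i < a" "x = 3 * i + f i" unfolding omit_def by auto
      then show "x \<in> V" using f3[of i] unfolding V_def by auto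
    qed
    have "inj_on (\<lambda>i. 3 * i + f i) {..<a}"
    proof (rule inj_onI)
      fix i i' assume "i \<in> {..<a}" "i' \<in> {..<a}" "3 * i + f i = 3 * i' + f i'"
      then show "i = i'" using f3[of i] f3[of i'] by auto
    qed
    then show "card (omit f) = a" unfolding omit_def by (simp add: card_image)
    show "3 * i + j \<in> omit f \<longleftrightarrow> j = f i" if "i < a" "j < 3" for i j
    proof
      assume "3 * i + j \<in> omit f"
      then obtain i' where i': "i' < a" "3 * i + j = 3 * i' + f i'" unfolding omit_def by auto
      then have "i' = i" using f3[of i'] that by auto
      then show "j = f i" using i' by simp
    next
      assume "j = f i"
      then show "3 * i + j \<in> omit f" unfolding omit_def using that by auto
    qed
  qed
  have opp: "even (order_position (V - omit f) x) \<noteq> even (order_position (V - omit f) y)"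
    if f: "f \<in> Fn" and xy: "x \<in> V - omit f" "y \<in> V - omit f" "x \<noteq> y" "vertex_class a x = vertex_class a y" for f x y
  proof -
    have lt: "even (order_position (V - omit f) x) \<noteq> even (order_position (V - omit f) y)"
      if xy: "x \<in> V - omit f" "y \<in> V - omit f" "x < y" "vertex_class a x = vertex_class a y" for x y
    proof -
      have "y < 3 * a"
      proof (rule ccontr)
        assume y: "\<not> y < 3 * a"
        then have "vertex_class a y \<ge> a" by (auto simp: vertex_class_def)
        then have "\<not> x < 3 * a" using xy(4) by (auto simp: vertex_class_def)
        then show False using y xy by (auto simp: vertex_class_def)
      qed
      define i where "i = y div 3"
      have "x div 3 = i" "i < a" using xy \<open>y < 3 * a\<close> by (auto simp: vertex_class_def i_def)
      then obtain p q where pq: "x = 3 * i + p" "y = 3 * i + q" "p < 3" "q < 3"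
        using i_def by (metis div_mod_decomp mod_less_divisor mult.commute zero_less_numeral)
      have "order_position (V - omit f) y = Suc (order_position (V - omit f) x)"
      proof (rule order_position_next)
        show "finite (V - omit f)" by (simp add: V_def)
        fix w assume w: "w \<in> V - omit f" "x < w"
        show "y \<le> w"
        proof (rule ccontr)
          assume "\<not> y \<le> w"
          then obtain s where s: "w = 3 * i + s" "p < s" "s < q" using w pq by (metis add_less_cancel_left less_imp_add_positive linorder_not_le add.assoc)
          have "f i < 3" using f \<open>i < a\<close> unfolding Fn_def by (auto simp: PiE_iff)
          have "f i \<noteq> p" "f i \<noteq> q" "f i \<noteq> s"
            using omit_iff[OF f \<open>i < a\<close>, of p] omit_iff[OF f \<open>i < a\<close>, of q] omit_iff[OF f \<open>i < a\<close>, of s] xy w pq s by auto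
          then show False using \<open>f i < 3\<close> s pq by auto
        qed
      qed (use xy in auto)
      then show ?thesis by simp
    qed
    show ?thesis using lt[of x y] lt[of y x] xy by (metis linorder_neqE_nat)
  qed
  have card_compl: "card (V - omit f) = 2 * a + r" if "f \<in> Fn" for f
    using omit_sub[OF that] card_omit[OF that] by (simp add: card_Diff_subset finite_subset V_def)
  have U_eq: "ev U \<union> od U = U" and disj: "ev U \<inter> od U = {}" for U by (auto simp: ev_def od_def)
  have image: "\<Psi> f \<in> {(\<sigma>, \<tau>). ordered_opposite_faces a r \<sigma> \<tau> \<and> alternating \<sigma> \<tau>}" if f: "f \<in> Fn" for f
  proof -
    define U where "U = V - omit f"
    have finU: "finite U" unfolding U_def V_def by simp
    have fl: "ev U \<in> flores a r" "od U \<in> flores a r"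
      unfolding flores_def ev_def od_def using opp[OF f] unfolding U_def[symmetric]
      by (auto simp: U_def V_def intro!: inj_onI)
    have "card (ev U) + card (od U) = card (ev U \<union> od U)"
      using finU by (intro card_Un_disjoint[symmetric]) (auto simp: ev_def od_def)
    then have g: "opposite_faces a r (ev U) (od U)"
      unfolding opposite_faces_def using fl disj card_compl[OF f] U_eq by (simp add: U_def)
    have ne: "ev U \<noteq> {}" "od U \<noteq> {}" using opposite_faces_nonempty[OF g a] by auto
    have Une: "U \<noteq> {}" using ne U_eq by auto
    have minU: "Min U \<in> ev U"
    proof -
      have "{w\<in>U. w < Min U} = {}" using finU by (auto simp: not_less)
      then have "order_position U (Min U) = 0" unfolding order_position_def by (metis card.empty)
      then show ?thesis unfolding ev_def using finU Une by simp
    qed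
    have "Min (ev U) < Min (od U)"
    proof -
      have fo: "finite (ev U)" "finite (od U)" using finU by (auto simp: ev_def od_def)
      have "Min (od U) \<in> od U" using fo ne by simp
      then have "Min (od U) \<in> U" "Min (od U) \<notin> ev U" unfolding od_def ev_def by auto
      then have "Min U \<le> Min (od U)" "Min U \<noteq> Min (od U)" using finU minU by auto
      moreover have "Min (ev U) \<le> Min U" using fo minU by simp
      ultimately show ?thesis by simp
    qed
    then have "ordered_opposite_faces a r (ev U) (od U)" using g unfolding ordered_opposite_faces_def by simp
    moreover have "alternating (ev U) (od U)"
      unfolding alternating_def U_eq by (rule exI[of _ True]) (auto simp: ev_def od_def)
    ultimately show ?thesis unfolding \<Psi>_def U_def by simp
  qed
  have inj: "inj_on \<Psi> Fn"
  proof (rule inj_onI)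
    fix f g assume f: "f \<in> Fn" and g: "g \<in> Fn" and eq: "\<Psi> f = \<Psi> g"
    have "V - omit f = V - omit g" using eq U_eq unfolding \<Psi>_def by (metis prod.inject)
    then have om: "omit f = omit g" using omit_sub[OF f] omit_sub[OF g] by blast
    show "f = g"
    proof
      fix i show "f i = g i"
      proof (cases "i < a")
        case True
        have "f i < 3" using f True unfolding Fn_def by (auto simp: PiE_iff)
        then show ?thesis using omit_iff[OF f True, of "f i"] omit_iff[OF g True, of "f i"] om by simp
      next
        case False
        then show ?thesis using f g unfolding Fn_def by (auto simp: PiE_iff extensional_def)
      qed
    qed
  qed
  have surj: "(\<sigma>, \<tau>) \<in> \<Psi> ` Fn" if h: "ordered_opposite_faces a r \<sigma> \<tau>" and alt: "alternating \<sigma> \<tau>" for \<sigma> \<tau>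
  proof -
    have g: "opposite_faces a r \<sigma> \<tau>" using h by (simp add: ordered_opposite_faces_def)
    then have fl: "\<sigma> \<in> flores a r" "\<tau> \<in> flores a r" and dj: "\<sigma> \<inter> \<tau> = {}" and c: "card \<sigma> + card \<tau> = 2 * a + r"
      by (auto simp: opposite_faces_def)
    have fin: "finite \<sigma>" "finite \<tau>" using fl finite_flores by auto
    define U where "U = \<sigma> \<union> \<tau>"
    have UV: "U \<subseteq> V" unfolding U_def V_def using fl by (auto simp: flores_def)
    have finU: "finite U" using fin by (simp add: U_def)
    have cU: "card U = 2 * a + r" unfolding U_def using fin dj c by (simp add: card_Un_disjoint)
    have cVU: "card (V - U) = a" using UV cU finU by (simp add: card_Diff_subset V_def)
    obtain f where f: "\<And>i. i < a \<Longrightarrow> f i < (3::nat)" "\<And>i. i < a \<Longrightarrow> 3 * i + f i \<notin> \<sigma> \<union> \<tau>"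
      "card ((\<lambda>i. 3 * i + f i) ` {..<a}) = a"
      using missing_choice[OF fl] by blast
    define f' where "f' = restrict f {..<a}"
    have f': "f' \<in> Fn" unfolding Fn_def f'_def using f(1) by auto
    have "omit f' = (\<lambda>i. 3 * i + f i) ` {..<a}" unfolding omit_def f'_def by simp
    then have "omit f' \<subseteq> V - U" using f(2) omit_sub[OF f'] unfolding U_def by auto
    then have om: "omit f' = V - U"
      using card_omit[OF f'] cVU by (intro card_subset_eq) (auto simp: V_def)
    then have U: "V - omit f' = U" using UV by auto
    obtain s where s: "\<forall>u\<in>\<sigma>. even (order_position U u) = s" "\<forall>u\<in>\<tau>. even (order_position U u) \<noteq> s"
      using alt unfolding alternating_def U_def by blast
    have ne: "\<sigma> \<noteq> {}" "\<tau> \<noteq> {}" using opposite_faces_nonempty[OF g a] by auto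
    have "Min \<sigma> < Min \<tau>" using h by (simp add: ordered_opposite_faces_def)
    have "Min \<sigma> \<le> w" if "w \<in> U" for w
      using that Min_le[OF fin(1), of w] Min_le[OF fin(2), of w] \<open>Min \<sigma> < Min \<tau>\<close> unfolding U_def by auto
    then have "{w\<in>U. w < Min \<sigma>} = {}" by (auto simp: not_less)
    then have "order_position U (Min \<sigma>) = 0" unfolding order_position_def by (metis card.empty)
    moreover have "Min \<sigma> \<in> \<sigma>" using fin ne by simp
    ultimately have "s" using s(1) by (metis even_zero)
    then have "\<sigma> = ev U" "\<tau> = od U" using s dj unfolding ev_def od_def U_def by auto
    then have "\<Psi> f' = (\<sigma>, \<tau>)" unfolding \<Psi>_def U by simp
    then show ?thesis using imageI[OF f', of \<Psi>] by simp
  qed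
  have "{(\<sigma>, \<tau>). ordered_opposite_faces a r \<sigma> \<tau> \<and> alternating \<sigma> \<tau>} = \<Psi> ` Fn"
  proof (intro equalityI subsetI)
    fix q assume "q \<in> {(\<sigma>, \<tau>). ordered_opposite_faces a r \<sigma> \<tau> \<and> alternating \<sigma> \<tau>}"
    then show "q \<in> \<Psi> ` Fn" using surj[of "fst q" "snd q"] by auto
  next
    fix q assume "q \<in> \<Psi> ` Fn"
    then obtain f where "f \<in> Fn" "q = \<Psi> f" by blast
    then show "q \<in> {(\<sigma>, \<tau>). ordered_opposite_faces a r \<sigma> \<tau> \<and> alternating \<sigma> \<tau>}" using image[of f] by simp
  qed
  then have "card {(\<sigma>, \<tau>). ordered_opposite_faces a r \<sigma> \<tau> \<and> alternating \<sigma> \<tau>} = card Fn" using inj by (simp add: card_image)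
  also have "\<dots> = 3 ^ a" unfolding Fn_def by (simp add: card_PiE)
  finally show ?thesis .
qed

section \<open>The van Kampen--Flores obstruction\<close>

lemma crosses_cong:
  assumes "\<And>u. u \<in> A \<union> B \<Longrightarrow> pos u = pos' u"
  shows "crosses pos A B = crosses pos' A B"
proof -
  have "affine_dependency pos (A \<union> B) c = affine_dependency pos' (A \<union> B) c" for c
  proof -
    have "(\<Sum>u\<in>A \<union> B. c u *\<^sub>R pos u) = (\<Sum>u\<in>A \<union> B. c u *\<^sub>R pos' u)"
      using assms by (intro sum.cong) auto
    then show ?thesis unfolding affine_dependency_def by simp
  qed
  then show ?thesis unfolding crosses_def by simp
qed

text \<open>
  Points that do not occur in any image contribute nothing to boundaries.
\<close>
lemma carried_map_extend:
  assumes F: "carried_map J car X F" and JJ: "J \<subseteq> J'" and finJ: "finite J'"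
    and X: "\<And>\<sigma> \<tau>. \<sigma> \<in> X \<Longrightarrow> \<tau> \<subseteq> \<sigma> \<Longrightarrow> \<tau> \<in> X"
    and car: "\<And>p. p \<in> J \<Longrightarrow> car' p = car p"
  shows "carried_map J' car' X F"
  unfolding carried_map_def
proof (intro conjI ballI allI impI)
  show "F {} {} = 1" using F by (simp add: carried_map_def)
next
  fix \<sigma> A p assume "\<sigma> \<in> X" "F \<sigma> A \<noteq> 0"
  note c = carried_mapD[OF F this]
  show "A \<subseteq> J'" "card A = card \<sigma>" using c JJ by auto
  show "p \<in> A \<Longrightarrow> car' p \<subseteq> \<sigma>" using c(1) c(3)[of p] car[of p] by auto
next
  fix \<sigma> B assume \<sigma>: "\<sigma> \<in> X" and B: "B \<in> Pow J'"
  have zero: "F \<tau> C = 0" if "\<tau> \<in> X" "\<not> C \<subseteq> J" for \<tau> C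
    using carried_mapD(1)[OF F that(1)] that(2) by blast
  show "chain_boundary J' (F \<sigma>) B = (\<Sum>v\<in>\<sigma>. F (\<sigma> - {v}) B)"
  proof (cases "B \<subseteq> J")
    case True
    have "chain_boundary J' (F \<sigma>) B = chain_boundary J (F \<sigma>) B"
      unfolding chain_boundary_def
    proof (rule sum.mono_neutral_right)
      show "\<forall>i\<in>J' - B - (J - B). F \<sigma> (insert i B) = 0"
      proof
        fix i assume "i \<in> J' - B - (J - B)"
        then show "F \<sigma> (insert i B) = 0" using zero[OF \<sigma>, of "insert i B"] by auto
      qed
    qed (use finJ JJ in auto)
    then show ?thesis using carried_map_boundary[OF F \<sigma> True] by simp
  next
    case False
    have "F \<sigma> (insert i B) = 0" for i using zero[OF \<sigma>, of "insert i B"] False by auto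
    then have "chain_boundary J' (F \<sigma>) B = 0" unfolding chain_boundary_def by simp
    moreover have "F (\<sigma> - {v}) B = 0" for v using zero[OF X[OF \<sigma>, of "\<sigma> - {v}"] False] by blast
    ultimately show ?thesis by simp
  qed
qed

text \<open>
  The boundary passes from \<open>lam\<close> to \<open>e\<close> by the double count of sum_insert_Pow. Labels are composed as well:
  a point of \<open>J\<close> inherits the labels of all vertices in its own label.
\<close>
lemma carried_map_comp:
  assumes e: "carried_map U \<kappa> X e" and lam: "carried_map J car K lam" and finU: "finite U"
    and X: "{} \<in> X" "\<And>\<sigma> \<tau>. \<sigma> \<in> X \<Longrightarrow> \<tau> \<subseteq> \<sigma> \<Longrightarrow> \<tau> \<in> X"
    and supp: "\<And>\<sigma> s. \<sigma> \<in> X \<Longrightarrow> e \<sigma> s \<noteq> 0 \<Longrightarrow> s \<in> K"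
  shows "carried_map J (\<lambda>p. \<Union>(\<kappa> ` car p)) X (\<lambda>\<sigma> A. \<Sum>s\<in>Pow U. e \<sigma> s * lam s A)"
  unfolding carried_map_def
proof (intro conjI ballI allI impI)
  have "e {} s * lam s {} = (if s = {} then 1 else 0)" if "s \<in> Pow U" for s
  proof (cases "s = {}")
    case True
    then show ?thesis using e lam by (simp add: carried_map_def)
  next
    case False
    have "e {} s = 0"
    proof (rule ccontr)
      assume "e {} s \<noteq> 0"
      from carried_mapD(2)[OF e X(1) this] have "card s = 0" by simp
      then show False using False that finU by (auto dest: finite_subset)
    qed
    then show ?thesis using False by simp
  qed
  then have "(\<Sum>s\<in>Pow U. e {} s * lam s {}) = (\<Sum>s\<in>Pow U. if s = {} then 1 else 0)" by (intro sum.cong) auto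
  also have "\<dots> = 1" using finU by simp
  finally show "(\<Sum>s\<in>Pow U. e {} s * lam s {}) = 1" .
next
  fix \<sigma> A p assume \<sigma>: "\<sigma> \<in> X" and nz: "(\<Sum>s\<in>Pow U. e \<sigma> s * lam s A) \<noteq> 0"
  from nz obtain s where "s \<in> Pow U" "e \<sigma> s * lam s A \<noteq> 0" by (rule sum.not_neutral_contains_not_neutral)
  then have s: "e \<sigma> s \<noteq> 0" "lam s A \<noteq> 0" by auto
  note c1 = carried_mapD[OF e \<sigma> s(1)] and c2 = carried_mapD[OF lam supp[OF \<sigma> s(1)] s(2)]
  show "A \<subseteq> J" "card A = card \<sigma>" using c1 c2 by auto
  show "\<Union>(\<kappa> ` car p) \<subseteq> \<sigma>" if "p \<in> A" using c1(3) c2(3)[OF that] by blast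
next
  fix \<sigma> B assume \<sigma>: "\<sigma> \<in> X" and "B \<in> Pow J"
  then have B: "B \<subseteq> J" by blast
  have "chain_boundary J (\<lambda>A. \<Sum>s\<in>Pow U. e \<sigma> s * lam s A) B = (\<Sum>s\<in>Pow U. e \<sigma> s * chain_boundary J (lam s) B)"
    unfolding chain_boundary_sum by (intro sum.cong refl) (simp add: chain_boundary_def sum_distrib_left)
  also have "\<dots> = (\<Sum>s\<in>Pow U. \<Sum>v\<in>s. e \<sigma> s * lam (s - {v}) B)"
  proof (rule sum.cong[OF refl])
    fix s assume "s \<in> Pow U"
    show "e \<sigma> s * chain_boundary J (lam s) B = (\<Sum>v\<in>s. e \<sigma> s * lam (s - {v}) B)"
    proof (cases "e \<sigma> s = 0")
      case False
      then show ?thesis using carried_map_boundary[OF lam supp[OF \<sigma> False] B] by (simp add: sum_distrib_left)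
    qed simp
  qed
  also have "\<dots> = (\<Sum>s\<in>Pow U. \<Sum>j\<in>U - s. e \<sigma> (insert j s) * lam (insert j s - {j}) B)"
    by (rule sum_insert_Pow[OF finU, symmetric])
  also have "\<dots> = (\<Sum>s\<in>Pow U. chain_boundary U (e \<sigma>) s * lam s B)"
    unfolding chain_boundary_def sum_distrib_right by (intro sum.cong refl) auto
  also have "\<dots> = (\<Sum>s\<in>Pow U. \<Sum>v\<in>\<sigma>. e (\<sigma> - {v}) s * lam s B)"
    using carried_map_boundary[OF e \<sigma>] by (intro sum.cong refl) (simp add: sum_distrib_right)
  also have "\<dots> = (\<Sum>v\<in>\<sigma>. \<Sum>s\<in>Pow U. e (\<sigma> - {v}) s * lam s B)" by (rule sum.swap)
  finally show "chain_boundary J (\<lambda>A. \<Sum>s\<in>Pow U. e \<sigma> s * lam s A) B = (\<Sum>v\<in>\<sigma>. \<Sum>s\<in>Pow U. e (\<sigma> - {v}) s * lam s B)" .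
qed

text \<open>
  Composing \<open>e\<close> with the subdivision gives a chain map to the points of \<open>L\<close>, which a small perturbation of the
  embedding brings into general position together with reference points on the moment curve. Its
  crossing number is 0, as disjoint simplices of \<open>L\<close> have disjoint images, and it equals the odd
  crossing number of the reference points.
\<close>
theorem no_carried_map_from_flores:
  fixes K :: "'v set set"
  assumes a: "a \<ge> 1" and dim: "CARD('k::finite) + 2 = 2 * a + r"
    and K: "abstract_complex K" and PL: "PL_embeddable TYPE(real ^ 'k) K"
    and e: "carried_map (\<Union>K) \<kappa> (flores a r) e"
    and supp: "\<And>\<sigma> s. \<sigma> \<in> flores a r \<Longrightarrow> e \<sigma> s \<noteq> 0 \<Longrightarrow> s \<in> K"
    and \<kappa>: "\<And>u. u \<in> \<Union>K \<Longrightarrow> \<kappa> u \<noteq> {}"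
  shows False
proof -
  obtain L and \<psi> :: "('v \<Rightarrow>\<^sub>0 real) \<Rightarrow> real ^ 'k" where L: "subdivision_of L K" and \<psi>: "linear_embedding \<psi> L"
    using PL unfolding PL_embeddable_def by blast
  interpret subdivided_complex K L using K L by unfold_locales
  define V where "V = {..<3 * a + r}"
  define X where "X = flores a r"
  have finK: "finite (\<Union>K)" using K unfolding abstract_complex_def by blast
  have Xclosed: "\<And>\<sigma> \<tau>. \<sigma> \<in> X \<Longrightarrow> \<tau> \<subseteq> \<sigma> \<Longrightarrow> \<tau> \<in> X" unfolding X_def by (rule flores_subset)
  have X0: "{} \<in> X" unfolding X_def by (rule empty_flores)
  obtain j0 where j0: "j0 \<in> \<Union>K"
  proof -
    have X1: "{0} \<in> X" using a by (auto simp: X_def flores_def)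
    have "chain_boundary (\<Union>K) (e {0}) {} = e {} {}"
      using carried_map_boundary[OF e, of "{0}" "{}"] X1 unfolding X_def by simp
    also have "\<dots> = 1" using e by (simp add: carried_map_def)
    finally have "chain_boundary (\<Union>K) (e {0}) {} \<noteq> 0" by simp
    then obtain j where "j \<in> \<Union>K - {}" by (rule chain_boundary_nonzero) blast
    then show ?thesis using that by blast
  qed
  have "{} \<in> L"
  proof -
    obtain \<sigma> where \<sigma>: "j0 \<in> \<sigma>" "\<sigma> \<in> K" using j0 by blast
    obtain s where "s \<in> L" by (rule geom_pointE[OF hull_inc \<sigma>(2), of "std_vertex j0"]) (use \<sigma> in auto)
    then show ?thesis using faceL_closed[of s "{}"] by blast
  qed
  note lam = carried_map_subdivided[OF this]
  define F where "F = (\<lambda>\<sigma> A. \<Sum>s\<in>Pow (\<Union>K). e \<sigma> s * subdivided s A)"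
  define car0 where "car0 = (\<lambda>p::'v \<Rightarrow>\<^sub>0 real. \<Union>(\<kappa> ` Poly_Mapping.keys p))"
  have F0: "carried_map points car0 X F"
    unfolding F_def car0_def X_def
    by (rule carried_map_comp[OF e lam finK]) (use empty_flores flores_subset supp in auto)
  have F_L: "A \<in> L" if "\<sigma> \<in> X" "F \<sigma> A \<noteq> 0" for \<sigma> A
  proof -
    from that(2) obtain s where "e \<sigma> s * subdivided s A \<noteq> 0"
      unfolding F_def by (rule sum.not_neutral_contains_not_neutral)
    then show ?thesis using subdivided_nonzero by auto
  qed
  \<comment> \<open>Labels for the reference points. Their coordinate sum is at least 2, so they are not points of \<open>L\<close>.\<close>
  define y :: "nat \<Rightarrow> ('v \<Rightarrow>\<^sub>0 real)" where "y = (\<lambda>v. (real v + 2) *\<^sub>R std_vertex j0)"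
  have look_y: "Poly_Mapping.lookup (y v) j = (if j = j0 then real v + 2 else 0)" for v j
    by (simp add: y_def lookup_std_vertex)
  have inj_y: "inj y"
    by (rule injI) (metis look_y add_right_cancel of_nat_eq_iff)
  have y_new: "y v \<notin> points" for v
  proof
    assume "y v \<in> points"
    then obtain s where s: "y v \<in> s" "s \<in> L" unfolding points_def by blast
    have "Poly_Mapping.keys (y v) \<subseteq> {j0}" by (auto simp: in_keys_iff look_y split: if_split_asm)
    then show False using point_sum[OF s, of "{j0}"] by (simp add: look_y)
  qed
  define Y where "Y = y ` V"
  define J where "J = points \<union> Y"
  have finY: "finite Y" unfolding Y_def V_def by simp
  have finJ: "finite J" unfolding J_def using finite_points finY by simp
  have PY: "points \<inter> Y = {}" unfolding Y_def using y_new by auto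
  define t where "t = the_inv y"
  have ty: "t (y v) = v" for v unfolding t_def using inj_y by (rule the_inv_f_f)
  define car where "car = (\<lambda>p. if p \<in> points then car0 p else {t p})"
  have F: "carried_map J car X F"
    by (rule carried_map_extend[OF F0 _ finJ Xclosed]) (auto simp: J_def car_def)
  have keysK: "Poly_Mapping.keys p \<subseteq> \<Union>K" if pp: "p \<in> points" for p
  proof -
    obtain s where s: "p \<in> s" "s \<in> L" using pp unfolding points_def by blast
    obtain \<tau> where "\<tau> \<in> K" "p \<in> std_simplex \<tau>" by (rule pointE[OF s])
    then show ?thesis using in_std_simplex_iff[of \<tau> p] finite_faceK by blast
  qed
  have car_ne: "car p \<noteq> {}" for p
  proof (cases "p \<in> points")
    case True
    obtain u where u: "u \<in> Poly_Mapping.keys p" using keys_nonempty[OF True] by blast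
    have "\<kappa> u \<noteq> {}" by (rule \<kappa>) (use keysK[OF True] u in blast)
    then have "car0 p \<noteq> {}" unfolding car0_def using u by blast
    then show ?thesis using True by (simp add: car_def)
  qed (simp add: car_def)
  have car_y: "car (y v) = {v}" for v unfolding car_def using y_new ty by simp
  obtain idx where idx: "bij_betw idx (UNIV::'k set) {1..CARD('k)}"
    using finite_same_card_bij[of "UNIV::'k set" "{1..CARD('k)}"] by auto
  define pairs where "pairs = {(A, B). A \<in> L \<and> B \<in> L \<and> A \<inter> B = {} \<and> A \<union> B \<noteq> {}}"
  have fin_pairs: "finite pairs" unfolding pairs_def by (rule finite_subset[of _ "L \<times> L"]) (use finiteL in auto)
  have "\<exists>d>0. \<forall>q\<in>pairs. \<forall>pos. (\<forall>u\<in>fst q \<union> snd q. dist (pos u) (\<psi> u) < d) \<longrightarrow> \<not> crosses pos (fst q) (snd q)"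
  proof (rule uniform_radius[OF fin_pairs])
    fix q assume "q \<in> pairs"
    then obtain A B where q: "q = (A, B)" "A \<in> L" "B \<in> L" "A \<inter> B = {}" "A \<union> B \<noteq> {}" unfolding pairs_def by blast
    have "convex hull (\<psi> ` A) \<inter> convex hull (\<psi> ` B) = convex hull (\<psi> ` (A \<inter> B))"
      using \<psi> q(2,3) unfolding linear_embedding_def by blast
    then have "convex hull (\<psi> ` A) \<inter> convex hull (\<psi> ` B) = {}" using q(4) by simp
    from not_crosses_stable[OF finite_faceL[OF q(2)] finite_faceL[OF q(3)] q(5) this]
    show "\<exists>d>0. \<forall>pos. (\<forall>u\<in>fst q \<union> snd q. dist (pos u) (\<psi> u) < d) \<longrightarrow> \<not> crosses pos (fst q) (snd q)"
      unfolding q(1) by simp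
  next
    fix q d and d' :: real
    assume "\<forall>pos. (\<forall>u\<in>fst q \<union> snd q. dist (pos u) (\<psi> u) < d) \<longrightarrow> \<not> crosses pos (fst q) (snd q)" "d' \<le> d"
    then show "\<forall>pos. (\<forall>u\<in>fst q \<union> snd q. dist (pos u) (\<psi> u) < d') \<longrightarrow> \<not> crosses pos (fst q) (snd q)"
      by (meson less_le_trans)
  qed
  then obtain d where d: "d > 0" "\<And>A B pos. (A, B) \<in> pairs \<Longrightarrow>
      (\<forall>u\<in>A \<union> B. dist (pos u) (\<psi> u) < d) \<Longrightarrow> \<not> crosses pos A B" by fastforce
  have "general_position (\<lambda>p. moment_curve idx (real (t p))) Y"
    by (rule general_position_moment_curve[OF idx finY]) (auto simp: inj_on_def Y_def ty)
  from general_position_approx[OF finite_points this finY PY d(1), of \<psi>]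
  obtain pos where pos: "\<forall>p\<in>Y. pos p = moment_curve idx (real (t p))"
    "\<forall>p\<in>points. dist (pos p) (\<psi> p) < d" "general_position pos J"
    unfolding J_def by blast
  define p where "p = (\<lambda>A B. of_bool (crosses pos A B) :: bit)"
  interpret vk: van_kampen J p "2 * a + r" V X "opposite_faces a r" "ordered_opposite_faces a r" car
  proof (intro van_kampen.intro)
    show "crossing_form J p (2 * a + r)"
    proof
      show "finite J" by (rule finJ)
      show "p A B = p B A" for A B unfolding p_def using crosses_commute[of pos A B] by simp
      show "(\<Sum>x\<in>A. p (A - {x}) B) = (\<Sum>x\<in>B. p A (B - {x}))"
        if "A \<subseteq> J" "B \<subseteq> J" "A \<inter> B = {}" "card A + card B = 2 * a + r + 1" for A B
        unfolding p_def using that dim by (intro crosses_boundary[OF pos(3) finJ]) auto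
    qed
    show "pair_cycle V X (opposite_faces a r) (ordered_opposite_faces a r) (2 * a + r)"
      unfolding V_def X_def by (rule pair_cycle_flores[OF a])
    show "van_kampen_axioms J car" by unfold_locales (use car_ne in auto)
  qed
  have "vk.crossing_number F = 0"
  proof -
    have "pairing J p (F \<sigma>) (F \<tau>) = 0" if h: "ordered_opposite_faces a r \<sigma> \<tau>" for \<sigma> \<tau>
    proof -
      have g: "opposite_faces a r \<sigma> \<tau>" using h by (simp add: ordered_opposite_faces_def)
      then have st: "\<sigma> \<in> X" "\<tau> \<in> X" "\<sigma> \<inter> \<tau> = {}" by (auto simp: opposite_faces_def X_def)
      have "F \<sigma> A * F \<tau> B * p A B = 0" for A B
      proof (cases "F \<sigma> A = 0 \<or> F \<tau> B = 0")
        case False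
        note cA = carried_mapD[OF F st(1), of A] and cB = carried_mapD[OF F st(2), of B]
        have AB: "A \<in> L" "B \<in> L" using F_L st False by auto
        have "A \<inter> B = {}"
        proof (rule ccontr)
          assume "A \<inter> B \<noteq> {}"
          then obtain x where "x \<in> A" "x \<in> B" by blast
          then have "car x \<subseteq> \<sigma> \<inter> \<tau>" using cA(3) cB(3) False by blast
          then show False using st(3) car_ne[of x] by blast
        qed
        moreover have "A \<noteq> {}"
        proof
          assume "A = {}"
          then have "card \<sigma> = 0" using cA(2) False by simp
          then show False using opposite_faces_nonempty[OF g a] finite_flores st(1) unfolding X_def by (metis card_0_eq)
        qed
        ultimately have "(A, B) \<in> pairs" using AB unfolding pairs_def by blast
        moreover have "A \<union> B \<subseteq> points" using AB unfolding points_def by blast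
        ultimately have "\<not> crosses pos A B" using d(2) pos(2) by blast
        then show ?thesis by (simp add: p_def)
      qed auto
      then show ?thesis unfolding pairing_def by (intro sum.neutral ballI) 
    qed
    then show ?thesis unfolding vk.crossing_number_def by (intro sum.neutral) auto
  qed
  moreover have "vk.crossing_number F = vk.crossing_number (\<lambda>\<sigma> A. of_bool (A = y ` \<sigma>))"
    by (rule vk.crossing_number_eq_vertex_map[OF F])
      (use car_y inj_y in \<open>auto simp: J_def Y_def intro: inj_on_subset\<close>)
  moreover have "vk.crossing_number (\<lambda>\<sigma> A. of_bool (A = y ` \<sigma>)) = 1"
  proof -
    have val: "pairing J p (\<lambda>A. of_bool (A = y ` \<sigma>)) (\<lambda>A. of_bool (A = y ` \<tau>)) = of_bool (alternating \<sigma> \<tau>)"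
      if h: "ordered_opposite_faces a r \<sigma> \<tau>" for \<sigma> \<tau>
    proof -
      have g: "\<sigma> \<in> flores a r" "\<tau> \<in> flores a r" "\<sigma> \<inter> \<tau> = {}" "card \<sigma> + card \<tau> = CARD('k) + 2"
        using h dim by (auto simp: opposite_faces_def ordered_opposite_faces_def)
      have sub: "y ` \<sigma> \<in> Pow J" "y ` \<tau> \<in> Pow J"
        using g(1,2) unfolding J_def Y_def V_def flores_def by auto
      have "pairing J p (\<lambda>A. of_bool (A = y ` \<sigma>)) (\<lambda>A. of_bool (A = y ` \<tau>))
        = (\<Sum>A\<in>Pow J. if A = y ` \<sigma> then (\<Sum>B\<in>Pow J. if B = y ` \<tau> then p A B else 0) else 0)"
        unfolding pairing_def
      proof (rule sum.cong[OF refl])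
        fix A
        show "(\<Sum>B\<in>Pow J. of_bool (A = y ` \<sigma>) * of_bool (B = y ` \<tau>) * p A B)
          = (if A = y ` \<sigma> then (\<Sum>B\<in>Pow J. if B = y ` \<tau> then p A B else 0) else 0)"
          by (cases "A = y ` \<sigma>") (auto intro!: sum.cong)
      qed
      also have "\<dots> = p (y ` \<sigma>) (y ` \<tau>)"
        using sub finJ by (simp only: sum.delta finite_Pow_iff if_True)
      also have "crosses pos (y ` \<sigma>) (y ` \<tau>) = crosses (\<lambda>x. pos (y x)) \<sigma> \<tau>"
        by (rule crosses_image) (rule inj_on_subset[OF inj_y subset_UNIV])
      then have "p (y ` \<sigma>) (y ` \<tau>) = of_bool (crosses (\<lambda>x. pos (y x)) \<sigma> \<tau>)" by (simp add: p_def)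
      also have "crosses (\<lambda>x. pos (y x)) \<sigma> \<tau> = crosses (\<lambda>x. moment_curve idx (real x)) \<sigma> \<tau>"
        by (rule crosses_cong) (use pos(1) ty g(1,2) in \<open>auto simp: Y_def V_def flores_def\<close>)
      also have "\<dots> = alternating \<sigma> \<tau>"
        unfolding alternating_def
        by (rule crosses_moment_curve_iff[OF idx finite_flores[OF g(1)] finite_flores[OF g(2)] g(3,4)])
      finally show ?thesis .
    qed
    have "vk.crossing_number (\<lambda>\<sigma> A. of_bool (A = y ` \<sigma>)) = (\<Sum>q\<in>{(\<sigma>, \<tau>). ordered_opposite_faces a r \<sigma> \<tau>}. of_bool (alternating (fst q) (snd q)))"
      unfolding vk.crossing_number_def using val by (intro sum.cong refl) auto
    also have "\<dots> = of_nat (card ({(\<sigma>, \<tau>). ordered_opposite_faces a r \<sigma> \<tau>} \<inter> {q. alternating (fst q) (snd q)}))"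
      using vk.finite_half by (simp add: sum_of_bool_eq)
    also have "{(\<sigma>, \<tau>). ordered_opposite_faces a r \<sigma> \<tau>} \<inter> {q. alternating (fst q) (snd q)} = {(\<sigma>, \<tau>). ordered_opposite_faces a r \<sigma> \<tau> \<and> alternating \<sigma> \<tau>}"
      by auto
    also have "of_nat (card \<dots>) = (1::bit)"
      unfolding card_alternating_opposite_faces[OF a] by simp
    finally show ?thesis .
  qed
  ultimately show False by simp
qed

lemma carried_map_vertex_map:
  assumes finJ: "finite J" and X: "\<And>\<sigma>. \<sigma> \<in> X \<Longrightarrow> finite \<sigma> \<and> \<sigma> \<subseteq> V" and y: "y ` V \<subseteq> J" "inj_on y V"
    and car: "\<And>v. v \<in> V \<Longrightarrow> car (y v) = {v}"
  shows "carried_map J car X (\<lambda>\<sigma> A. of_bool (A = y ` \<sigma>))"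
  unfolding carried_map_def
proof (intro conjI ballI allI impI)
  fix \<sigma> A p assume \<sigma>: "\<sigma> \<in> X" and nz: "of_bool (A = y ` \<sigma>) \<noteq> (0::bit)"
  then have A: "A = y ` \<sigma>" by simp
  have inj: "inj_on y \<sigma>" by (rule inj_on_subset[OF y(2)]) (use X[OF \<sigma>] in blast)
  show "A \<subseteq> J" "card A = card \<sigma>" using A X[OF \<sigma>] y(1) card_image[OF inj] by auto
  show "p \<in> A \<Longrightarrow> car p \<subseteq> \<sigma>" using A X[OF \<sigma>] car by auto
next
  fix \<sigma> B assume \<sigma>: "\<sigma> \<in> X" and "B \<in> Pow J"
  then have B: "B \<subseteq> J" by blast
  have inj: "inj_on y \<sigma>" by (rule inj_on_subset[OF y(2)]) (use X[OF \<sigma>] in blast)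
  have "y ` \<sigma> \<subseteq> J" using X[OF \<sigma>] y(1) by blast
  then show "chain_boundary J (\<lambda>A. of_bool (A = y ` \<sigma>)) B = (\<Sum>v\<in>\<sigma>. of_bool (B = y ` (\<sigma> - {v})))"
    using chain_boundary_vertex_map[OF finJ _ inj _ B] X[OF \<sigma>] by blast
qed simp

section \<open>Complete multipartite subhypergraphs\<close>

text \<open>
  The graph of the cube lies above its tangent at \<open>a\<close>.
\<close>
lemma cube_tangent:
  fixes a x :: real
  assumes "0 \<le> a" "0 \<le> x"
  shows "3 * a\<^sup>2 * x - 2 * a ^ 3 \<le> x ^ 3"
proof -
  have "x ^ 3 - (3 * a\<^sup>2 * x - 2 * a ^ 3) = (x - a)\<^sup>2 * (x + 2 * a)"
    by (simp add: power2_eq_square power3_eq_cube algebra_simps)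
  also have "\<dots> \<ge> 0" using assms by simp
  finally show ?thesis by simp
qed

text \<open>
  Summing the tangent inequality at the mean of \<open>d\<close> yields the inequality between power means.
\<close>
lemma sum_cubes_ge:
  fixes d :: "'a \<Rightarrow> real"
  assumes fin: "finite T" and M: "real (card T) > 0" and d: "\<And>x. x \<in> T \<Longrightarrow> 0 \<le> d x"
  shows "(\<Sum>x\<in>T. d x) ^ 3 / (real (card T))\<^sup>2 \<le> (\<Sum>x\<in>T. d x ^ 3)"
proof -
  define S M' where "S = (\<Sum>x\<in>T. d x)" and "M' = real (card T)"
  define a where "a = S / M'"
  have a: "0 \<le> a" "M' \<noteq> 0" unfolding a_def S_def M'_def using d M by (auto simp: sum_nonneg)
  have "S ^ 3 / M'\<^sup>2 = 3 * a\<^sup>2 * S - 2 * a ^ 3 * M'"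
    unfolding a_def using a(2) by (simp add: field_simps power2_eq_square power3_eq_cube)
  also have "\<dots> = (\<Sum>x\<in>T. 3 * a\<^sup>2 * d x - 2 * a ^ 3)"
    unfolding S_def M'_def sum_subtractf sum_distrib_left[symmetric] by simp
  also have "\<dots> \<le> (\<Sum>x\<in>T. d x ^ 3)" using cube_tangent[OF a(1)] d by (intro sum_mono) auto
  finally show ?thesis by (simp add: S_def M'_def)
qed

text \<open>
  The bound of Erdos, for ordered tuples. The cubes of the numbers of heads, summed over all tails, count
  the triples of heads with a common tail, and the power mean inequality makes this sum large. Triples
  with repetitions contribute little, so some three distinct heads have enough common tails for the
  induction hypothesis. The exponent \<open>3^{-k}\<close> is divided by 3 in each step.
\<close>
lemma complete_multipartite_tuples:
  fixes V :: "'a set"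
  assumes fin: "finite V" and n: "card V = n" "n \<ge> 1"
    and H: "H \<subseteq> {xs. set xs \<subseteq> V \<and> length xs = Suc k}"
    and large: "real (card H) \<ge> 3 * real n powr (real (Suc k) - 3 powr (- real k))"
  shows "\<exists>As. length As = Suc k \<and> (\<forall>A\<in>set As. card A = 3) \<and> (\<forall>xs. list_all2 (\<in>) xs As \<longrightarrow> xs \<in> H)"
  using H large
proof (induction k arbitrary: H)
  case 0
  define A where "A = {v. [v] \<in> H}"
  have "H = (\<lambda>v. [v]) ` A" unfolding A_def using 0(1) by (auto simp: length_Suc_conv)
  then have "card H = card A" by (simp add: card_image inj_on_def)
  moreover have "real (card H) \<ge> 3" using 0(2) n by simp
  ultimately obtain A' where A': "A' \<subseteq> A" "card A' = 3"
    by (metis (no_types, opaque_lifting) obtain_subset_with_card_n of_nat_le_iff of_nat_numeral)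
  show ?case
    by (rule exI[of _ "[A']"]) (use A' in \<open>auto simp: A_def list_all2_Cons2\<close>)
next
  case (Suc k)
  define T where "T = {xs. set xs \<subseteq> V \<and> length xs = Suc k}"
  have finT: "finite T" unfolding T_def using fin by (rule finite_lists_length_eq)
  have cardT: "card T = n ^ Suc k" unfolding T_def using fin n by (simp add: card_lists_length_eq)
  define N where "N = (\<lambda>xs. {v\<in>V. v # xs \<in> H})"
  define C where "C = (\<lambda>v. {xs\<in>T. v # xs \<in> H})"
  have finN: "finite (N xs)" for xs unfolding N_def using fin by simp
  have finC: "finite (C v)" for v unfolding C_def using finT by simp
  have H_eq: "H = (\<lambda>(xs, v). v # xs) ` Sigma T N"
    using Suc.prems(1) unfolding T_def N_def by (force simp: length_Suc_conv image_iff)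
  have cH: "card H = (\<Sum>xs\<in>T. card (N xs))"
  proof -
    have "inj_on (\<lambda>(xs, v). v # xs) (Sigma T N)" by (auto simp: inj_on_def)
    then have "card H = card (Sigma T N)" unfolding H_eq by (rule card_image)
    then show ?thesis using finT finN by simp
  qed
  have triples: "(\<Sum>xs\<in>T. card (N xs) ^ 3) = (\<Sum>(a, b, c)\<in>V \<times> V \<times> V. card (C a \<inter> C b \<inter> C c))"
  proof -
    have "(\<Sum>xs\<in>T. card (N xs) ^ 3) = card (Sigma T (\<lambda>xs. N xs \<times> N xs \<times> N xs))"
      using finT finN by (simp add: card_cartesian_product power3_eq_cube mult.assoc)
    also have "\<dots> = card (Sigma (V \<times> V \<times> V) (\<lambda>(a, b, c). C a \<inter> C b \<inter> C c))"
      by (rule bij_betw_same_card[of "\<lambda>(xs, q). (q, xs)"], rule bij_betwI[of _ _ _ "\<lambda>(q, xs). (xs, q)"])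
        (auto simp: N_def C_def)
    also have "\<dots> = (\<Sum>q\<in>V \<times> V \<times> V. card ((\<lambda>(a, b, c). C a \<inter> C b \<inter> C c) q))"
      using fin finC by (subst card_SigmaI) auto
    finally show ?thesis by (simp add: case_prod_beta)
  qed
  define e where "e = 3 powr (- real k)"
  have e: "0 < e" "e \<le> 1" "3 powr (- real (Suc k)) = e / 3"
  proof -
    have "3 powr (- real k) \<le> (3::real) powr 0" by (rule powr_mono) auto
    then show "0 < e" "e \<le> 1" unfolding e_def by simp_all
    have "- real (Suc k) = - real k - 1" by simp
    then show "3 powr (- real (Suc k)) = e / 3" by (simp only: e_def powr_diff) simp
  qed
  define B where "B = 3 * real n powr (real (Suc k) - e)"
  define D where "D = {(a, b, c). (a, b, c) \<in> V \<times> V \<times> V \<and> (a = b \<or> a = c \<or> b = c)}"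
  have "\<exists>a\<in>V. \<exists>b\<in>V. \<exists>c\<in>V. a \<noteq> b \<and> a \<noteq> c \<and> b \<noteq> c \<and> real (card (C a \<inter> C b \<inter> C c)) \<ge> B"
  proof (rule ccontr)
    assume no: "\<not> ?thesis"
    have n0: "real n > 0" using n by simp
    define Q where "Q = real n powr (real k + 4 - e)"
    have Q: "Q > 0" unfolding Q_def using n0 by simp
    have lower: "27 * Q \<le> (\<Sum>xs\<in>T. real (card (N xs)) ^ 3)"
    proof -
      have M: "real (card T) > 0" using cardT n0 by simp
      have "27 * Q = (3 * real n powr (real (Suc (Suc k)) - e / 3)) ^ 3 / (real (card T))\<^sup>2"
      proof -
        have "(real n powr (real (Suc (Suc k)) - e / 3)) ^ 3 = real n powr (3 * (real (Suc (Suc k)) - e / 3))"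
          using n0 by (simp add: powr_powr[symmetric] powr_realpow[symmetric] powr_powr mult.commute)
        moreover have "(real (card T))\<^sup>2 = real n powr (2 * real (Suc k))"
          using n0 unfolding cardT by (simp add: powr_realpow[symmetric] powr_powr power_mult[symmetric] mult.commute del: power_Suc)
        moreover have "real n powr (3 * (real (Suc (Suc k)) - e / 3)) / real n powr (2 * real (Suc k)) = Q"
          unfolding Q_def powr_diff[symmetric] by (rule arg_cong[of _ _ "\<lambda>z. real n powr z"]) (simp add: field_simps)
        moreover have "(3 * z) ^ 3 = 27 * z ^ 3" for z :: real by (simp add: power_mult_distrib)
        ultimately show ?thesis by (simp only: times_divide_eq_right[symmetric])
      qed
      also have "\<dots> \<le> (real (card H)) ^ 3 / (real (card T))\<^sup>2"
        using Suc.prems(2) unfolding e(3) by (intro divide_right_mono power_mono) auto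
      also have "real (card H) = (\<Sum>xs\<in>T. real (card (N xs)))" using cH by simp
      also have "(\<Sum>xs\<in>T. real (card (N xs))) ^ 3 / (real (card T))\<^sup>2 \<le> (\<Sum>xs\<in>T. real (card (N xs)) ^ 3)"
        by (rule sum_cubes_ge[OF finT M]) simp
      finally show ?thesis .
    qed
    define h where "h = (\<lambda>(a, b, c). real (card (C a \<inter> C b \<inter> C c)))"
    have finD: "finite D" unfolding D_def by (rule finite_subset[of _ "V \<times> V \<times> V"]) (use fin in auto)
    have cD: "card D \<le> 3 * n\<^sup>2"
    proof -
      have "D \<subseteq> (\<lambda>(a, b). (a, a, b)) ` (V \<times> V) \<union> ((\<lambda>(a, b). (a, b, a)) ` (V \<times> V) \<union> (\<lambda>(a, b). (b, a, a)) ` (V \<times> V))"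
        unfolding D_def by force
      then have "card D \<le> card ((\<lambda>(a, b). (a, a, b)) ` (V \<times> V) \<union> ((\<lambda>(a, b). (a, b, a)) ` (V \<times> V) \<union> (\<lambda>(a, b). (b, a, a)) ` (V \<times> V)))"
        using fin by (intro card_mono) auto
      also have "\<dots> \<le> card ((\<lambda>(a, b). (a, a, b)) ` (V \<times> V)) + (card ((\<lambda>(a, b). (a, b, a)) ` (V \<times> V)) + card ((\<lambda>(a, b). (b, a, a)) ` (V \<times> V)))"
        by (rule order_trans[OF card_Un_le add_left_mono[OF card_Un_le]])
      also have "\<dots> \<le> card (V \<times> V) + (card (V \<times> V) + card (V \<times> V))"
        using fin by (intro add_mono card_image_le) auto
      finally show ?thesis using n by (simp add: power2_eq_square card_cartesian_product)
    qed
    have h_le: "h q \<le> real n ^ Suc k" if "q \<in> V \<times> V \<times> V" for q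
    proof -
      obtain a b c where q: "q = (a, b, c)" by (cases q) auto
      have "card (C a \<inter> C b \<inter> C c) \<le> card T" using finT by (intro card_mono) (auto simp: C_def)
      then have "real (card (C a \<inter> C b \<inter> C c)) \<le> real (n ^ Suc k)" unfolding cardT using of_nat_le_iff by blast
      then show ?thesis by (simp add: q h_def)
    qed
    have "(\<Sum>xs\<in>T. real (card (N xs)) ^ 3) = (\<Sum>q\<in>V \<times> V \<times> V. h q)"
      using arg_cong[OF triples, of real] by (simp add: h_def case_prod_beta)
    also have "\<dots> = (\<Sum>q\<in>D. h q) + (\<Sum>q\<in>V \<times> V \<times> V - D. h q)"
      using fin by (subst sum.subset_diff[of D]) (auto simp: D_def)
    also have "(\<Sum>q\<in>D. h q) \<le> (\<Sum>q\<in>D. real n ^ Suc k)"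
      using h_le by (intro sum_mono) (auto simp: D_def)
    also have "(\<Sum>q\<in>D. real n ^ Suc k) \<le> 3 * (real n)\<^sup>2 * real n ^ Suc k"
      using of_nat_mono[OF cD, where 'a = real] by (simp add: mult_right_mono)
    also have "3 * (real n)\<^sup>2 * real n ^ Suc k \<le> 3 * Q"
    proof -
      have "(real n)\<^sup>2 * real n ^ Suc k = real n powr (real k + 3)"
      proof -
        have "(real n)\<^sup>2 = real n powr real 2" "real n ^ Suc k = real n powr real (Suc k)"
          by (rule powr_realpow[OF n0, symmetric])+
        then have "(real n)\<^sup>2 * real n ^ Suc k = real n powr (real 2 + real (Suc k))" by (simp only: powr_add)
        also have "real 2 + real (Suc k) = real k + 3" by simp
        finally show ?thesis .
      qed
      also have "\<dots> \<le> Q" unfolding Q_def using n e by (intro powr_mono) auto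
      finally show ?thesis by simp
    qed
    also have "(\<Sum>q\<in>V \<times> V \<times> V - D. h q) \<le> (\<Sum>q\<in>V \<times> V \<times> V - D. B)"
    proof (rule sum_mono)
      fix q assume q: "q \<in> V \<times> V \<times> V - D"
      obtain a b c where abc: "q = (a, b, c)" by (cases q) auto
      have "a \<in> V" "b \<in> V" "c \<in> V" "a \<noteq> b" "a \<noteq> c" "b \<noteq> c" using q unfolding D_def abc by auto
      then have "real (card (C a \<inter> C b \<inter> C c)) < B" using no by (meson not_le)
      then show "h q \<le> B" by (simp add: h_def abc)
    qed
    also have "(\<Sum>q\<in>V \<times> V \<times> V - D. B) \<le> real n ^ 3 * B"
    proof -
      have "card (V \<times> V \<times> V - D) \<le> card (V \<times> V \<times> V)" using fin by (intro card_mono) auto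
      also have "\<dots> = n ^ 3" using n by (simp add: power3_eq_cube card_cartesian_product mult.assoc)
      finally have "real (card (V \<times> V \<times> V - D)) \<le> real n ^ 3" by (metis of_nat_le_iff of_nat_power)
      moreover have "B \<ge> 0" unfolding B_def by simp
      ultimately show ?thesis by (simp add: mult_right_mono)
    qed
    also have "real n ^ 3 * B = 3 * Q"
    proof -
      have "real n ^ 3 = real n powr real 3" by (rule powr_realpow[OF n0, symmetric])
      then have "real n ^ 3 * real n powr (real (Suc k) - e) = real n powr (real 3 + (real (Suc k) - e))"
        by (simp only: powr_add)
      also have "real 3 + (real (Suc k) - e) = real k + 4 - e" by simp
      finally show ?thesis unfolding B_def Q_def by (simp only: mult.left_commute)
    qed
    finally have "(\<Sum>xs\<in>T. real (card (N xs)) ^ 3) \<le> 3 * Q + 3 * Q" by simp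
    then show False using lower Q by simp
  qed
  then obtain a b c where abc: "a \<noteq> b" "a \<noteq> c" "b \<noteq> c" "real (card (C a \<inter> C b \<inter> C c)) \<ge> B" by blast
  have "C a \<inter> C b \<inter> C c \<subseteq> {xs. set xs \<subseteq> V \<and> length xs = Suc k}" unfolding C_def T_def by auto
  from Suc.IH[OF this] abc(4)[unfolded B_def e_def] obtain As
    where As: "length As = Suc k" "\<forall>A\<in>set As. card A = 3" "\<forall>xs. list_all2 (\<in>) xs As \<longrightarrow> xs \<in> C a \<inter> C b \<inter> C c"
    by blast
  show ?case
  proof (intro exI[of _ "{a, b, c} # As"] conjI allI impI)
    show "length ({a, b, c} # As) = Suc (Suc k)" using As by simp
    show "\<forall>A\<in>set ({a, b, c} # As). card A = 3" using As abc by simp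
    fix xs assume "list_all2 (\<in>) xs ({a, b, c} # As)"
    then obtain y ys where "xs = y # ys" "y \<in> {a, b, c}" "list_all2 (\<in>) ys As"
      by (auto simp: list_all2_Cons2)
    then show "xs \<in> H" using As(3) unfolding C_def by blast
  qed
qed

text \<open>
  The bound for tuples is applied to all orderings of faces. Orderings have no repetitions, which makes
  the parts disjoint; \<open>g\<close> enumerates part \<open>i\<close> by \<open>3 * i\<close>, \<open>3 * i + 1\<close>, \<open>3 * i + 2\<close>.
\<close>
lemma many_faces_multipartite:
  fixes K :: "'v set set"
  assumes K: "abstract_complex K" and n: "card (\<Union>K) = n" "n \<ge> 1"
    and large: "real (num_faces k K) \<ge> 3 * real n powr (real (Suc k) - 3 powr (- real k))"
  shows "\<exists>g. inj_on g {..<3 * Suc k} \<and>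
    (\<forall>\<sigma>\<subseteq>{..<3 * Suc k}. inj_on (\<lambda>v::nat. v div 3) \<sigma> \<longrightarrow> g ` \<sigma> \<in> K)"
proof -
  have finK: "finite K" "\<And>\<sigma>. \<sigma> \<in> K \<Longrightarrow> finite \<sigma>" and closed: "\<And>\<sigma> \<tau>. \<sigma> \<in> K \<Longrightarrow> \<tau> \<subseteq> \<sigma> \<Longrightarrow> \<tau> \<in> K"
    using K unfolding abstract_complex_def by blast+
  have finV: "finite (\<Union>K)" using finK by blast
  define H where "H = {xs. distinct xs \<and> set xs \<in> K \<and> length xs = Suc k}"
  have Hsub: "H \<subseteq> {xs. set xs \<subseteq> \<Union>K \<and> length xs = Suc k}" unfolding H_def by auto
  have finH: "finite H" using finite_subset[OF Hsub finite_lists_length_eq[OF finV]] .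
  have "{\<sigma>\<in>K. card \<sigma> = k + 1} \<subseteq> set ` H"
  proof
    fix \<sigma> assume s: "\<sigma> \<in> {\<sigma>\<in>K. card \<sigma> = k + 1}"
    then obtain xs where "set xs = \<sigma>" "distinct xs" using finite_distinct_list finK(2) by blast
    then show "\<sigma> \<in> set ` H" using s distinct_card[of xs] unfolding H_def by auto
  qed
  then have "num_faces k K \<le> card H" unfolding num_faces_def by (rule surj_card_le[OF finH])
  then have "real (card H) \<ge> 3 * real n powr (real (Suc k) - 3 powr (- real k))" using large by linarith
  from complete_multipartite_tuples[OF finV n Hsub this] obtain As
    where As: "length As = Suc k" "\<forall>A\<in>set As. card A = 3" "\<And>xs. list_all2 (\<in>) xs As \<Longrightarrow> xs \<in> H" by blast
  have "\<forall>A\<in>set As. \<exists>f. bij_betw f {..<3::nat} A"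
    using As(2) by (metis card.infinite card_lessThan finite_lessThan finite_same_card_bij zero_neq_numeral)
  then obtain F where F: "\<And>A. A \<in> set As \<Longrightarrow> bij_betw (F A) {..<3::nat} A" by metis
  define g where "g = (\<lambda>v. F (As ! (v div 3)) (v mod 3))"
  have g_in: "g v \<in> As ! (v div 3)" if "v < 3 * Suc k" for v
  proof -
    have "v div 3 < length As" using that As(1) by auto
    then show ?thesis unfolding g_def using F[of "As ! (v div 3)"] by (auto simp: bij_betw_def)
  qed
  have transversal: "map (\<lambda>i. g (c i)) [0..<Suc k] \<in> H" if c: "\<And>i. i < Suc k \<Longrightarrow> c i < 3 * Suc k \<and> c i div 3 = i" for c
  proof (rule As(3))
    have "g (c i) \<in> As ! i" if "i < Suc k" for i using g_in[of "c i"] c[OF that] by auto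
    then show "list_all2 (\<in>) (map (\<lambda>i. g (c i)) [0..<Suc k]) As"
      unfolding list_all2_conv_all_nth using As(1) by (auto simp del: upt_Suc)
  qed
  have inj: "inj_on g {..<3 * Suc k}"
  proof (rule inj_onI)
    fix v w assume v: "v \<in> {..<3 * Suc k}" and w: "w \<in> {..<3 * Suc k}" and eq: "g v = g w"
    show "v = w"
    proof (cases "v div 3 = w div 3")
      case True
      have "v div 3 < length As" using v As(1) by auto
      then have "inj_on (F (As ! (v div 3))) {..<3}" using F by (auto simp: bij_betw_def)
      then have "v mod 3 = w mod 3" using eq True unfolding g_def by (auto dest: inj_onD)
      then show ?thesis using True by (metis div_mod_decomp)
    next
      case False
      define c where "c = (\<lambda>i. if i = v div 3 then v else if i = w div 3 then w else 3 * i)"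
      have "map (\<lambda>i. g (c i)) [0..<Suc k] \<in> H"
        by (rule transversal) (use v w in \<open>auto simp: c_def\<close>)
      then have "inj_on (\<lambda>i. g (c i)) {0..<Suc k}" unfolding H_def by (simp add: distinct_map del: upt_Suc)
      moreover have "v div 3 \<in> {0..<Suc k}" "w div 3 \<in> {0..<Suc k}" using v w by auto
      moreover have "g (c (v div 3)) = g (c (w div 3))" using eq False by (simp add: c_def)
      ultimately show ?thesis using False by (metis inj_onD)
    qed
  qed
  have "g ` \<sigma> \<in> K" if \<sigma>: "\<sigma> \<subseteq> {..<3 * Suc k}" "inj_on (\<lambda>v. v div 3) \<sigma>" for \<sigma>
  proof -
    define c where "c = (\<lambda>i. if i \<in> (\<lambda>v. v div 3) ` \<sigma> then the_inv_into \<sigma> (\<lambda>v. v div 3) i else 3 * i)"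
    have c\<sigma>: "c (v div 3) = v" if "v \<in> \<sigma>" for v
      using that the_inv_into_f_f[OF \<sigma>(2) that] unfolding c_def by auto
    have "map (\<lambda>i. g (c i)) [0..<Suc k] \<in> H"
    proof (rule transversal)
      fix i assume "i < Suc k"
      show "c i < 3 * Suc k \<and> c i div 3 = i"
      proof (cases "i \<in> (\<lambda>v. v div 3) ` \<sigma>")
        case True
        then obtain v where "v \<in> \<sigma>" "i = v div 3" by blast
        then show ?thesis using c\<sigma> \<sigma>(1) by auto
      qed (use \<open>i < Suc k\<close> in \<open>simp add: c_def\<close>)
    qed
    then have "set (map (\<lambda>i. g (c i)) [0..<Suc k]) \<in> K" unfolding H_def by blast
    moreover have "g ` \<sigma> \<subseteq> set (map (\<lambda>i. g (c i)) [0..<Suc k])"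
    proof
      fix z assume "z \<in> g ` \<sigma>"
      then obtain v where v: "v \<in> \<sigma>" "z = g v" by blast
      then have "v div 3 \<in> set [0..<Suc k]" using \<sigma>(1) by auto
      then show "z \<in> set (map (\<lambda>i. g (c i)) [0..<Suc k])" using c\<sigma>[OF v(1)] v(2) by (metis (no_types, lifting) imageI list.set_map)
    qed
    ultimately show ?thesis using closed by blast
  qed
  then show ?thesis using inj by blast
qed

section \<open>Complete minors of dense graphs\<close>

definition connected_in :: "('a \<Rightarrow> 'a \<Rightarrow> bool) \<Rightarrow> 'a set \<Rightarrow> bool" where
  "connected_in E B \<longleftrightarrow> (\<forall>x\<in>B. \<forall>y\<in>B. (\<lambda>u v. E u v \<and> u \<in> B \<and> v \<in> B)\<^sup>*\<^sup>* x y)"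

definition adjacent :: "('a \<Rightarrow> 'a \<Rightarrow> bool) \<Rightarrow> 'a set \<Rightarrow> 'a set \<Rightarrow> bool" where
  "adjacent E A B \<longleftrightarrow> (\<exists>a\<in>A. \<exists>b\<in>B. E a b)"

text \<open>
  Contractions are modelled by families of disjoint connected vertex sets: contracting an edge means to
  replace two adjacent members by their union.
\<close>
definition branch_sets :: "('a \<Rightarrow> 'a \<Rightarrow> bool) \<Rightarrow> 'a set set \<Rightarrow> bool" where
  "branch_sets E P \<longleftrightarrow> finite P \<and> {} \<notin> P \<and> disjoint P \<and> (\<forall>B\<in>P. connected_in E B)"

text \<open>
  Each edge between members of \<open>P\<close> is counted in both directions.
\<close>
definition adjacent_pairs :: "('a \<Rightarrow> 'a \<Rightarrow> bool) \<Rightarrow> 'a set set \<Rightarrow> nat" where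
  "adjacent_pairs E P = card {(A, B). A \<in> P \<and> B \<in> P \<and> A \<noteq> B \<and> adjacent E A B}"

text \<open>
  The members of \<open>Q\<close> are built from members of \<open>P\<close>, and each of them contains one; this keeps track of
  adjacency to sets outside of \<open>Q\<close>.
\<close>
definition complete_minor :: "('a \<Rightarrow> 'a \<Rightarrow> bool) \<Rightarrow> nat \<Rightarrow> 'a set set \<Rightarrow> 'a set set \<Rightarrow> bool" where
  "complete_minor E r P Q \<longleftrightarrow> branch_sets E Q \<and> card Q = r \<and>
     (\<forall>A\<in>Q. \<forall>B\<in>Q. A \<noteq> B \<longrightarrow> adjacent E A B) \<and>
     (\<forall>B\<in>Q. B \<subseteq> \<Union>P \<and> (\<exists>A\<in>P. A \<subseteq> B))"

lemma complete_minorD: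
  assumes "complete_minor E r P Q"
  shows "finite Q" "{} \<notin> Q" "card Q = r" "\<And>C. C \<in> Q \<Longrightarrow> connected_in E C"
    "\<And>C D. C \<in> Q \<Longrightarrow> D \<in> Q \<Longrightarrow> C \<noteq> D \<Longrightarrow> C \<inter> D = {}"
    "\<And>C D. C \<in> Q \<Longrightarrow> D \<in> Q \<Longrightarrow> C \<noteq> D \<Longrightarrow> adjacent E C D"
    "\<And>C. C \<in> Q \<Longrightarrow> C \<subseteq> \<Union>P" "\<And>C. C \<in> Q \<Longrightarrow> \<exists>A\<in>P. A \<subseteq> C"
  using assms unfolding complete_minor_def branch_sets_def disjoint_def by simp_all

lemma connected_in_mono:
  assumes "(\<lambda>u v. E u v \<and> u \<in> B \<and> v \<in> B)\<^sup>*\<^sup>* x y" "B \<subseteq> B'"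
  shows "(\<lambda>u v. E u v \<and> u \<in> B' \<and> v \<in> B')\<^sup>*\<^sup>* x y"
  by (rule rtranclp_mono[THEN predicate2D, OF _ assms(1)]) (use assms(2) in auto)

lemma connected_in_Un:
  assumes sym: "\<And>u v. E u v \<Longrightarrow> E v u"
    and A: "connected_in E A" and B: "connected_in E B" and adj: "adjacent E A B"
  shows "connected_in E (A \<union> B)"
proof -
  obtain a b where ab: "a \<in> A" "b \<in> B" "E a b" using adj unfolding adjacent_def by blast
  let ?R = "(\<lambda>u v. E u v \<and> u \<in> A \<union> B \<and> v \<in> A \<union> B)\<^sup>*\<^sup>*"
  have inA: "?R x y" if "x \<in> A" "y \<in> A" for x y
    using A that connected_in_mono[of E A x y "A \<union> B"] unfolding connected_in_def by blast
  have inB: "?R x y" if "x \<in> B" "y \<in> B" for x y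
    using B that connected_in_mono[of E B x y "A \<union> B"] unfolding connected_in_def by blast
  have e: "?R a b" "?R b a" using ab sym by (auto intro!: r_into_rtranclp)
  show ?thesis unfolding connected_in_def
  proof (intro ballI)
    fix x y assume "x \<in> A \<union> B" "y \<in> A \<union> B"
    then consider "x \<in> A" "y \<in> A" | "x \<in> A" "y \<in> B" | "x \<in> B" "y \<in> A" | "x \<in> B" "y \<in> B" by blast
    then show "?R x y"
    proof cases
      case 1 then show ?thesis by (rule inA)
    next
      case 2
      have "?R x a" "?R b y" using inA[OF 2(1) ab(1)] inB[OF ab(2) 2(2)] .
      then show ?thesis using e(1) by (meson rtranclp_trans)
    next
      case 3
      have "?R x b" "?R a y" using inB[OF 3(1) ab(2)] inA[OF ab(1) 3(2)] .
      then show ?thesis using e(2) by (meson rtranclp_trans)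
    next
      case 4 then show ?thesis by (rule inB)
    qed
  qed
qed

lemma adjacent_commute:
  assumes "\<And>u v. E u v \<Longrightarrow> E v u"
  shows "adjacent E A B \<longleftrightarrow> adjacent E B A"
  unfolding adjacent_def using assms by blast

lemma adjacent_Un: "adjacent E D (A \<union> B) \<longleftrightarrow> adjacent E D A \<or> adjacent E D B"
  unfolding adjacent_def by blast

lemma adjacent_pairs_insert:
  assumes sym: "\<And>u v. E u v \<Longrightarrow> E v u" and R: "finite R" "A \<notin> R"
  shows "adjacent_pairs E (insert A R) = adjacent_pairs E R + 2 * card {D\<in>R. adjacent E D A}"
proof -
  define S where "S = {D\<in>R. adjacent E D A}"
  define Z where "Z = {(A, B). A \<in> R \<and> B \<in> R \<and> A \<noteq> B \<and> adjacent E A B}"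
  have finS: "finite S" unfolding S_def using R by simp
  have finZ: "finite Z" unfolding Z_def by (rule finite_subset[of _ "R \<times> R"]) (use R in auto)
  have SR: "A \<notin> S" unfolding S_def using R by simp
  have "{(A', B). A' \<in> insert A R \<and> B \<in> insert A R \<and> A' \<noteq> B \<and> adjacent E A' B} =
     Z \<union> ((\<lambda>D. (D, A)) ` S \<union> (\<lambda>D. (A, D)) ` S)"
    unfolding Z_def S_def using R(2) adjacent_commute[of E, OF sym] by auto
  then have "adjacent_pairs E (insert A R) = card (Z \<union> ((\<lambda>D. (D, A)) ` S \<union> (\<lambda>D. (A, D)) ` S))"
    unfolding adjacent_pairs_def by simp
  also have "\<dots> = card Z + card ((\<lambda>D. (D, A)) ` S \<union> (\<lambda>D. (A, D)) ` S)"
    using finS finZ R by (intro card_Un_disjoint) (auto simp: Z_def)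
  also have "card ((\<lambda>D. (D, A)) ` S \<union> (\<lambda>D. (A, D)) ` S) = card ((\<lambda>D. (D, A)) ` S) + card ((\<lambda>D. (A, D)) ` S)"
    using finS SR by (intro card_Un_disjoint) auto
  also have "\<dots> = 2 * card S" by (simp add: card_image inj_on_def)
  finally show ?thesis unfolding adjacent_pairs_def Z_def S_def .
qed

text \<open>
  Twice the edge density that forces a complete minor of the given order.
\<close>
fun minor_bound :: "nat \<Rightarrow> nat" where
  "minor_bound 0 = 0"
| "minor_bound (Suc r) = (if r = 0 then 0 else 2 * minor_bound r + 2)"

text \<open>
  If some edge of \<open>P\<close> has few common neighbours, then contracting it loses few edges and keeps the density.
  Otherwise every edge has many common neighbours. Then the neighbourhood of a member \<open>A\<close> has large
  minimum degree, so by induction it contains a complete minor of order \<open>r\<close>, to which \<open>A\<close> is added.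
\<close>
lemma complete_minor_exists:
  assumes sym: "\<And>u v. E u v \<Longrightarrow> E v u" and r: "r \<ge> 1"
    and P: "branch_sets E P" and dense: "adjacent_pairs E P > minor_bound r * card P"
  shows "\<exists>Q. complete_minor E r P Q"
  using r P dense
proof (induction r arbitrary: P rule: nat_induct_at_least)
  case base
  then have "P \<noteq> {}" by (auto simp: adjacent_pairs_def)
  then obtain A where A: "A \<in> P" by blast
  then show ?case using base
    by (intro exI[of _ "{A}"]) (auto simp: complete_minor_def branch_sets_def disjoint_def)
next
  case (Suc r)
  note outer = Suc.IH
  have bound: "minor_bound (Suc r) = 2 * minor_bound r + 2" using Suc.hyps by simp
  show ?case using Suc.prems
  proof (induction "card P" arbitrary: P rule: less_induct)
    case less
    have finP: "finite P" and ne: "{} \<notin> P" and disj: "disjoint P" and conn: "\<And>B. B \<in> P \<Longrightarrow> connected_in E B"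
      using less.prems(1) unfolding branch_sets_def by auto
    define common where "common = (\<lambda>A B. {D\<in>P - {A, B}. adjacent E D A \<and> adjacent E D B})"
    show ?case
    proof (cases "\<exists>A\<in>P. \<exists>B\<in>P. A \<noteq> B \<and> adjacent E A B \<and> card (common A B) \<le> minor_bound r")
      case True
      then obtain A B where AB: "A \<in> P" "B \<in> P" "A \<noteq> B" "adjacent E A B" "card (common A B) \<le> minor_bound r" by blast
      define R where "R = P - {A, B}"
      have finR: "finite R" using finP unfolding R_def by simp
      have P_eq: "P = insert A (insert B R)" unfolding R_def using AB by auto
      have ABdisj: "A \<inter> B = {}" using disj AB by (auto simp: disjoint_def)
      have Rdisj: "D \<inter> A = {}" "D \<inter> B = {}" "D \<noteq> {}" if "D \<in> R" for D
        using that disj AB ne unfolding R_def disjoint_def by auto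
      have ABR: "A \<union> B \<notin> R" using Rdisj(1)[of "A \<union> B"] AB(1) ne by auto
      define P' where "P' = insert (A \<union> B) R"
      define nA nB nU where "nA = {D\<in>R. adjacent E D A}" and "nB = {D\<in>R. adjacent E D B}"
        and "nU = {D\<in>R. adjacent E D (A \<union> B)}"
      have fin: "finite nA" "finite nB" using finR by (auto simp: nA_def nB_def)
      have "nU = nA \<union> nB" unfolding nU_def nA_def nB_def adjacent_Un by blast
      moreover have "nA \<inter> nB = common A B" unfolding nA_def nB_def common_def R_def by blast
      ultimately have cU: "card nA + card nB = card nU + card (common A B)"
        using card_Un_Int[OF fin] by simp
      have "adjacent_pairs E P = adjacent_pairs E (insert B R) + 2 * card {D\<in>insert B R. adjacent E D A}"
        unfolding P_eq using finR AB(3) by (intro adjacent_pairs_insert[OF sym]) (auto simp: R_def)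
      also have "{D\<in>insert B R. adjacent E D A} = insert B nA"
        using AB(4) adjacent_commute[of E, OF sym] unfolding nA_def by auto
      also have "card (insert B nA) = Suc (card nA)" using fin by (simp add: nA_def R_def)
      also have "adjacent_pairs E (insert B R) = adjacent_pairs E R + 2 * card nB"
        unfolding nB_def using finR by (intro adjacent_pairs_insert[OF sym]) (auto simp: R_def)
      finally have e1: "adjacent_pairs E P = adjacent_pairs E R + 2 * card nB + 2 * Suc (card nA)" .
      have e2: "adjacent_pairs E P' = adjacent_pairs E R + 2 * card nU"
        unfolding P'_def nU_def by (rule adjacent_pairs_insert[OF sym finR ABR])
      have cP: "card P = card R + 2" unfolding P_eq using finR AB(3) by (simp add: R_def)
      have cP': "card P' = card R + 1" unfolding P'_def using finR ABR by simp
      have "minor_bound (Suc r) * card P < adjacent_pairs E P" using less.prems(2) .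
      then have dense': "adjacent_pairs E P' > minor_bound (Suc r) * card P'"
        using e1 e2 cU AB(5) bound unfolding cP cP' by simp
      have br': "branch_sets E P'"
      proof -
        have RR: "C \<inter> D = {}" if "C \<in> R" "D \<in> R" "C \<noteq> D" for C D
          using that disj unfolding disjoint_def R_def by simp
        have "C \<inter> D = {}" if "C \<in> P'" "D \<in> P'" "C \<noteq> D" for C D
          using that RR[of C D] Rdisj[of C] Rdisj[of D] unfolding P'_def by auto
        then have "disjoint P'" unfolding disjoint_def by blast
        moreover have "connected_in E (A \<union> B)"
          by (rule connected_in_Un[OF sym conn[OF AB(1)] conn[OF AB(2)] AB(4)])
        ultimately show ?thesis unfolding branch_sets_def P'_def using finR ne AB conn by (auto simp: R_def)
      qed
      have "card P' < card P" using cP cP' by simp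
      from less.hyps[OF this br' dense'] obtain Q where Q: "complete_minor E (Suc r) P' Q" ..
      have "\<Union>P' = \<Union>P" unfolding P'_def P_eq by auto
      moreover have "\<exists>D\<in>P. D \<subseteq> C" if "\<exists>D\<in>P'. D \<subseteq> C" for C
        using that AB unfolding P'_def R_def by auto
      ultimately have "complete_minor E (Suc r) P Q" using Q unfolding complete_minor_def by auto
      then show ?thesis by blast
    next
      case False
      have "{(A, B). A \<in> P \<and> B \<in> P \<and> A \<noteq> B \<and> adjacent E A B} \<noteq> {}"
        using less.prems(2) unfolding adjacent_pairs_def by (metis card.empty not_less_zero)
      then obtain A B0 where A: "A \<in> P" "B0 \<in> P" "A \<noteq> B0" "adjacent E A B0" by blast
      define N where "N = {D\<in>P - {A}. adjacent E D A}"
      have finN: "finite N" unfolding N_def using finP by simp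
      have NP: "N \<subseteq> P" unfolding N_def by blast
      have brN: "branch_sets E N"
        unfolding branch_sets_def using NP finN ne conn pairwise_subset[OF disj NP] by blast
      have "B0 \<in> N" unfolding N_def using A adjacent_commute[of E, OF sym] by auto
      then have cN: "card N > 0" using finN card_gt_0_iff by blast
      have deg: "Suc (minor_bound r) \<le> card {D\<in>N. D \<noteq> B \<and> adjacent E B D}" if B: "B \<in> N" for B
      proof -
        have "B \<in> P" "A \<noteq> B" "adjacent E A B" using B adjacent_commute[of E, OF sym] unfolding N_def by auto
        then have "Suc (minor_bound r) \<le> card (common A B)" using False A(1) by (meson not_less_eq_eq)
        also have "common A B = {D\<in>N. D \<noteq> B \<and> adjacent E B D}"
          unfolding common_def N_def using adjacent_commute[of E, OF sym] by auto
        finally show ?thesis .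
      qed
      have "{(A, B). A \<in> N \<and> B \<in> N \<and> A \<noteq> B \<and> adjacent E A B} = Sigma N (\<lambda>B. {D\<in>N. D \<noteq> B \<and> adjacent E B D})" by auto
      then have "adjacent_pairs E N = (\<Sum>B\<in>N. card {D\<in>N. D \<noteq> B \<and> adjacent E B D})"
        unfolding adjacent_pairs_def using finN by simp
      also have "\<dots> \<ge> (\<Sum>B\<in>N. Suc (minor_bound r))" using deg by (intro sum_mono) auto
      finally have "adjacent_pairs E N \<ge> card N * Suc (minor_bound r)" by simp
      then have "adjacent_pairs E N > minor_bound r * card N" using cN by (simp add: mult.commute)
      then obtain Q where Q: "complete_minor E r N Q" using outer[OF brN] by blast
      have Qsub: "C \<inter> A = {}" if "C \<in> Q" for C
      proof -
        have "C \<subseteq> \<Union>N" by (rule complete_minorD(7)[OF Q that])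
        moreover have "D \<inter> A = {}" if "D \<in> N" for D using that disj A(1) unfolding N_def disjoint_def by auto
        ultimately show ?thesis by blast
      qed
      have AQ: "A \<notin> Q" using Qsub[of A] A(1) ne by auto
      have adjQ: "adjacent E C A" if C: "C \<in> Q" for C
      proof -
        obtain D where "D \<in> N" "D \<subseteq> C" using complete_minorD(8)[OF Q C] by blast
        then have "adjacent E D A" "D \<subseteq> C" by (auto simp: N_def)
        then show ?thesis unfolding adjacent_def by blast
      qed
      have "complete_minor E (Suc r) P (insert A Q)"
        unfolding complete_minor_def
      proof (intro conjI ballI impI)
        note Qd = complete_minorD[OF Q]
        have "C \<inter> D = {}" if "C \<in> insert A Q" "D \<in> insert A Q" "C \<noteq> D" for C D
          using that Qd(5)[of C D] Qsub[of C] Qsub[of D] by auto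
        then have "disjoint (insert A Q)" unfolding disjoint_def by blast
        then show "branch_sets E (insert A Q)"
          using Qd(1,2,4) A(1) ne conn unfolding branch_sets_def by auto
        show "card (insert A Q) = Suc r" using Qd(1,3) AQ by simp
        show "adjacent E C D" if "C \<in> insert A Q" "D \<in> insert A Q" "C \<noteq> D" for C D
          using that adjQ[of C] adjQ[of D] Qd(6)[of C D] adjacent_commute[of E A, OF sym] by auto
        show "B \<subseteq> \<Union>P" if "B \<in> insert A Q" for B
          using that A(1) NP Qd(7)[of B] by auto
        show "\<exists>D\<in>P. D \<subseteq> B" if "B \<in> insert A Q" for B
          using that A(1) NP Qd(8)[of B] by auto
      qed
      then show ?thesis by blast
    qed
  qed
qed

text \<open>
  The sum of the edges of a walk, whose inner vertices cancel.
\<close>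
lemma path_chain:
  assumes irr: "\<And>u. \<not> E u u" and fin: "finite J" and BJ: "B \<subseteq> J" and x: "x \<in> B"
    and path: "(\<lambda>u v. E u v \<and> u \<in> B \<and> v \<in> B)\<^sup>*\<^sup>* x y"
  shows "\<exists>c::'a set \<Rightarrow> bit. (\<forall>s. c s \<noteq> 0 \<longrightarrow> (\<exists>u v. s = {u, v} \<and> u \<noteq> v \<and> E u v \<and> u \<in> B \<and> v \<in> B)) \<and>
     (\<forall>t\<subseteq>J. chain_boundary J c t = of_bool (t = {x}) + of_bool (t = {y}))"
  using path
proof (induction rule: rtranclp_induct)
  case base
  show ?case by (rule exI[of _ "\<lambda>_. 0"]) (simp add: chain_boundary_def)
next
  case (step y z)
  then obtain c where c: "\<forall>s. c s \<noteq> 0 \<longrightarrow> (\<exists>u v. s = {u, v} \<and> u \<noteq> v \<and> E u v \<and> u \<in> B \<and> v \<in> B)"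
    "\<forall>t\<subseteq>J. chain_boundary J c t = of_bool (t = {x}) + of_bool (t = {y})" by blast
  have yz: "E y z" "y \<in> B" "z \<in> B" "y \<noteq> z" using step(2) irr by auto
  define d :: "'a set \<Rightarrow> bit" where "d = (\<lambda>s. of_bool (s = {y, z}))"
  have bdd: "chain_boundary J d t = of_bool (t = {y}) + of_bool (t = {z})" if t: "t \<subseteq> J" for t
  proof -
    have "chain_boundary J d t = (\<Sum>j\<in>J - t. of_bool (j = z \<and> t = {y}) + of_bool (j = y \<and> t = {z}))"
      unfolding chain_boundary_def d_def
    proof (intro sum.cong refl)
      fix j assume j: "j \<in> J - t"
      have "insert j t = {y, z} \<longleftrightarrow> j \<in> {y, z} \<and> t = {y, z} - {j}" using j by auto
      also have "\<dots> \<longleftrightarrow> (j = z \<and> t = {y}) \<or> (j = y \<and> t = {z})" using yz(4) by auto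
      finally have "insert j t = {y, z} \<longleftrightarrow> (j = z \<and> t = {y}) \<or> (j = y \<and> t = {z})" .
      then show "of_bool (insert j t = {y, z}) = (of_bool (j = z \<and> t = {y}) + of_bool (j = y \<and> t = {z}) :: bit)"
        using yz(4) by auto
    qed
    also have "\<dots> = (\<Sum>j\<in>J - t. if j = z then of_bool (t = {y}) else 0) + (\<Sum>j\<in>J - t. if j = y then of_bool (t = {z}) else 0)"
      unfolding sum.distrib[symmetric] by (intro sum.cong) auto
    also have "\<dots> = of_bool (t = {y}) + of_bool (t = {z})"
      using fin yz BJ by (auto simp: sum.delta)
    finally show ?thesis .
  qed
  show ?case
  proof (intro exI[of _ "\<lambda>s. c s + d s"] conjI allI impI)
    fix s assume "c s + d s \<noteq> 0"
    then have "c s \<noteq> 0 \<or> s = {y, z}" unfolding d_def by (cases "s = {y, z}") auto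
    then show "\<exists>u v. s = {u, v} \<and> u \<noteq> v \<and> E u v \<and> u \<in> B \<and> v \<in> B" using c(1) yz by blast
  next
    fix t assume t: "t \<subseteq> J"
    have "chain_boundary J (\<lambda>s. c s + d s) t = (of_bool (t = {x}) + of_bool (t = {y})) + (of_bool (t = {y}) + of_bool (t = {z}))"
      using c(2) bdd t by (simp add: chain_boundary_add)
    also have "\<dots> = of_bool (t = {x}) + of_bool (t = {z})"
      by (simp only: add.assoc bit_add_self_left)
    finally show "chain_boundary J (\<lambda>s. c s + d s) t = of_bool (t = {x}) + of_bool (t = {z})" .
  qed
qed

text \<open>
  Vertices go to base points of the branch sets, and an edge goes to a path between two base points inside
  the union of the two branch sets. Disjoint edges of the complete graph then have images with no
  vertex in common.
\<close>
lemma carried_map_complete_minor: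
  assumes irr: "\<And>u. \<not> E u u" and sym: "\<And>u v. E u v \<Longrightarrow> E v u" and fin: "finite J"
    and B: "\<And>i. i < r \<Longrightarrow> B i \<subseteq> J \<and> B i \<noteq> {} \<and> connected_in E (B i)"
    and adj: "\<And>i j. i < r \<Longrightarrow> j < r \<Longrightarrow> i \<noteq> j \<Longrightarrow> adjacent E (B i) (B j)"
    and car: "\<And>i u. i < r \<Longrightarrow> u \<in> B i \<Longrightarrow> car u = {i}"
  shows "\<exists>F. carried_map J car {\<sigma>. \<sigma> \<subseteq> {..<r::nat} \<and> card \<sigma> \<le> 2} F \<and>
    (\<forall>\<sigma> s. \<sigma> \<subseteq> {..<r} \<and> card \<sigma> \<le> 2 \<and> F \<sigma> s \<noteq> 0 \<longrightarrow>
       s = {} \<or> (\<exists>u\<in>J. s = {u} \<and> (\<exists>i<r. u \<in> B i)) \<or> (\<exists>u v. s = {u, v} \<and> u \<in> J \<and> v \<in> J \<and> E u v))"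
proof -
  have "\<forall>i. \<exists>x. i < r \<longrightarrow> x \<in> B i" using B by blast
  then obtain b where b: "\<And>i. i < r \<Longrightarrow> b i \<in> B i" by metis
  define spans where "spans = (\<lambda>i j (c::'a set \<Rightarrow> bit).
     (\<forall>s. c s \<noteq> 0 \<longrightarrow> (\<exists>u v. s = {u, v} \<and> u \<noteq> v \<and> E u v \<and> u \<in> B i \<union> B j \<and> v \<in> B i \<union> B j)) \<and>
     (\<forall>t\<subseteq>J. chain_boundary J c t = of_bool (t = {b i}) + of_bool (t = {b j})))"
  have ex: "\<exists>c. spans i j c" if ij: "i < r" "j < r" "i \<noteq> j" for i j
  proof -
    have "connected_in E (B i \<union> B j)"
      by (rule connected_in_Un[of E, OF sym _ _ adj[OF ij]]) (use B[OF ij(1)] B[OF ij(2)] in auto)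
    moreover have mem: "b i \<in> B i \<union> B j" "b j \<in> B i \<union> B j" using b[OF ij(1)] b[OF ij(2)] by auto
    ultimately have path: "(\<lambda>u v. E u v \<and> u \<in> B i \<union> B j \<and> v \<in> B i \<union> B j)\<^sup>*\<^sup>* (b i) (b j)"
      unfolding connected_in_def by simp
    have "B i \<union> B j \<subseteq> J" using B[OF ij(1)] B[OF ij(2)] by auto
    from path_chain[OF irr fin this mem(1) path] show ?thesis unfolding spans_def .
  qed
  have "\<exists>c. \<exists>i j. i < r \<and> j < r \<and> i \<noteq> j \<and> \<sigma> = {i, j} \<and> spans i j c" if \<sigma>: "\<sigma> \<subseteq> {..<r}" "card \<sigma> = 2" for \<sigma>
  proof -
    obtain i j where ij: "\<sigma> = {i, j}" "i \<noteq> j" using \<sigma>(2) unfolding card_2_iff by blast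
    then have "i < r" "j < r" using \<sigma>(1) by auto
    then show ?thesis using ex[of i j] ij by blast
  qed
  then obtain c where c: "\<And>\<sigma>. \<sigma> \<subseteq> {..<r} \<Longrightarrow> card \<sigma> = 2 \<Longrightarrow>
      \<exists>i j. i < r \<and> j < r \<and> i \<noteq> j \<and> \<sigma> = {i, j} \<and> spans i j (c \<sigma>)" by metis
  define F where "F = (\<lambda>\<sigma> s. if card \<sigma> = 2 then c \<sigma> s else of_bool (s = b ` \<sigma>))"
  have F0: "F {} s = of_bool (s = {})" for s unfolding F_def by simp
  have F1: "F {i} s = of_bool (s = {b i})" for i s unfolding F_def by simp
  have cases: "\<sigma> = {} \<or> (\<exists>i<r. \<sigma> = {i}) \<or> (\<exists>i j. i < r \<and> j < r \<and> i \<noteq> j \<and> \<sigma> = {i, j} \<and> spans i j (F \<sigma>))"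
    if \<sigma>: "\<sigma> \<subseteq> {..<r}" "card \<sigma> \<le> 2" for \<sigma>
  proof -
    have "finite \<sigma>" using \<sigma> finite_subset by blast
    consider "card \<sigma> = 0" | "card \<sigma> = 1" | "card \<sigma> = 2" using \<sigma>(2) by linarith
    then show ?thesis
    proof cases
      case 1 then show ?thesis using \<open>finite \<sigma>\<close> by simp
    next
      case 2
      then obtain i where "\<sigma> = {i}" by (rule card_1_singletonE)
      then show ?thesis using \<sigma> by auto
    next
      case 3
      then have "F \<sigma> = c \<sigma>" unfolding F_def by auto
      then show ?thesis using c[OF \<sigma>(1) 3] by metis
    qed
  qed
  have "carried_map J car {\<sigma>. \<sigma> \<subseteq> {..<r} \<and> card \<sigma> \<le> 2} F"
    unfolding carried_map_def
  proof (intro conjI ballI)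
    show "F {} {} = 1" by (simp add: F0)
  next
    fix \<sigma> assume "\<sigma> \<in> {\<sigma>. \<sigma> \<subseteq> {..<r} \<and> card \<sigma> \<le> 2}"
    then have \<sigma>: "\<sigma> \<subseteq> {..<r}" "card \<sigma> \<le> 2" by auto
    show "\<forall>A. F \<sigma> A \<noteq> 0 \<longrightarrow> A \<subseteq> J \<and> card A = card \<sigma> \<and> (\<forall>p\<in>A. car p \<subseteq> \<sigma>)"
    proof (intro allI impI)
      fix A assume nz: "F \<sigma> A \<noteq> 0"
      from cases[OF \<sigma>] show "A \<subseteq> J \<and> card A = card \<sigma> \<and> (\<forall>p\<in>A. car p \<subseteq> \<sigma>)"
      proof (elim disjE exE conjE)
        assume "\<sigma> = {}"
        then show ?thesis using nz F0[of A] by (cases "A = {}") auto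
      next
        fix i assume i: "i < r" "\<sigma> = {i}"
        then have "A = {b i}" using nz F1[of i A] by (cases "A = {b i}") auto
        then show ?thesis using i b[OF i(1)] B[OF i(1)] car[OF i(1) b[OF i(1)]] by auto
      next
        fix i j assume ij: "i < r" "j < r" "i \<noteq> j" "\<sigma> = {i, j}" "spans i j (F \<sigma>)"
        then obtain u v where uv: "A = {u, v}" "u \<noteq> v" "u \<in> B i \<union> B j" "v \<in> B i \<union> B j"
          using nz unfolding spans_def by blast
        then have "car u \<subseteq> \<sigma>" "car v \<subseteq> \<sigma>" "u \<in> J" "v \<in> J" using car[OF ij(1)] car[OF ij(2)] B[OF ij(1)] B[OF ij(2)] ij(4) by auto
        then show ?thesis using uv ij by auto
      qed
    qed
    show "chain_boundary J (F \<sigma>) t = (\<Sum>v\<in>\<sigma>. F (\<sigma> - {v}) t)" if "t \<in> Pow J" for t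
    proof -
      have t: "t \<subseteq> J" using that by blast
      from cases[OF \<sigma>] show "chain_boundary J (F \<sigma>) t = (\<Sum>v\<in>\<sigma>. F (\<sigma> - {v}) t)"
      proof (elim disjE exE conjE)
        assume s: "\<sigma> = {}"
        have "chain_boundary J (F {}) t = 0" unfolding chain_boundary_def by (rule sum.neutral) (simp add: F0)
        then show ?thesis using s by simp
      next
        fix i assume i: "i < r" "\<sigma> = {i}"
        have "chain_boundary J (F {i}) t = (\<Sum>j\<in>J - t. if j = b i then of_bool (t = {}) else 0)"
          unfolding chain_boundary_def F1 by (intro sum.cong) auto
        also have "\<dots> = of_bool (t = {})" using fin b[OF i(1)] B[OF i(1)] by (auto simp: sum.delta)
        finally show ?thesis using i by (simp add: F0)
      next
        fix i j assume ij: "i < r" "j < r" "i \<noteq> j" "\<sigma> = {i, j}" "spans i j (F \<sigma>)"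
        then have "chain_boundary J (F \<sigma>) t = of_bool (t = {b i}) + of_bool (t = {b j})" using t unfolding spans_def by blast
        moreover have "{i, j} - {i} = {j}" "{i, j} - {j} = {i}" using ij(3) by auto
        ultimately show ?thesis using ij(3,4) by (simp add: F1 add.commute)
      qed
    qed
  qed
  moreover have "s = {} \<or> (\<exists>u\<in>J. s = {u} \<and> (\<exists>i<r. u \<in> B i)) \<or> (\<exists>u v. s = {u, v} \<and> u \<in> J \<and> v \<in> J \<and> E u v)"
    if as: "\<sigma> \<subseteq> {..<r}" "card \<sigma> \<le> 2" "F \<sigma> s \<noteq> 0" for \<sigma> s
    using cases[OF as(1,2)]
  proof (elim disjE exE conjE)
    assume "\<sigma> = {}"
    then show ?thesis using as(3) F0[of s] by (cases "s = {}") auto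
  next
    fix i assume i: "i < r" "\<sigma> = {i}"
    then have "s = {b i}" using as(3) F1[of i s] by (cases "s = {b i}") auto
    then show ?thesis using b[OF i(1)] B[OF i(1)] i(1) by auto
  next
    fix i j assume ij: "i < r" "j < r" "i \<noteq> j" "\<sigma> = {i, j}" "spans i j (F \<sigma>)"
    then obtain u v where "s = {u, v}" "E u v" "u \<in> B i \<union> B j" "v \<in> B i \<union> B j"
      using as(3) unfolding spans_def by blast
    then show ?thesis using B[OF ij(1)] B[OF ij(2)] by blast
  qed
  ultimately show ?thesis by blast
qed

text \<open>
  The Leibniz rule for joins: the boundary of a simplex \<open>s\<close> splits into the part that removes points of
  \<open>W\<close>, handled by \<open>F\<close>, and the part that removes points of \<open>\<rho>\<close>, which \<open>h\<close> matches with vertices of \<open>S\<close>.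
\<close>
lemma carried_map_join:
  assumes lk: "carried_map W car X0 F" and h: "bij_betw h S \<rho>" and WR: "W \<inter> \<rho> = {}"
    and fin: "finite W" "finite \<rho>" and finX: "\<And>\<sigma>. \<sigma> \<in> X \<Longrightarrow> finite \<sigma>"
    and X: "\<And>\<sigma>. \<sigma> \<in> X \<Longrightarrow> \<sigma> - S \<in> X0"
    and car: "\<And>x. x \<in> S \<Longrightarrow> car (h x) = {x}"
    and suppF: "\<And>\<sigma> s. \<sigma> \<in> X0 \<Longrightarrow> F \<sigma> s \<noteq> 0 \<Longrightarrow> s \<subseteq> W"
  defines "G \<equiv> \<lambda>\<sigma> s. if s \<subseteq> W \<union> \<rho> \<and> h ` (\<sigma> \<inter> S) = s \<inter> \<rho> then F (\<sigma> - S) (s - \<rho>) else 0"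
  shows "carried_map (W \<union> \<rho>) car X G"
  unfolding carried_map_def
proof (intro conjI ballI allI impI)
  show "G {} {} = 1" using lk by (simp add: G_def carried_map_def)
next
  fix \<sigma> s assume \<sigma>: "\<sigma> \<in> X" and nz: "G \<sigma> s \<noteq> 0"
  have s: "s \<subseteq> W \<union> \<rho>" "h ` (\<sigma> \<inter> S) = s \<inter> \<rho>" "F (\<sigma> - S) (s - \<rho>) \<noteq> 0"
    using nz unfolding G_def by (auto split: if_split_asm)
  note c = carried_mapD[OF lk X[OF \<sigma>] s(3)]
  have fins: "finite s" using s(1) fin finite_subset by blast
  have inj: "inj_on h (\<sigma> \<inter> S)" using h by (meson bij_betw_def inf_le2 inj_on_subset)
  have "card s = card (s - \<rho>) + card (s \<inter> \<rho>)"
    using card_Diff_subset_Int[of s \<rho>] card_mono[of s "s \<inter> \<rho>"] fins by simp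
  also have "card (s \<inter> \<rho>) = card (\<sigma> \<inter> S)" using card_image[OF inj] s(2) by simp
  also have "card (s - \<rho>) = card (\<sigma> - S)" by (rule c(2))
  also have "card (\<sigma> - S) + card (\<sigma> \<inter> S) = card \<sigma>"
    using card_Diff_subset_Int[of \<sigma> S] card_mono[of \<sigma> "\<sigma> \<inter> S"] finX[OF \<sigma>] by simp
  finally show "card s = card \<sigma>" .
  show "s \<subseteq> W \<union> \<rho>" by (rule s(1))
  fix p assume p: "p \<in> s"
  show "car p \<subseteq> \<sigma>"
  proof (cases "p \<in> \<rho>")
    case True
    then obtain x where "x \<in> \<sigma> \<inter> S" "p = h x" using p s(2) by blast
    then show ?thesis using car by auto
  next
    case False
    then show ?thesis using c(3)[of p] p by blast
  qed
next
  fix \<sigma> t assume \<sigma>: "\<sigma> \<in> X" and "t \<in> Pow (W \<union> \<rho>)"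
  then have t: "t \<subseteq> W \<union> \<rho>" by blast
  have fin\<sigma>: "finite \<sigma>" using finX[OF \<sigma>] .
  define T where "T = h ` (\<sigma> \<inter> S)"
  have Trho: "T \<subseteq> \<rho>" unfolding T_def using h by (auto simp: bij_betw_def)
  have injS: "inj_on h S" using h by (simp add: bij_betw_def)
  have "chain_boundary (W \<union> \<rho>) (G \<sigma>) t = (\<Sum>j\<in>W - t. G \<sigma> (insert j t)) + (\<Sum>j\<in>\<rho> - t. G \<sigma> (insert j t))"
    unfolding chain_boundary_def Un_Diff using fin WR by (intro sum.union_disjoint) auto
  also have "(\<Sum>j\<in>W - t. G \<sigma> (insert j t)) = (\<Sum>j\<in>W - (t - \<rho>). if T = t \<inter> \<rho> then F (\<sigma> - S) (insert j (t - \<rho>)) else 0)"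
  proof (rule sum.cong)
    show "W - t = W - (t - \<rho>)" using WR by auto
    fix j assume j: "j \<in> W - (t - \<rho>)"
    have "insert j t - \<rho> = insert j (t - \<rho>)" "insert j t \<inter> \<rho> = t \<inter> \<rho>" "insert j t \<subseteq> W \<union> \<rho>" using j WR t by auto
    then show "G \<sigma> (insert j t) = (if T = t \<inter> \<rho> then F (\<sigma> - S) (insert j (t - \<rho>)) else 0)"
      unfolding G_def T_def by simp
  qed
  also have "\<dots> = (if T = t \<inter> \<rho> then \<Sum>v\<in>\<sigma> - S. F (\<sigma> - S - {v}) (t - \<rho>) else 0)"
    using carried_map_boundary[OF lk X[OF \<sigma>], of "t - \<rho>"] t by (auto simp: chain_boundary_def)
  also have "\<dots> = (\<Sum>v\<in>\<sigma> - S. G (\<sigma> - {v}) t)"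
  proof -
    have "G (\<sigma> - {v}) t = (if T = t \<inter> \<rho> then F (\<sigma> - S - {v}) (t - \<rho>) else 0)" if "v \<in> \<sigma> - S" for v
    proof -
      have "\<sigma> - {v} - S = \<sigma> - S - {v}" "(\<sigma> - {v}) \<inter> S = \<sigma> \<inter> S" using that by auto
      then show ?thesis unfolding G_def T_def using t by simp
    qed
    then show ?thesis by simp
  qed
  also have "(\<Sum>j\<in>\<rho> - t. G \<sigma> (insert j t)) = (\<Sum>j\<in>\<rho> - t. if T = insert j (t \<inter> \<rho>) then F (\<sigma> - S) (t - \<rho>) else 0)"
  proof (intro sum.cong refl)
    fix j assume j: "j \<in> \<rho> - t"
    have "insert j t - \<rho> = t - \<rho>" "insert j t \<inter> \<rho> = insert j (t \<inter> \<rho>)" "insert j t \<subseteq> W \<union> \<rho>" using j t by auto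
    then show "G \<sigma> (insert j t) = (if T = insert j (t \<inter> \<rho>) then F (\<sigma> - S) (t - \<rho>) else 0)"
      unfolding G_def T_def by simp
  qed
  also have "\<dots> = (\<Sum>j\<in>T. if T - {j} = t \<inter> \<rho> then F (\<sigma> - S) (t - \<rho>) else 0)"
  proof (rule sum.mono_neutral_cong)
    show "finite (\<rho> - t)" "finite T" using fin Trho finite_subset by auto
    show "(if T = insert i (t \<inter> \<rho>) then F (\<sigma> - S) (t - \<rho>) else 0) = 0" if "i \<in> \<rho> - t - T" for i
      using that by auto
    show "(if T - {i} = t \<inter> \<rho> then F (\<sigma> - S) (t - \<rho>) else 0) = 0" if "i \<in> T - (\<rho> - t)" for i
    proof -
      have "i \<in> t \<inter> \<rho>" using that Trho by blast
      then have "T - {i} \<noteq> t \<inter> \<rho>" by blast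
      then show ?thesis by simp
    qed
    show "(if T = insert x (t \<inter> \<rho>) then F (\<sigma> - S) (t - \<rho>) else 0) = (if T - {x} = t \<inter> \<rho> then F (\<sigma> - S) (t - \<rho>) else 0)"
      if "x \<in> (\<rho> - t) \<inter> T" for x
    proof -
      have "T = insert x (t \<inter> \<rho>) \<longleftrightarrow> T - {x} = t \<inter> \<rho>" using that by blast
      then show ?thesis by simp
    qed
  qed
  also have "\<dots> = (\<Sum>v\<in>\<sigma> \<inter> S. if T - {h v} = t \<inter> \<rho> then F (\<sigma> - S) (t - \<rho>) else 0)"
    unfolding T_def using inj_on_subset[OF injS, of "\<sigma> \<inter> S"] by (subst sum.reindex) auto
  also have "\<dots> = (\<Sum>v\<in>\<sigma> \<inter> S. G (\<sigma> - {v}) t)"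
  proof (intro sum.cong refl)
    fix v assume v: "v \<in> \<sigma> \<inter> S"
    have "\<sigma> - {v} - S = \<sigma> - S" using v by auto
    moreover have "h ` ((\<sigma> - {v}) \<inter> S) = T - {h v}"
      unfolding T_def using v injS by (auto dest: inj_onD)
    ultimately show "(if T - {h v} = t \<inter> \<rho> then F (\<sigma> - S) (t - \<rho>) else 0) = G (\<sigma> - {v}) t"
      unfolding G_def using t by simp
  qed
  also have "(\<Sum>v\<in>\<sigma> - S. G (\<sigma> - {v}) t) + (\<Sum>v\<in>\<sigma> \<inter> S. G (\<sigma> - {v}) t) = (\<Sum>v\<in>\<sigma>. G (\<sigma> - {v}) t)"
    using fin\<sigma> sum.Int_Diff[of \<sigma> "\<lambda>v. G (\<sigma> - {v}) t" S] by (simp add: add.commute)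
  finally show "chain_boundary (W \<union> \<rho>) (G \<sigma>) t = (\<Sum>v\<in>\<sigma>. G (\<sigma> - {v}) t)" .
qed

section \<open>Counting faces\<close>

text \<open>
  The complete multipartite complex with \<open>m + 1\<close> triples is the obstruction for \<open>\<real>\<^sup>2\<^sup>m\<close>. In
  \<open>\<real>\<^sup>2\<^sup>m\<^sup>-\<^sup>1\<close> it suffices to keep one vertex of the last triple, that is, \<open>a = m\<close> and \<open>r = 1\<close>.
\<close>
lemma sparse_middle_faces:
  fixes K :: "nat set set"
  assumes K: "abstract_complex K" and PL: "PL_embeddable TYPE(real ^ 'k) K"
    and dim: "CARD('k::finite) + 2 = 2 * m + 1 \<or> CARD('k) = 2 * m" and m: "m \<ge> 1"
    and n: "card (\<Union>K) = n" "n \<ge> 1"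
  shows "real (num_faces m K) \<le> 3 * real n powr (real (Suc m) - 3 powr (- real m))"
proof (rule ccontr)
  assume "\<not> ?thesis"
  then have "real (num_faces m K) \<ge> 3 * real n powr (real (Suc m) - 3 powr (- real m))" by simp
  from many_faces_multipartite[OF K n this] obtain g
    where g: "inj_on g {..<3 * Suc m}" "\<And>\<sigma>. \<sigma> \<subseteq> {..<3 * Suc m} \<Longrightarrow> inj_on (\<lambda>v::nat. v div 3) \<sigma> \<Longrightarrow> g ` \<sigma> \<in> K"
    by blast
  obtain a r where ar: "a \<ge> 1" "CARD('k) + 2 = 2 * a + r" "3 * a + r \<le> 3 * Suc m" "a = m + 1 \<and> r = 0 \<or> a = m \<and> r = 1"
  proof (cases "CARD('k) = 2 * m")
    case True then show ?thesis using that[of "m + 1" 0] by simp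
  next
    case False then show ?thesis using that[of m 1] dim m by simp
  qed
  have gK: "g ` \<sigma> \<in> K" if \<sigma>: "\<sigma> \<in> flores a r" for \<sigma>
  proof (rule g(2))
    show "\<sigma> \<subseteq> {..<3 * Suc m}" using \<sigma> ar(3) by (auto simp: flores_def)
    have "vertex_class a v = v div 3" if "v \<in> \<sigma>" for v
    proof -
      have "v < 3 * a + r" using that \<sigma> by (auto simp: flores_def)
      then show ?thesis using ar(4) by (auto simp: vertex_class_def)
    qed
    then show "inj_on (\<lambda>v. v div 3) \<sigma>" using \<sigma> unfolding flores_def by (auto simp: inj_on_def)
  qed
  define V where "V = {..<3 * a + r}"
  have injV: "inj_on g V" unfolding V_def by (rule inj_on_subset[OF g(1)]) (use ar(3) in auto)
  have gV: "g ` V \<subseteq> \<Union>K"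
  proof
    fix z assume "z \<in> g ` V"
    then obtain v where v: "v \<in> V" "z = g v" by blast
    have "{v} \<in> flores a r" using v by (auto simp: flores_def V_def)
    then have "g ` {v} \<in> K" by (rule gK)
    then show "z \<in> \<Union>K" using v by auto
  qed
  define \<kappa> where "\<kappa> = (\<lambda>u. if u \<in> g ` V then {the_inv_into V g u} else {0})"
  have finK: "finite (\<Union>K)" using K unfolding abstract_complex_def by blast
  have "carried_map (\<Union>K) \<kappa> (flores a r) (\<lambda>\<sigma> A. of_bool (A = g ` \<sigma>))"
  proof (rule carried_map_vertex_map[where V = V, OF finK _ gV injV])
    show "finite \<sigma> \<and> \<sigma> \<subseteq> V" if "\<sigma> \<in> flores a r" for \<sigma>
      using that finite_flores[OF that] by (auto simp: flores_def V_def)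
    show "\<kappa> (g v) = {v}" if "v \<in> V" for v
      using that by (simp add: \<kappa>_def the_inv_into_f_f[OF injV that])
  qed
  then show False
    by (rule no_carried_map_from_flores[OF ar(1,2) K PL]) (use gK in \<open>auto simp: \<kappa>_def\<close>)
qed

text \<open>
  A minor \<open>K_6\<close> of the link of \<open>\<rho>\<close> contains \<open>K_{3,3}\<close>, whose join with \<open>\<rho>\<close> is the obstruction for \<open>a = 2\<close>.
\<close>
lemma link_sparse:
  fixes K :: "nat set set"
  assumes K: "abstract_complex K" and PL: "PL_embeddable TYPE(real ^ 'k) K"
    and dim: "CARD('k::finite) = card \<rho> + 2" and \<rho>: "\<rho> \<in> K"
  defines "W \<equiv> {v. v \<notin> \<rho> \<and> insert v \<rho> \<in> K}"
    and "E \<equiv> (\<lambda>u v. u \<noteq> v \<and> u \<notin> \<rho> \<and> v \<notin> \<rho> \<and> insert u (insert v \<rho>) \<in> K)"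
  shows "adjacent_pairs E ((\<lambda>v. {v}) ` W) \<le> minor_bound 6 * card W"
proof (rule ccontr)
  assume dense: "\<not> ?thesis"
  have finK: "finite (\<Union>K)" and closed: "\<And>\<sigma> \<tau>. \<sigma> \<in> K \<Longrightarrow> \<tau> \<subseteq> \<sigma> \<Longrightarrow> \<tau> \<in> K"
    using K unfolding abstract_complex_def by blast+
  have WK: "W \<subseteq> \<Union>K" unfolding W_def by blast
  have finW: "finite W" using WK finK finite_subset by blast
  have fin\<rho>: "finite \<rho>" using \<rho> K unfolding abstract_complex_def by blast
  have sym: "E u v \<Longrightarrow> E v u" for u v unfolding E_def by (auto simp: insert_commute)
  have irr: "\<not> E u u" for u unfolding E_def by simp
  define P where "P = (\<lambda>v. {v}) ` W"
  have cP: "card P = card W" unfolding P_def by (simp add: card_image)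
  have "branch_sets E P" unfolding branch_sets_def P_def connected_in_def disjoint_def using finW by auto
  moreover have "adjacent_pairs E P > minor_bound 6 * card P" using dense unfolding P_def[symmetric] by (simp add: cP not_le)
  moreover have "(6::nat) \<ge> 1" by simp
  ultimately obtain Q where Q: "complete_minor E 6 P Q" using complete_minor_exists[of E 6 P, OF sym] by blast
  have finQ: "finite Q" and cQ: "card Q = 6" using Q unfolding complete_minor_def branch_sets_def by auto
  obtain B where B: "bij_betw B {..<6::nat} Q"
    using finite_same_card_bij[of "{..<6::nat}" Q] finQ cQ by auto
  have BQ: "B i \<in> Q" if "i < 6" for i using B that by (auto simp: bij_betw_def)
  have UP: "\<Union>P = W" unfolding P_def by auto
  have Bprop: "B i \<subseteq> W \<and> B i \<noteq> {} \<and> connected_in E (B i)" if "i < 6" for i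
    using BQ[OF that] complete_minorD(2)[OF Q] complete_minorD(4)[OF Q BQ[OF that]]
      complete_minorD(7)[OF Q BQ[OF that]] unfolding UP by auto
  have Bneq: "B i \<noteq> B j" if "i < 6" "j < 6" "i \<noteq> j" for i j
    using B that by (auto simp: bij_betw_def inj_on_def)
  have Badj: "adjacent E (B i) (B j)" if "i < 6" "j < 6" "i \<noteq> j" for i j
    by (rule complete_minorD(6)[OF Q BQ[OF that(1)] BQ[OF that(2)] Bneq[OF that]])
  have Bdisj: "B i \<inter> B j = {}" if "i < 6" "j < 6" "i \<noteq> j" for i j
    by (rule complete_minorD(5)[OF Q BQ[OF that(1)] BQ[OF that(2)] Bneq[OF that]])
  define r where "r = card \<rho>"
  define S where "S = {6..<6 + r}"
  obtain h where h: "bij_betw h S \<rho>"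
    using finite_same_card_bij[of S \<rho>] fin\<rho> unfolding S_def r_def by auto
  \<comment> \<open>Vertices outside of \<open>\<rho>\<close> and of the branch sets occur in no image; they get an arbitrary nonempty label.\<close>
  define \<kappa> where "\<kappa> = (\<lambda>u. if \<exists>i<6. u \<in> B i then {THE i. i < 6 \<and> u \<in> B i}
      else if u \<in> \<rho> then {the_inv_into S h u} else {0})"
  have \<kappa>B: "\<kappa> u = {i}" if "i < 6" "u \<in> B i" for i u
  proof -
    have "(THE i. i < 6 \<and> u \<in> B i) = i" using that Bdisj by (intro the_equality) blast+
    then show ?thesis using that unfolding \<kappa>_def by auto
  qed
  have W\<rho>: "W \<inter> \<rho> = {}" unfolding W_def by blast
  have \<kappa>h: "\<kappa> (h x) = {x}" if "x \<in> S" for x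
  proof -
    have hx: "h x \<in> \<rho>" and inj: "inj_on h S" using h that by (auto simp: bij_betw_def)
    then have no: "\<not> (\<exists>i<6. h x \<in> B i)" using Bprop W\<rho> by blast
    show ?thesis unfolding \<kappa>_def if_not_P[OF no] if_P[OF hx] the_inv_into_f_f[OF inj that] ..
  qed
  define X0 where "X0 = {\<sigma>. \<sigma> \<subseteq> {..<6::nat} \<and> card \<sigma> \<le> 2}"
  have "\<exists>F. carried_map W \<kappa> {\<sigma>. \<sigma> \<subseteq> {..<6} \<and> card \<sigma> \<le> 2} F \<and>
    (\<forall>\<sigma> s. \<sigma> \<subseteq> {..<6} \<and> card \<sigma> \<le> 2 \<and> F \<sigma> s \<noteq> 0 \<longrightarrow>
       s = {} \<or> (\<exists>u\<in>W. s = {u} \<and> (\<exists>i<6. u \<in> B i)) \<or> (\<exists>u v. s = {u, v} \<and> u \<in> W \<and> v \<in> W \<and> E u v))"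
  proof (rule carried_map_complete_minor[of E W 6 B \<kappa>])
    show "\<not> E u u" for u by (rule irr)
    show "E v u" if "E u v" for u v using that by (rule sym)
    show "finite W" by (rule finW)
    show "B i \<subseteq> W \<and> B i \<noteq> {} \<and> connected_in E (B i)" if "i < 6" for i using that by (rule Bprop)
    show "adjacent E (B i) (B j)" if "i < 6" "j < 6" "i \<noteq> j" for i j using that by (rule Badj)
    show "\<kappa> u = {i}" if "i < 6" "u \<in> B i" for i u using that by (rule \<kappa>B)
  qed
  then obtain F where F: "carried_map W \<kappa> X0 F" and Fs0: "\<forall>\<sigma> s. \<sigma> \<subseteq> {..<6} \<and> card \<sigma> \<le> 2 \<and> F \<sigma> s \<noteq> 0 \<longrightarrow>
       s = {} \<or> (\<exists>u\<in>W. s = {u} \<and> (\<exists>i<6. u \<in> B i)) \<or> (\<exists>u v. s = {u, v} \<and> u \<in> W \<and> v \<in> W \<and> E u v)"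
    unfolding X0_def by (elim exE conjE)
  have Fs: "s = {} \<or> (\<exists>u\<in>W. s = {u} \<and> (\<exists>i<6. u \<in> B i)) \<or> (\<exists>u v. s = {u, v} \<and> u \<in> W \<and> v \<in> W \<and> E u v)"
    if "\<sigma> \<in> X0" "F \<sigma> s \<noteq> 0" for \<sigma> s
  proof -
    have "\<sigma> \<subseteq> {..<6} \<and> card \<sigma> \<le> 2 \<and> F \<sigma> s \<noteq> 0" using that by (simp add: X0_def)
    then show ?thesis using Fs0 by blast
  qed
  define G where "G = (\<lambda>\<sigma> s. if s \<subseteq> W \<union> \<rho> \<and> h ` (\<sigma> \<inter> S) = s \<inter> \<rho> then F (\<sigma> - S) (s - \<rho>) else 0)"
  have X0: "\<sigma> - S \<in> X0" if "\<sigma> \<in> flores 2 r" for \<sigma>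
  proof -
    have sub: "\<sigma> - S \<subseteq> {..<6}" using that by (auto simp: flores_def S_def)
    have "card (\<sigma> - S) = card (vertex_class 2 ` (\<sigma> - S))"
      using that unfolding flores_def by (intro card_image[symmetric]) (auto intro: inj_on_subset)
    also have "\<dots> \<le> card {..<2::nat}"
      using sub by (intro card_mono) (auto simp: vertex_class_def)
    finally show ?thesis unfolding X0_def using sub by simp
  qed
  have G1: "carried_map (W \<union> \<rho>) \<kappa> (flores 2 r) G"
    unfolding G_def
  proof (rule carried_map_join[OF F h W\<rho> finW fin\<rho> _ X0 \<kappa>h])
    show "finite \<sigma>" if "\<sigma> \<in> flores 2 r" for \<sigma> using that finite_flores by blast
    show "s \<subseteq> W" if "\<sigma> \<in> X0" "F \<sigma> s \<noteq> 0" for \<sigma> s using carried_mapD(1)[OF F that] .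
  qed auto
  have W\<rho>K: "W \<union> \<rho> \<subseteq> \<Union>K" using WK \<rho> by blast
  have "carried_map (\<Union>K) \<kappa> (flores 2 r) G"
    by (rule carried_map_extend[OF G1 W\<rho>K finK]) (auto intro: flores_subset)
  moreover have "s \<in> K" if \<sigma>: "\<sigma> \<in> flores 2 r" and nz: "G \<sigma> s \<noteq> 0" for \<sigma> s
  proof -
    have s: "F (\<sigma> - S) (s - \<rho>) \<noteq> 0" using nz unfolding G_def by (auto split: if_split_asm)
    have "s \<subseteq> \<rho> \<or> (\<exists>u\<in>W. s \<subseteq> insert u \<rho>) \<or> (\<exists>u v. s \<subseteq> insert u (insert v \<rho>) \<and> E u v)"
      using Fs[OF X0[OF \<sigma>] s] by blast
    then show ?thesis using closed \<rho> unfolding W_def E_def by blast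
  qed
  moreover have "\<kappa> u \<noteq> {}" for u unfolding \<kappa>_def by simp
  moreover have "CARD('k) + 2 = 2 * 2 + r" using dim by (simp add: r_def)
  moreover have "(2::nat) \<ge> 1" by simp
  ultimately show False using no_carried_map_from_flores[OF _ _ K PL] by blast
qed

text \<open>
  A \<open>d\<close>-face containing a \<open>(d - 2)\<close>-face \<open>\<rho>\<close> is an edge of the link of \<open>\<rho>\<close>, and a vertex of the link is a
  \<open>(d - 1)\<close>-face containing \<open>\<rho>\<close>. The estimate for links is summed over all \<open>\<rho>\<close>.
\<close>
lemma num_faces_codim1:
  fixes K :: "nat set set"
  assumes K: "abstract_complex K" and PL: "PL_embeddable TYPE(real ^ 'k) K"
    and dim: "CARD('k::finite) = d + 1" and d: "d \<ge> 1"
  shows "num_faces d K \<le> minor_bound 6 * d * num_faces (d - 1) K"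
proof -
  have finK: "finite K" and finf: "\<And>\<sigma>. \<sigma> \<in> K \<Longrightarrow> finite \<sigma>" and closed: "\<And>\<sigma> \<tau>. \<sigma> \<in> K \<Longrightarrow> \<tau> \<subseteq> \<sigma> \<Longrightarrow> \<tau> \<in> K"
    using K unfolding abstract_complex_def by blast+
  define R where "R = {\<rho>\<in>K. card \<rho> = d - 1}"
  define W where "W = (\<lambda>\<rho>. {v. v \<notin> \<rho> \<and> insert v \<rho> \<in> K})"
  define E where "E = (\<lambda>\<rho> u v. u \<noteq> v \<and> u \<notin> \<rho> \<and> v \<notin> \<rho> \<and> insert u (insert v \<rho>) \<in> K)"
  define top where "top = {\<sigma>\<in>K. card \<sigma> = d + 1}"
  have finR: "finite R" unfolding R_def using finK by simp
  have finW: "finite (W \<rho>)" for \<rho>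
  proof (rule finite_subset)
    show "W \<rho> \<subseteq> \<Union>K" unfolding W_def by blast
    show "finite (\<Union>K)" using finK finf by blast
  qed
  have link: "card {\<sigma>\<in>top. \<rho> \<subseteq> \<sigma>} \<le> minor_bound 6 * card (W \<rho>)" if \<rho>: "\<rho> \<in> R" for \<rho>
  proof -
    define A where "A = {(A, B). A \<in> (\<lambda>v. {v}) ` W \<rho> \<and> B \<in> (\<lambda>v. {v}) ` W \<rho> \<and> A \<noteq> B \<and> adjacent (E \<rho>) A B}"
    have finA: "finite A" unfolding A_def
      by (rule finite_subset[of _ "((\<lambda>v. {v}) ` W \<rho>) \<times> ((\<lambda>v. {v}) ` W \<rho>)"]) (use finW in auto)
    have "{\<sigma>\<in>top. \<rho> \<subseteq> \<sigma>} \<subseteq> (\<lambda>(A, B). \<rho> \<union> A \<union> B) ` A"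
    proof
      fix \<sigma> assume "\<sigma> \<in> {\<sigma>\<in>top. \<rho> \<subseteq> \<sigma>}"
      then have \<sigma>: "\<sigma> \<in> K" "card \<sigma> = d + 1" "\<rho> \<subseteq> \<sigma>" unfolding top_def by auto
      have "card (\<sigma> - \<rho>) = 2" using \<sigma> \<rho> d finf unfolding R_def by (simp add: card_Diff_subset)
      then obtain u v where uv: "\<sigma> - \<rho> = {u, v}" "u \<noteq> v" unfolding card_2_iff by blast
      then have \<sigma>_eq: "\<sigma> = insert u (insert v \<rho>)" using \<sigma>(3) by blast
      have "insert u \<rho> \<in> K" "insert v \<rho> \<in> K" using closed[OF \<sigma>(1)] unfolding \<sigma>_eq by blast+
      moreover have "u \<notin> \<rho>" "v \<notin> \<rho>" using uv by blast+
      ultimately have "({u}, {v}) \<in> A" using \<sigma>(1) uv(2) unfolding A_def W_def E_def adjacent_def \<sigma>_eq by auto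
      moreover have "\<sigma> = \<rho> \<union> {u} \<union> {v}" unfolding \<sigma>_eq by blast
      ultimately show "\<sigma> \<in> (\<lambda>(A, B). \<rho> \<union> A \<union> B) ` A" by (metis (mono_tags, lifting) case_prod_conv image_eqI)
    qed
    then have "card {\<sigma>\<in>top. \<rho> \<subseteq> \<sigma>} \<le> card A" by (rule surj_card_le[OF finA])
    also have "card A = adjacent_pairs (E \<rho>) ((\<lambda>v. {v}) ` W \<rho>)" unfolding A_def adjacent_pairs_def ..
    also have "\<dots> \<le> minor_bound 6 * card (W \<rho>)"
      unfolding W_def E_def
      by (rule link_sparse[OF K PL]) (use \<rho> dim d in \<open>auto simp: R_def\<close>)
    finally show ?thesis .
  qed
  have "top \<subseteq> (\<Union>\<rho>\<in>R. {\<sigma>\<in>top. \<rho> \<subseteq> \<sigma>})"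
  proof
    fix \<sigma> assume \<sigma>: "\<sigma> \<in> top"
    then have "d - 1 \<le> card \<sigma>" by (simp add: top_def)
    then obtain \<rho> where "\<rho> \<subseteq> \<sigma>" "card \<rho> = d - 1" by (meson obtain_subset_with_card_n)
    then show "\<sigma> \<in> (\<Union>\<rho>\<in>R. {\<sigma>\<in>top. \<rho> \<subseteq> \<sigma>})" using \<sigma> closed unfolding R_def top_def by blast
  qed
  then have "card top \<le> card (\<Union>\<rho>\<in>R. {\<sigma>\<in>top. \<rho> \<subseteq> \<sigma>})"
    using finR finK by (intro card_mono) (auto simp: top_def)
  also have "\<dots> \<le> (\<Sum>\<rho>\<in>R. card {\<sigma>\<in>top. \<rho> \<subseteq> \<sigma>})" using finR by (rule card_UN_le)
  also have "\<dots> \<le> (\<Sum>\<rho>\<in>R. minor_bound 6 * card (W \<rho>))" using link by (rule sum_mono)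
  also have "\<dots> = minor_bound 6 * card (Sigma R W)" using finR finW by (simp add: sum_distrib_left)
  also have "card (Sigma R W) \<le> card (Sigma {\<sigma>\<in>K. card \<sigma> = d} (\<lambda>\<sigma>. \<sigma>))"
  proof (rule card_inj_on_le[of "\<lambda>(\<rho>, v). (insert v \<rho>, v)"])
    show "inj_on (\<lambda>(\<rho>, v). (insert v \<rho>, v)) (Sigma R W)"
      by (rule inj_onI) (auto simp: W_def dest: insert_ident[THEN iffD1, rotated 2])
    show "(\<lambda>(\<rho>, v). (insert v \<rho>, v)) ` Sigma R W \<subseteq> Sigma {\<sigma>\<in>K. card \<sigma> = d} (\<lambda>\<sigma>. \<sigma>)"
      using d finf by (auto simp: R_def W_def)
    show "finite (Sigma {\<sigma>\<in>K. card \<sigma> = d} (\<lambda>\<sigma>. \<sigma>))" using finK finf by auto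
  qed
  also have "card (Sigma {\<sigma>\<in>K. card \<sigma> = d} (\<lambda>\<sigma>. \<sigma>)) = (\<Sum>\<sigma>\<in>{\<sigma>\<in>K. card \<sigma> = d}. card \<sigma>)"
    using finK finf by simp
  also have "\<dots> = d * num_faces (d - 1) K" using d by (simp add: num_faces_def)
  finally show ?thesis by (simp add: num_faces_def top_def mult.assoc)
qed

text \<open>
  A \<open>j\<close>-face is covered by one of its \<open>i\<close>-faces and a list of the \<open>j - i\<close> remaining vertices.
\<close>
lemma num_faces_higher:
  fixes K :: "'v set set"
  assumes K: "abstract_complex K" and n: "card (\<Union>K) = n" and ij: "i \<le> j"
  shows "num_faces j K \<le> num_faces i K * n ^ (j - i)"
proof -
  have finK: "finite K" and finf: "\<And>\<sigma>. \<sigma> \<in> K \<Longrightarrow> finite \<sigma>" and closed: "\<And>\<sigma> \<tau>. \<sigma> \<in> K \<Longrightarrow> \<tau> \<subseteq> \<sigma> \<Longrightarrow> \<tau> \<in> K"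
    using K unfolding abstract_complex_def by blast+
  have finV: "finite (\<Union>K)" using finK finf by blast
  define Lst where "Lst = {xs. set xs \<subseteq> \<Union>K \<and> length xs = j - i}"
  define Fi where "Fi = {\<sigma>\<in>K. card \<sigma> = i + 1}"
  have fin: "finite (Fi \<times> Lst)" unfolding Fi_def Lst_def using finK finite_lists_length_eq[OF finV] by simp
  have "{\<sigma>\<in>K. card \<sigma> = j + 1} \<subseteq> (\<lambda>(\<tau>, xs). \<tau> \<union> set xs) ` (Fi \<times> Lst)"
  proof
    fix \<sigma> assume "\<sigma> \<in> {\<sigma>\<in>K. card \<sigma> = j + 1}"
    then have \<sigma>: "\<sigma> \<in> K" "card \<sigma> = j + 1" by auto
    obtain xs where xs: "set xs = \<sigma>" "distinct xs" using finite_distinct_list finf \<sigma>(1) by blast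
    have len: "length xs = j + 1" using xs \<sigma>(2) distinct_card by metis
    have "set (take (i + 1) xs) \<in> Fi"
      unfolding Fi_def using closed[OF \<sigma>(1), of "set (take (i + 1) xs)"] xs len ij
      by (auto simp: distinct_card dest: in_set_takeD)
    moreover have "drop (i + 1) xs \<in> Lst"
      unfolding Lst_def using xs \<sigma>(1) len by (auto dest: in_set_dropD)
    moreover have "\<sigma> = set (take (i + 1) xs) \<union> set (drop (i + 1) xs)"
      using xs(1) by (metis append_take_drop_id set_append)
    ultimately show "\<sigma> \<in> (\<lambda>(\<tau>, xs). \<tau> \<union> set xs) ` (Fi \<times> Lst)"
      by (intro image_eqI[of _ _ "(set (take (i + 1) xs), drop (i + 1) xs)"]) auto
  qed
  then have "card {\<sigma>\<in>K. card \<sigma> = j + 1} \<le> card (Fi \<times> Lst)" by (rule surj_card_le[OF fin])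
  also have "\<dots> = num_faces i K * n ^ (j - i)"
    unfolding Lst_def Fi_def num_faces_def card_cartesian_product using card_lists_length_eq[OF finV] n by simp
  finally show ?thesis by (simp add: num_faces_def)
qed

lemma ceiling_half:
  "\<lceil>(real d + 1) / 2\<rceil> = int ((d + 2) div 2)"
proof (cases "even d")
  case True
  then obtain c where "d = 2 * c" by (auto elim: evenE)
  then show ?thesis by (intro ceiling_unique) auto
next
  case False
  then obtain c where "d = 2 * c + 1" by (auto elim: oddE)
  then show ?thesis by (intro ceiling_unique) auto
qed

theorem theorem14:
  fixes d :: nat
  assumes "d \<ge> 3" and "CARD('k::finite) = d + 1"
  shows "\<exists>C::real. \<forall>(\<Sigma> :: nat set set) (n :: nat).
           abstract_complex \<Sigma> \<and> complex_dim \<Sigma> = int d \<and> card (\<Union>\<Sigma>) = n \<and>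
           PL_embeddable TYPE(real ^ 'k) \<Sigma> \<longrightarrow>
           real (num_faces d \<Sigma>) \<le>
             C * real n powr (real d - 3 powr (- real_of_int \<lceil>(real d + 1) / 2\<rceil>))"
proof -
  define m where "m = (d + 2) div 2"
  have m: "m \<ge> 1" "m \<le> d - 1" "d + 1 + 2 = 2 * m + 1 \<or> d + 1 = 2 * m"
    using assms(1) unfolding m_def by auto
  have exponent: "3 powr (- real_of_int \<lceil>(real d + 1) / 2\<rceil>) = 3 powr (- real m)"
    unfolding ceiling_half m_def by simp
  define c where "c = minor_bound 6"
  have "real (num_faces d \<Sigma>) \<le> (3 * real (c * d)) * real n powr (real d - 3 powr (- real m))"
    if \<Sigma>: "abstract_complex \<Sigma>" "card (\<Union>\<Sigma>) = n" "PL_embeddable TYPE(real ^ 'k) \<Sigma>"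
    for \<Sigma> :: "nat set set" and n
  proof (cases "n \<ge> 1")
    case False
    have "\<not> (\<sigma> \<in> \<Sigma> \<and> card \<sigma> = d + 1)" for \<sigma>
    proof
      assume s: "\<sigma> \<in> \<Sigma> \<and> card \<sigma> = d + 1"
      have "finite (\<Union>\<Sigma>)" using \<Sigma>(1) unfolding abstract_complex_def by blast
      then have "card \<sigma> \<le> card (\<Union>\<Sigma>)" using s by (intro card_mono) auto
      then show False using s False \<Sigma>(2) by simp
    qed
    then have "{\<sigma>\<in>\<Sigma>. card \<sigma> = d + 1} = {}" by blast
    then have "num_faces d \<Sigma> = 0" unfolding num_faces_def by (simp only: card.empty)
    then show ?thesis by simp
  next
    case True
    have n0: "real n > 0" using True by simp
    have "num_faces d \<Sigma> \<le> c * d * num_faces (d - 1) \<Sigma>"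
      unfolding c_def using num_faces_codim1[OF \<Sigma>(1,3) assms(2)] assms(1) by simp
    also have "\<dots> \<le> c * d * (num_faces m \<Sigma> * n ^ (d - 1 - m))"
      using num_faces_higher[OF \<Sigma>(1,2) m(2)] by simp
    finally have "real (num_faces d \<Sigma>) \<le> real (c * d * (num_faces m \<Sigma> * n ^ (d - 1 - m)))"
      using of_nat_le_iff by blast
    also have "\<dots> = real (c * d) * (real (num_faces m \<Sigma>) * real n ^ (d - 1 - m))" by simp
    also have "\<dots> \<le> real (c * d) * (3 * real n powr (real (Suc m) - 3 powr (- real m)) * real n ^ (d - 1 - m))"
      using sparse_middle_faces[OF \<Sigma>(1,3) _ m(1) \<Sigma>(2) True] m(3) assms(2)
      by (intro mult_left_mono mult_right_mono) auto
    also have "\<dots> = (3 * real (c * d)) * (real n powr (real (Suc m) - 3 powr (- real m)) * real n powr real (d - 1 - m))"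
      using n0 by (simp add: powr_realpow)
    also have "real n powr (real (Suc m) - 3 powr (- real m)) * real n powr real (d - 1 - m) = real n powr (real d - 3 powr (- real m))"
    proof -
      have "real (Suc m) + real (d - 1 - m) = real d" using m(2) assms(1) by simp
      then show ?thesis unfolding powr_add[symmetric] by (intro arg_cong[of _ _ "\<lambda>z. real n powr z"]) linarith
    qed
    finally show ?thesis .
  qed
  then show ?thesis unfolding exponent by blast
qed

end
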